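(* Let $F$ be the cyclic quartic field defined by $a,b,c,d$. Let $p_I\ge 1$ be a divisor of $d$ and let $q_J\ge 1$ be a divisor of $a$ such that $d$ is a quadratic non-residue modulo $q$ for each prime divisor $q$ of $q_J$. Let $P_I$ be the unique ideal of $\mathcal{O}_F$ of norm $p_I$ and $Q_J$ the unique ideal of $\mathcal{O}_F$ of norm $q_J^2$. (i) The lattice $P_I$ is well-rounded if and only if $d\equiv 1\pmod 4$, $b\equiv 0\pmod 2$, $a+b\equiv 1\pmod 4$ and one of the following conditions is satisfied: - $|a|=1$ and $\frac15 d\le p_I^2\le 5d$; - $|a|=3$ and $d\le p_I^2\le 9d$; - $|a|=5$ and $\frac73 d\le p_I^2\le 5d$. (ii) The lattice $Q_J$ is well-rounded if and only if $d=5$, $b=2$, $c=1$ and $|a|\le q_J^2\le 5|a|$.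
   Context: Cyclic quartic fields: $a,b,c,d$ are integers with $a$ squarefree and odd, $d=b^2+c^2$ squarefree, $b>0$, $c>0$, $\gcd(a,d)=1$; $\beta=\sqrt{a(d-b\sqrt d)}$ and $F=\mathbb{Q}(\beta)$, with defining polynomial $x^4-2adx^2+a^2c^2d$. $F$ is a cyclic quartic field, totally real if $a>0$ and totally imaginary if $a<0$. All ideals are nonzero integral ideals of the ring of integers $\mathcal{O}_F$. An ideal is viewed as a full rank lattice in $F\otimes\mathbb{R}\cong\mathbb{R}^4$ with Euclidean norm $\|\delta\|^2=\sum_{\tau}|\tau(\delta)|^2$, the sum over all four embeddings $\tau:F\to\mathbb{C}$. A full rank lattice in $\mathbb{R}^n$ is well-rounded (WR) if its nonzero vectors of minimal norm contain $n$ linearly independent vectors.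
   Formalization: In (ii) the condition a+b≡1 (mod 4) is added to the right-hand side; without it (ii) is false, e.g. for a=1, b=2, c=1, d=5, q_J=1, where F is totally real and the only shortest vectors of O_F are ±1. *)

theory Defs
  imports
    "HOL-Analysis.Analysis"
    "HOL-Number_Theory.Residues"
    "HOL-Computational_Algebra.Squarefree"
    "HOL-Algebra.Algebraic_Closure_Type"
    "HOL-Algebra.Generated_Fields"
    "HOL-Algebra.QuotRing"
begin

abbreviation complex_ring :: "complex ring" where
  "complex_ring \<equiv> ring_of_type_algebra"

text \<open>
  Number fields are realised as subfields of the complex numbers. For negative \<open>a\<close> the
  radicand below is a negative real number, and \<^const>\<open>csqrt\<close> picks one of its two
  square roots; both generate the same field.
\<close>

definition cyclic_quartic_gen :: "int \<Rightarrow> int \<Rightarrow> int \<Rightarrow> complex" where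
  "cyclic_quartic_gen a b d =
     csqrt (complex_of_real (of_int a * (of_int d - of_int b * sqrt (of_int d))))"

definition cyclic_quartic_field :: "int \<Rightarrow> int \<Rightarrow> int \<Rightarrow> complex set" where
  "cyclic_quartic_field a b d = generate_field complex_ring {cyclic_quartic_gen a b d}"

definition ring_of_integers :: "complex set \<Rightarrow> complex ring" where
  "ring_of_integers F = complex_ring\<lparr>carrier := {x \<in> F. algebraic_int x}\<rparr>"

definition nonzero_ideal_of_norm :: "complex set \<Rightarrow> nat \<Rightarrow> complex set \<Rightarrow> bool" where
  "nonzero_ideal_of_norm F n I \<longleftrightarrow>
     ideal I (ring_of_integers F) \<and> I \<noteq> {0} \<and> order (ring_of_integers F Quot I) = n"

text \<open>
  Embeddings are made \<^const>\<open>extensional\<close> so that two of them are equal as functions iff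
  they agree on \<open>F\<close>.
\<close>

definition embeddings :: "complex set \<Rightarrow> (complex \<Rightarrow> complex) set" where
  "embeddings F = ring_hom (complex_ring\<lparr>carrier := F\<rparr>) complex_ring \<inter> extensional F"

text \<open>
  For an enumeration \<open>\<tau>\<close> of the embeddings of \<open>F\<close>, the norm of \<open>complex ^ 'n\<close> restricts
  to the norm whose square is \<open>\<Sum>i\<in>UNIV. (cmod (\<tau> i x))\<^sup>2\<close>. The real vector space
  \<open>F \<otimes> \<real>\<close> is the real span of the image of \<open>F\<close>; its real dimension is the degree of \<open>F\<close>,
  half that of the ambient space.
\<close>

definition canonical_embedding ::
  "('n::finite \<Rightarrow> complex \<Rightarrow> complex) \<Rightarrow> complex \<Rightarrow> complex ^ 'n" where
  "canonical_embedding \<tau> x = (\<chi> i. \<tau> i x)"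

definition minkowski_space ::
  "('n::finite \<Rightarrow> complex \<Rightarrow> complex) \<Rightarrow> complex set \<Rightarrow> (complex ^ 'n) set" where
  "minkowski_space \<tau> F = span (canonical_embedding \<tau> ` F)"

definition minimal_vectors :: "'a::euclidean_space set \<Rightarrow> 'a set" where
  "minimal_vectors L = {v \<in> L. v \<noteq> 0 \<and> (\<forall>w\<in>L. w \<noteq> 0 \<longrightarrow> norm v \<le> norm w)}"

text \<open>Intended for full rank lattices \<open>L\<close> in the real subspace \<open>V\<close>.\<close>

definition well_rounded :: "'a::euclidean_space set \<Rightarrow> 'a set \<Rightarrow> bool" where
  "well_rounded V L \<longleftrightarrow>
     (\<exists>B \<subseteq> minimal_vectors L. finite B \<and> independent B \<and> card B = dim V)"

definition well_rounded_ideal ::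
  "('n::finite \<Rightarrow> complex \<Rightarrow> complex) \<Rightarrow> complex set \<Rightarrow> complex set \<Rightarrow> bool" where
  "well_rounded_ideal \<tau> F I \<longleftrightarrow>
     well_rounded (minkowski_space \<tau> F) (canonical_embedding \<tau> ` I)"

end

theory Submission
  imports Defs "HOL-Algebra.Sylow"
begin

text \<open>
  Write \<open>s = \<surd>d\<close>, let \<open>\<beta>\<close> be the given generator and \<open>\<beta>' = a c s / \<beta>\<close>, so that \<open>\<beta>'\<^sup>2 = a (d + b s)\<close>.
  Everything is explicit in the \<open>\<rat>\<close>-basis \<open>1, s, \<beta>, \<beta>'\<close> of \<open>F\<close>: the map
  \<open>s \<mapsto> -s, \<beta> \<mapsto> \<beta>' \<mapsto> -\<beta>\<close> generates the Galois group, and the cross terms in the sum over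
  the four embeddings cancel, so that
  \<open>\<parallel>x + y s + z \<beta> + w \<beta>'\<parallel>\<^sup>2 = 4 (x\<^sup>2 + d y\<^sup>2 + |a| d (z\<^sup>2 + w\<^sup>2))\<close>.
  The basis is therefore orthogonal, and every ideal becomes a lattice in \<open>\<rat>\<^sup>4\<close> with a diagonal form.

  Integers have coordinates in \<open>1/4 \<int>\<close>. The reason is that \<open>a d\<close> is squarefree: traces and norms of an
  integer \<open>x + y s + z \<beta> + w \<beta>'\<close> are integers, and they make \<open>a d (4z)\<^sup>2\<close> and \<open>a d (4w)\<^sup>2\<close> integers. Which
  quadruples over \<open>1/4 \<int>\<close> are integral is then a question of congruences with three outcomes. If \<open>d\<close>
  is even, the integers are \<open>\<int>[s, \<beta>, \<beta>']\<close>. If \<open>d\<close> is odd and \<open>2\<close> ramifies in \<open>F\<close>, every integer has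
  the form \<open>(x + y s)/2 + (z \<beta> + w \<beta>')/2\<close> with integers \<open>x \<equiv> y\<close> and \<open>z \<equiv> w\<close> modulo \<open>2\<close>. If \<open>d\<close> is odd,
  \<open>b\<close> even and \<open>a + b \<equiv> 1\<close> modulo \<open>4\<close>, the numerators over \<open>4\<close> are either all even and form a scaled copy of the
  lattice \<open>D\<^sub>4\<close>, or all odd and subject to one congruence modulo \<open>4\<close>.

  The ideals are \<open>P = {\<delta>. p | x}\<close> and \<open>Q = {\<delta>. q | x, q | y}\<close>. They are the only ones of their
  norm because the quotient ring by any such ideal is reduced: if \<open>t\<^sup>2 = 0\<close> in a finite commutative ring \<open>T\<close>, then
  \<open>|tT|\<^sup>2\<close> divides \<open>|T|\<close>. For \<open>|T| = p\<close>, which is squarefree, this gives \<open>t = 0\<close>. For \<open>|T| = q\<^sup>2\<close> the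
  group \<open>tT\<close> has squarefree order, hence is cyclic, so \<open>s\<close> acts on it as an integer \<open>k\<close> with
  \<open>k\<^sup>2 \<equiv> d\<close> modulo its order, against the assumption on \<open>d\<close> unless \<open>t = 0\<close>. The ideal therefore contains
  \<open>p, s, \<beta>, \<beta>'\<close>, respectively \<open>q, \<beta>, \<beta>'\<close>, and these elements force equality with \<open>P\<close> or \<open>Q\<close>.

  It remains to minimise the form on each lattice. In the first two cases the lattice is
  an orthogonal sum of smaller ones, and equality of the minima of the parts contradicts the arithmetic of \<open>d\<close>. In the
  last case the form takes, after scaling, the values \<open>u, v, t, t\<close> at a quarter of the shortest lattice vectors on the four axes;
  the lattice is well-rounded iff the shortest odd vectors, of value \<open>u + v + 2t\<close>, are minimal, because shorter vectors of
  \<open>D\<^sub>4\<close> of a common value cannot involve all axes. For \<open>u = p\<^sup>2, v = d\<close> and for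
  \<open>u = q\<^sup>2, v = d q\<^sup>2\<close>, both with \<open>t = |a| d\<close>, these inequalities become the stated ones.
\<close>

section \<open>Nilpotent elements of finite commutative rings\<close>

lemma (in group) card_subgroup_dvd:
  assumes "subgroup H G" "subgroup K G" "H \<subseteq> K" "finite (carrier G)"
  shows "card H dvd card K"
proof -
  have K: "group (G\<lparr>carrier := K\<rparr>)"
    using assms(2) by (simp add: subgroup_imp_group)
  have "subgroup H (G\<lparr>carrier := K\<rparr>)"
    using assms by (simp add: subgroup_incl)
  from group.lagrange[OF K this] show ?thesis
    by (simp add: order_def) (metis dvd_triv_right)
qed

text \<open>Cauchy's theorem gives an element of order \<open>r\<close>, and its order divides every exponent of the group.\<close>

lemma (in group) pow_eq_one_imp_dvd_order:
  assumes fin: "finite (carrier G)" and pow: "\<And>x. x \<in> carrier G \<Longrightarrow> x [^] n = \<one>"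
    and r: "Factorial_Ring.prime r" "r dvd order G"
  shows "r dvd n"
proof -
  obtain m where m: "order G = r ^ 1 * m" using r(2) by auto
  obtain H where H: "subgroup H G" "card H = r ^ 1"
    using sylow_thm[OF r(1) is_group m fin] by blast
  have "r > 1" using r(1) by (rule prime_gt_1_nat)
  then have "H \<noteq> {\<one>}" using H(2) by auto
  then obtain h where h: "h \<in> H" "h \<noteq> \<one>"
    using subgroup.one_closed[OF H(1)] by blast
  have hG: "h \<in> carrier G" by (rule subgroup.mem_carrier[OF H(1) h(1)])
  have gH: "group (G\<lparr>carrier := H\<rparr>)" using H(1) by (simp add: subgroup_imp_group)
  have "h [^]\<^bsub>G\<lparr>carrier := H\<rparr>\<^esub> order (G\<lparr>carrier := H\<rparr>) = \<one>"
    using group.pow_order_eq_1[OF gH, of h] h(1) by simp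
  then have "h [^] r = \<one>"
    using H by (simp add: order_def nat_pow_consistent[symmetric])
  then have "ord h dvd r" using pow_eq_id[OF hG] by blast
  moreover have "ord h \<noteq> 1" using ord_eq_1[OF hG] h(2) by blast
  ultimately have "ord h = r" using r(1) by (metis prime_nat_iff)
  moreover have "ord h dvd n" using pow_eq_id[OF hG] pow[OF hG] by blast
  ultimately show ?thesis by simp
qed

definition (in cring) multiples :: "'a \<Rightarrow> 'a set" where
  "multiples t = (\<lambda>x. x \<otimes> t) ` carrier R"

lemma (in cring) mult_right_hom:
  assumes t: "t \<in> carrier R"
  shows "group_hom (add_monoid R) (add_monoid R) (\<lambda>x. x \<otimes> t)"
  using t by (auto intro!: group_hom.intro group_hom_axioms.intro homI a_group l_distr)

lemma (in cring) subgroup_multiples: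
  assumes t: "t \<in> carrier R"
  shows "subgroup (multiples t) (add_monoid R)"
  unfolding multiples_def using group_hom.img_is_subgroup[OF mult_right_hom[OF t]] by simp

text \<open>
  Multiplication by \<open>t\<close> has image \<open>tR\<close> and kernel the annihilator of \<open>t\<close>, so \<open>|R| = |tR| |Ann t|\<close>; as
  \<open>t\<^sup>2 = 0\<close>, the group \<open>tR\<close> lies in \<open>Ann t\<close> and Lagrange's theorem applies a second time.
\<close>

lemma (in cring) card_multiples_square_dvd:
  assumes t: "t \<in> carrier R" "t \<otimes> t = \<zero>" and fin: "finite (carrier R)"
  shows "(card (multiples t))\<^sup>2 dvd order R"
proof -
  interpret h: group_hom "add_monoid R" "add_monoid R" "\<lambda>x. x \<otimes> t"
    by (rule mult_right_hom[OF t(1)])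
  interpret h': group_hom "add_monoid R" "(add_monoid R)\<lparr>carrier := multiples t\<rparr>" "\<lambda>x. x \<otimes> t"
    using t(1) add.subgroup_imp_group[OF subgroup_multiples[OF t(1)]]
    by (auto intro!: group_hom.intro group_hom_axioms.intro homI a_group l_distr
      simp: multiples_def)
  define N where "N = kernel (add_monoid R) (add_monoid R) (\<lambda>x. x \<otimes> t)"
  have N: "subgroup N (add_monoid R)" unfolding N_def by (rule h.subgroup_kernel)
  have N': "N = kernel (add_monoid R) ((add_monoid R)\<lparr>carrier := multiples t\<rparr>) (\<lambda>x. x \<otimes> t)"
    unfolding N_def kernel_def by simp
  have "(\<lambda>x. x \<otimes> t) ` carrier (add_monoid R) = carrier ((add_monoid R)\<lparr>carrier := multiples t\<rparr>)"
    by (simp add: multiples_def)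
  from h'.FactGroup_iso_set[OF this]
  have "card (rcosets\<^bsub>add_monoid R\<^esub> N) = card (multiples t)"
    unfolding N'[symmetric] by (auto simp: iso_def FactGroup_def dest: bij_betw_same_card)
  with add.lagrange[OF N] have eq: "card (multiples t) * card N = order R"
    by (simp add: order_def)
  have "multiples t \<subseteq> N"
    using t by (auto simp: multiples_def N_def kernel_def m_assoc)
  then have "card (multiples t) dvd card N"
    using add.card_subgroup_dvd[OF subgroup_multiples[OF t(1)] N] fin by simp
  then show ?thesis unfolding eq[symmetric] by (simp add: power2_eq_square mult_dvd_mono)
qed

lemma (in cring) card_multiples_eq_1D:
  assumes "t \<in> carrier R" "card (multiples t) = 1"
  shows "t = \<zero>"
proof -
  have "t \<in> multiples t" "\<zero> \<in> multiples t"
    using assms(1) by (auto simp: multiples_def intro: image_eqI[of _ _ \<one>] image_eqI[of _ _ \<zero>])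
  with assms(2) show ?thesis by (metis card_1_singletonE singletonD)
qed

lemma (in cring) nilpotent_eq_zero_if_squarefree_order:
  assumes "t \<in> carrier R" "t \<otimes> t = \<zero>" "finite (carrier R)" "squarefree (order R)"
  shows "t = \<zero>"
  using squarefreeD[OF assms(4) card_multiples_square_dvd[OF assms(1-3)]]
  by (intro card_multiples_eq_1D assms(1)) simp

text \<open>
  The additive order of \<open>t\<close> is an exponent of the group \<open>tR\<close>. By Cauchy's theorem a prime dividing \<open>|tR| / ord t\<close> would
  also divide \<open>ord t\<close>, and its square would divide \<open>|tR|\<close>.
\<close>

lemma (in cring) cyclic_multiples:
  assumes t: "t \<in> carrier R" and fin: "finite (carrier R)" and sqf: "squarefree (card (multiples t))"
  shows "add.ord t = card (multiples t)"
    and "multiples t = {[k] \<cdot> t | k::int. True}"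
proof -
  let ?J = "(add_monoid R)\<lparr>carrier := multiples t\<rparr>"
  have J: "group ?J" by (rule add.subgroup_imp_group[OF subgroup_multiples[OF t]])
  have finJ: "finite (multiples t)" using fin by (simp add: multiples_def)
  have tJ: "t \<in> multiples t" using t by (auto simp: multiples_def intro: image_eqI[of _ _ \<one>])
  have pw: "x [^]\<^bsub>?J\<^esub> n = [n] \<cdot> x" for x and n :: nat
    by (simp add: add_pow_def nat_pow_def)
  have kill: "[add.ord t] \<cdot> x = \<zero>" if x: "x \<in> multiples t" for x
  proof -
    obtain y where y: "y \<in> carrier R" "x = y \<otimes> t" using x by (auto simp: multiples_def)
    have "[add.ord t] \<cdot> x = y \<otimes> ([add.ord t] \<cdot> t)" unfolding y(2) using y(1) t by (rule add_pow_rdistr[symmetric])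
    also have "[add.ord t] \<cdot> t = \<zero>" using add.pow_ord_eq_1[of t] t by simp
    finally show ?thesis using y by simp
  qed
  have dvd1: "add.ord t dvd card (multiples t)"
  proof -
    have "t [^]\<^bsub>?J\<^esub> order ?J = \<one>\<^bsub>?J\<^esub>"
      using group.pow_order_eq_1[OF J] tJ by simp
    then have "[card (multiples t)] \<cdot> t = \<zero>" unfolding pw by (simp add: order_def)
    then show ?thesis using add.pow_eq_id[of t "card (multiples t)"] t by simp
  qed
  then obtain e where e: "card (multiples t) = add.ord t * e" by auto
  have "e = 1"
  proof (rule ccontr)
    assume "e \<noteq> 1"
    then obtain r where r: "Factorial_Ring.prime r" "r dvd e" using prime_factor_nat by blast
    have "x [^]\<^bsub>?J\<^esub> add.ord t = \<one>\<^bsub>?J\<^esub>" if "x \<in> carrier ?J" for x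
      using kill that unfolding pw by simp
    moreover have "finite (carrier ?J)" "r dvd order ?J"
      using finJ r(2) by (simp_all add: order_def e)
    ultimately have "r dvd add.ord t"
      using group.pow_eq_one_imp_dvd_order[OF J] r(1) by blast
    then have "r\<^sup>2 dvd card (multiples t)" unfolding e power2_eq_square using r(2) by (rule mult_dvd_mono)
    then have "is_unit r" using squarefreeD[OF sqf] by blast
    then show False using r(1) by simp
  qed
  then show 1: "add.ord t = card (multiples t)" using e by simp
  have sub: "generate (add_monoid R) {t} \<subseteq> multiples t"
    using add.generate_subgroup_incl[of "{t}" "multiples t"] subgroup_multiples[OF t] tJ by simp
  have "card (generate (add_monoid R) {t}) = card (multiples t)"
    using add.generate_pow_card[of t] t 1 by simp
  with sub finJ have "generate (add_monoid R) {t} = multiples t"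
    by (simp add: card_subset_eq)
  then show "multiples t = {[k] \<cdot> t | k::int. True}"
    using add.generate_pow[of t] t by (auto simp: add_pow_def)
qed

text \<open>
  The order \<open>m\<close> of \<open>tR\<close> divides \<open>q\<close>, so \<open>tR = \<int>t\<close> and \<open>s t = k t\<close> for an integer \<open>k\<close>. Then \<open>d t = s\<^sup>2 t = k\<^sup>2 t\<close>, which
  makes \<open>d\<close> a square modulo every prime factor of \<open>m\<close>.
\<close>

lemma (in cring) nilpotent_eq_zero_if_no_root:
  fixes q :: nat and d :: int
  assumes t: "t \<in> carrier R" "t \<otimes> t = \<zero>" and fin: "finite (carrier R)"
    and ord: "order R = q\<^sup>2" "squarefree q"
    and s: "s \<in> carrier R" "s \<otimes> s = [d] \<cdot> \<one>"
    and nonres: "\<And>r. Factorial_Ring.prime r \<Longrightarrow> r dvd q \<Longrightarrow> \<not> QuadRes (int r) d"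
  shows "t = \<zero>"
proof (rule card_multiples_eq_1D[OF t(1)], rule ccontr)
  let ?m = "card (multiples t)"
  assume "?m \<noteq> 1"
  then obtain r where r: "Factorial_Ring.prime r" "r dvd ?m" using prime_factor_nat by blast
  have "?m\<^sup>2 dvd q\<^sup>2" using card_multiples_square_dvd[OF t fin] ord(1) by simp
  then have mq: "?m dvd q" by simp
  have sqf: "squarefree ?m" using squarefree_mono[OF mq ord(2)] .
  have "s \<otimes> t \<in> multiples t" using s(1) by (auto simp: multiples_def)
  then obtain k :: int where k: "s \<otimes> t = [k] \<cdot> t"
    using cyclic_multiples(2)[OF t(1) fin sqf] by auto
  have "[d] \<cdot> t = ([d] \<cdot> \<one>) \<otimes> t" using t(1) by (simp add: add_pow_ldistr_int)
  also have "\<dots> = s \<otimes> (s \<otimes> t)" unfolding s(2)[symmetric] using s(1) t(1) by (simp add: m_assoc)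
  also have "\<dots> = [k] \<cdot> (s \<otimes> t)" unfolding k using s(1) t(1) k by (simp add: add_pow_rdistr_int)
  also have "\<dots> = [(k * k)] \<cdot> t" unfolding k using t(1) by (simp add: add.int_pow_pow)
  finally have "[(k * k - d)] \<cdot> t = \<zero>"
    using t(1) add.int_pow_diff[of t "k*k" d] by (simp add: add.inv_solve_right)
  then have "int ?m dvd k * k - d"
    using add.int_pow_eq_id[of t "k*k-d"] t(1) cyclic_multiples(1)[OF t(1) fin sqf] by simp
  then have "int r dvd k * k - d" using r(2) by (meson dvd_trans int_dvd_int_iff)
  then have "[k\<^sup>2 = d] (mod int r)" by (simp add: cong_iff_dvd_diff power2_eq_square)
  then have "QuadRes (int r) d" unfolding QuadRes_def by blast
  then show False using nonres[OF r(1)] r(2) mq by (meson dvd_trans)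
qed

section \<open>The quartic field in coordinates\<close>

text \<open>The square of the denominator of \<open>r\<close> has to divide \<open>n\<close>.\<close>

lemma squarefree_mult_rat_square_Ints:
  fixes r :: rat and n :: int
  assumes "squarefree n" "of_int n * r\<^sup>2 \<in> \<int>"
  shows "r \<in> \<int>"
proof -
  obtain u v where uv: "quotient_of r = (u, v)" by fastforce
  have v: "v > 0" "coprime u v" using uv quotient_of_denom_pos quotient_of_coprime by auto
  have r: "r = of_int u / of_int v" using uv by (rule quotient_of_div)
  obtain m :: int where m: "of_int n * r\<^sup>2 = of_int m" using assms(2) by (auto elim: Ints_cases)
  have "of_int (n * u\<^sup>2) = (of_int (m * v\<^sup>2) :: rat)"
    using m v(1) unfolding r by (simp add: field_simps)
  then have "n * u\<^sup>2 = m * v\<^sup>2" unfolding of_int_eq_iff .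
  then have "v\<^sup>2 dvd n * u\<^sup>2" by simp
  moreover have "coprime (v\<^sup>2) (u\<^sup>2)" using v(2) by (simp add: coprime_commute)
  ultimately have "v\<^sup>2 dvd n" by (simp add: coprime_dvd_mult_left_iff)
  then have "v = 1" using squarefreeD[OF assms(1)] v(1) by fastforce
  then show ?thesis unfolding r by simp
qed

locale cyclic_quartic =
  fixes a b c d :: int
  assumes squarefree_a: "squarefree a" and odd_a: "odd a"
    and d_eq: "d = b\<^sup>2 + c\<^sup>2" and squarefree_d: "squarefree d"
    and b_pos: "b > 0" and c_pos: "c > 0" and coprime_a_d: "coprime a d"
begin

lemma d_ge_2: "d \<ge> 2"
  using b_pos c_pos zero_less_power[of b 2] zero_less_power[of c 2] unfolding d_eq by linarith

lemma a_nonzero: "a \<noteq> 0" using odd_a by auto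

lemma rat_square_ne_d:
  fixes r r' :: rat
  assumes "r'\<^sup>2 = of_int d * r\<^sup>2"
  shows "r = 0"
proof (rule ccontr)
  assume r: "r \<noteq> 0"
  have sq: "(r' / r)\<^sup>2 = of_int d" using assms r by (simp add: field_simps power_divide)
  have "r' / r \<in> \<int>"
    by (rule squarefree_mult_rat_square_Ints[of 1]) (simp_all add: sq)
  then obtain k :: int where "r' / r = of_int k" by (auto elim: Ints_cases)
  with sq have "of_int (k\<^sup>2) = (of_int d :: rat)" by simp
  then have k: "k\<^sup>2 = d" unfolding of_int_eq_iff .
  then have "k dvd 1" using squarefreeD[OF squarefree_d, of k] by simp
  then have "k\<^sup>2 = 1" by (metis abs_1 power2_abs power_one zdvd1_eq)
  with k d_ge_2 show False by simp
qed

definition s :: complex where "s = complex_of_real (sqrt (of_int d))"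
definition \<beta> :: complex where "\<beta> = cyclic_quartic_gen a b d"
definition \<beta>' :: complex where "\<beta>' = of_int (a * c) * s / \<beta>"

lemma s_s: "s * s = of_int d"
  using d_ge_2 unfolding s_def by (simp flip: of_real_mult)

lemma \<beta>_\<beta>: "\<beta> * \<beta> = of_int (a * d) - of_int (a * b) * s"
  using power2_csqrt[of "complex_of_real (of_int a * (of_int d - of_int b * sqrt (of_int d)))"]
  unfolding \<beta>_def cyclic_quartic_gen_def s_def by (simp add: power2_eq_square algebra_simps)

lemma s_nonzero: "s \<noteq> 0" using s_s d_ge_2 by auto

lemma \<beta>_nonzero: "\<beta> \<noteq> 0"
proof
  assume "\<beta> = 0"
  then have *: "of_int b * s = of_int d" using \<beta>_\<beta> a_nonzero by simp
  have "of_int (b * b * d) = of_int b * s * (of_int b * s)"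
    using s_s by (simp add: mult_ac)
  also have "\<dots> = of_int (d * d)" unfolding * by simp
  finally have "b * b * d = d * d" unfolding of_int_eq_iff .
  then have "b * b = d" using d_ge_2 by simp
  then show False using d_eq c_pos by (simp add: power2_eq_square)
qed

lemma \<beta>_\<beta>': "\<beta> * \<beta>' = of_int (a * c) * s"
  unfolding \<beta>'_def using \<beta>_nonzero by simp

lemmas field_relations = s_s \<beta>_\<beta>[unfolded of_int_mult] \<beta>_\<beta>'[unfolded of_int_mult]

lemma of_int_d_eq: "(of_int d :: 'r :: comm_ring_1) = of_int b * of_int b + of_int c * of_int c"
  unfolding d_eq by (simp add: power2_eq_square)

text \<open>
  Multiplication by \<open>s\<close> on \<open>\<rat>\<beta> + \<rat>\<beta>'\<close> is where \<open>d = b\<^sup>2 + c\<^sup>2\<close> enters. It is checked after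
  multiplying by \<open>\<beta>\<close>, since the product \<open>\<beta> \<beta>'\<close> is known by the choice of \<open>\<beta>'\<close>.
\<close>

lemma s_\<beta>: "s * \<beta> = of_int c * \<beta>' - of_int b * \<beta>"
proof -
  have "(s * \<beta>) * \<beta> = (of_int c * \<beta>' - of_int b * \<beta>) * \<beta>"
    using field_relations of_int_d_eq[where 'r = complex] by Groebner_Basis.algebra
  then show ?thesis using \<beta>_nonzero by simp
qed

lemma s_\<beta>': "s * \<beta>' = of_int c * \<beta> + of_int b * \<beta>'"
proof -
  have "of_int c * (s * \<beta>') = of_int c * (of_int c * \<beta> + of_int b * \<beta>')"
    using s_\<beta> s_s of_int_d_eq[where 'r = complex] by Groebner_Basis.algebra
  then show ?thesis using c_pos by simp
qed

lemma \<beta>'_\<beta>': "\<beta>' * \<beta>' = of_int (a * d) + of_int (a * b) * s"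
proof -
  have "of_int c * (\<beta>' * \<beta>') = of_int c * (of_int (a * d) + of_int (a * b) * s)"
    unfolding of_int_mult using s_\<beta> s_\<beta>' field_relations of_int_d_eq[where 'r = complex] by Groebner_Basis.algebra
  then show ?thesis using c_pos by simp
qed

definition el :: "rat \<Rightarrow> rat \<Rightarrow> rat \<Rightarrow> rat \<Rightarrow> complex" where
  "el x y z w = of_rat x + of_rat y * s + of_rat z * \<beta> + of_rat w * \<beta>'"

lemma el_add: "el x y z w + el x' y' z' w' = el (x + x') (y + y') (z + z') (w + w')"
  by (simp add: el_def of_rat_add algebra_simps)

lemma el_minus: "- el x y z w = el (- x) (- y) (- z) (- w)"
  by (simp add: el_def of_rat_minus)

lemma el_diff: "el x y z w - el x' y' z' w' = el (x - x') (y - y') (z - z') (w - w')"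
  by (simp add: el_def of_rat_diff algebra_simps)

lemma el_rat: "el x 0 0 0 = of_rat x"
  by (simp add: el_def)

lemma el_mult:
  "el x y z w * el x' y' z' w' =
    el (x * x' + of_int d * (y * y') + of_int (a * d) * (z * z' + w * w'))
       (x * y' + y * x' + of_int a * (of_int b * (w * w' - z * z') + of_int c * (z * w' + w * z')))
       (x * z' + z * x' - of_int b * (y * z' + z * y') + of_int c * (y * w' + w * y'))
       (x * w' + w * x' + of_int c * (y * z' + z * y') + of_int b * (y * w' + w * y'))"
proof -
  have *: "(U + Y * s + Z * \<beta> + W * \<beta>') * (U' + Y' * s + Z' * \<beta> + W' * \<beta>') =
      U * U' + (U * Y' + Y * U') * s + (U * Z' + Z * U') * \<beta> + (U * W' + W * U') * \<beta>'
      + Y * Y' * (s * s) + Z * Z' * (\<beta> * \<beta>) + W * W' * (\<beta>' * \<beta>')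
      + (Y * Z' + Z * Y') * (s * \<beta>) + (Y * W' + W * Y') * (s * \<beta>') + (Z * W' + W * Z') * (\<beta> * \<beta>')"
    for U Y Z W U' Y' Z' W'
    by (simp add: algebra_simps)
  show ?thesis
    unfolding el_def * s_s \<beta>_\<beta> \<beta>_\<beta>' \<beta>'_\<beta>' s_\<beta> s_\<beta>'
    by (simp add: of_rat_add of_rat_diff of_rat_mult algebra_simps)
qed

text \<open>This and the next lemma are the linear independence of \<open>1, s\<close> and of \<open>1, s, \<beta>, \<beta>'\<close> over \<open>\<rat>\<close>.\<close>

lemma quadratic_eq_0_iff: "of_rat x + of_rat y * s = 0 \<longleftrightarrow> x = 0 \<and> y = 0"
proof
  assume *: "of_rat x + of_rat y * s = 0"
  have "of_rat (x\<^sup>2) = (of_rat (of_int d * y\<^sup>2) :: complex)"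
  proof -
    have "of_rat x = - (of_rat y * s)" using * by (simp add: eq_neg_iff_add_eq_0)
    then have "of_rat x * of_rat x = of_rat y * of_rat y * (s * s)" by simp
    also have "\<dots> = of_rat (of_int d * y\<^sup>2)"
      unfolding s_s by (simp add: of_rat_mult power2_eq_square mult_ac)
    finally show ?thesis by (simp add: of_rat_mult power2_eq_square)
  qed
  then have "x\<^sup>2 = of_int d * y\<^sup>2" unfolding of_rat_eq_iff .
  moreover from this have "y = 0" by (rule rat_square_ne_d)
  ultimately show "x = 0 \<and> y = 0" by simp
qed simp

text \<open>
  A relation reads \<open>\<beta> (p + w s) = - c (x + y s)\<close>. Squaring it gives an equation in \<open>\<rat>(s)\<close> whose norm says that
  \<open>d (a c (p\<^sup>2 - d w\<^sup>2))\<^sup>2\<close> is a rational square, because \<open>a (d - b s)\<close> has norm \<open>a\<^sup>2 c\<^sup>2 d\<close>. As \<open>d\<close> is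
  not a square, everything vanishes.
\<close>

lemma el_eq_0_iff: "el x y z w = 0 \<longleftrightarrow> x = 0 \<and> y = 0 \<and> z = 0 \<and> w = 0"
proof
  assume el0: "el x y z w = 0"
  define p where "p = of_int c * z + of_int b * w"
  have "of_int c * el x y z w = of_int c * (of_rat x + of_rat y * s) + \<beta> * (of_rat p + of_rat w * s)"
  proof -
    have "\<beta> * (of_rat p + of_rat w * s) =
        of_rat z * of_int c * \<beta> + of_rat w * (of_int b * \<beta>) + of_rat w * (s * \<beta>)"
      unfolding p_def by (simp add: of_rat_add of_rat_mult algebra_simps)
    then show ?thesis unfolding s_\<beta> el_def by (simp add: algebra_simps)
  qed
  then have "\<beta> * (of_rat p + of_rat w * s) = - (of_int c * (of_rat x + of_rat y * s))"
    using el0 by (simp add: eq_neg_iff_add_eq_0 add.commute)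
  then have "(\<beta> * \<beta>) * (of_rat p + of_rat w * s)\<^sup>2 = of_int c * of_int c * (of_rat x + of_rat y * s)\<^sup>2"
    by Groebner_Basis.algebra
  then have "(of_int (a * d) - of_int (a * b) * s) * (of_rat p + of_rat w * s)\<^sup>2
      - of_int c * of_int c * (of_rat x + of_rat y * s)\<^sup>2 = 0"
    unfolding \<beta>_\<beta> by simp
  also have "(of_int (a * d) - of_int (a * b) * s) * (of_rat p + of_rat w * s)\<^sup>2
      - of_int c * of_int c * (of_rat x + of_rat y * s)\<^sup>2 =
    of_rat (of_int a * of_int d * (p * p + of_int d * w * w) - 2 * of_int a * of_int b * of_int d * p * w
        - of_int c * of_int c * (x * x + of_int d * y * y))
    + of_rat (2 * of_int a * of_int d * p * w - of_int a * of_int b * (p * p + of_int d * w * w)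
        - 2 * of_int c * of_int c * x * y) * s"
  proof -
    have of_int_d: "of_int d = s * s" by (rule s_s[symmetric])
    show ?thesis
      by (simp add: of_rat_add of_rat_mult of_rat_diff of_int_d algebra_simps power2_eq_square)
  qed
  finally have
    E1: "of_int a * of_int d * (p * p + of_int d * w * w) - 2 * of_int a * of_int b * of_int d * p * w
        - of_int c * of_int c * (x * x + of_int d * y * y) = 0" and
    E2: "2 * of_int a * of_int d * p * w - of_int a * of_int b * (p * p + of_int d * w * w)
        - 2 * of_int c * of_int c * x * y = 0"
    unfolding quadratic_eq_0_iff by auto
  have "(of_int c * of_int c * (x\<^sup>2 - of_int d * y\<^sup>2))\<^sup>2 = of_int d * (of_int a * of_int c * (p\<^sup>2 - of_int d * w\<^sup>2))\<^sup>2"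
    using E1 E2 of_int_d_eq[where 'r = rat] by Groebner_Basis.algebra
  then have "of_int a * of_int c * (p\<^sup>2 - of_int d * w\<^sup>2) = 0" by (rule rat_square_ne_d)
  then have p: "p\<^sup>2 = of_int d * w\<^sup>2" using a_nonzero c_pos by simp
  then have w: "w = 0" by (rule rat_square_ne_d)
  with p have "p = 0" by simp
  with w have z: "z = 0" unfolding p_def using c_pos by simp
  from el0 show "x = 0 \<and> y = 0 \<and> z = 0 \<and> w = 0"
    using quadratic_eq_0_iff[of x y] w z unfolding el_def by simp
qed (simp add: el_def)

lemma el_eq_iff: "el x y z w = el x' y' z' w' \<longleftrightarrow> x = x' \<and> y = y' \<and> z = z' \<and> w = w'"
  using el_eq_0_iff[of "x - x'" "y - y'" "z - z'" "w - w'"] unfolding el_diff[symmetric] by simp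

definition K :: "complex set" where "K = {el x y z w | x y z w. True}"

lemma el_in_K [simp]: "el x y z w \<in> K" by (auto simp: K_def)

lemma K_cases:
  assumes "u \<in> K" obtains x y z w where "u = el x y z w"
  using assms by (auto simp: K_def)

lemma K_add: "u \<in> K \<Longrightarrow> v \<in> K \<Longrightarrow> u + v \<in> K"
  by (elim K_cases) (simp add: el_add)

lemma K_mult: "u \<in> K \<Longrightarrow> v \<in> K \<Longrightarrow> u * v \<in> K"
  by (elim K_cases) (simp add: el_mult)

lemma K_minus: "u \<in> K \<Longrightarrow> - u \<in> K"
  by (elim K_cases) (simp add: el_minus)

lemma K_rat: "of_rat r \<in> K"
  by (metis el_in_K el_rat)

text \<open>The conjugate of \<open>u\<close> over \<open>\<rat>(s)\<close> is \<open>v\<close>, so \<open>u v\<close> lies in \<open>\<rat>(s)\<close>, where inverses come from the norm.\<close>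

lemma K_inverse:
  assumes "u \<in> K"
  shows "inverse u \<in> K"
proof (cases "u = 0")
  case True
  then show ?thesis using K_rat[of 0] by simp
next
  case False
  obtain x y z w where u: "u = el x y z w" using assms by (rule K_cases)
  define v where "v = el x y (- z) (- w)"
  define m where "m = x * x + of_int d * (y * y) - of_int (a * d) * (z * z + w * w)"
  define n where "n = 2 * x * y + of_int a * (of_int b * (z * z - w * w) - 2 * of_int c * z * w)"
  have uv: "u * v = el m n 0 0"
    unfolding u v_def el_mult m_def n_def by (simp add: el_eq_iff algebra_simps)
  have "v \<noteq> 0" using False unfolding u v_def el_eq_0_iff by simp
  then have ne: "el m n 0 0 \<noteq> 0" using False uv by (metis mult_eq_0_iff)
  define N where "N = m\<^sup>2 - of_int d * n\<^sup>2"
  have mn: "el m n 0 0 * el m (- n) 0 0 = of_rat N"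
    unfolding el_mult N_def by (simp add: el_rat[symmetric] el_eq_iff power2_eq_square algebra_simps)
  have N: "N \<noteq> 0"
    using ne rat_square_ne_d[of m n] unfolding N_def el_eq_0_iff by auto
  have "u * (v * el m (- n) 0 0 * of_rat (inverse N)) = 1"
    using mn uv N by (simp add: mult.assoc[symmetric] of_rat_mult[symmetric] del: of_rat_mult)
  then have "inverse u = v * el m (- n) 0 0 * of_rat (inverse N)"
    by (rule inverse_unique)
  then show ?thesis by (simp add: v_def K_mult K_rat)
qed

end

lemma complex_ring_simps [simp]:
  "carrier complex_ring = UNIV" "mult complex_ring = (*)" "one complex_ring = 1"
  "zero complex_ring = 0" "add complex_ring = (+)"
  by (simp_all add: ring_of_type_algebra_def)

lemma a_inv_complex_ring [simp]: "\<ominus>\<^bsub>complex_ring\<^esub> u = - u"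
proof -
  interpret field complex_ring by (rule field_from_type_algebra)
  show ?thesis using minus_equality[of "- u" u] by simp
qed

lemma m_inv_complex_ring [simp]: "u \<noteq> 0 \<Longrightarrow> inv\<^bsub>complex_ring\<^esub> u = inverse u"
proof -
  interpret field complex_ring by (rule field_from_type_algebra)
  show "u \<noteq> 0 \<Longrightarrow> ?thesis" using comm_inv_char[of u "inverse u"] by simp
qed

context cyclic_quartic
begin

lemma field_eq_K: "cyclic_quartic_field a b d = K"
proof
  show "cyclic_quartic_field a b d \<subseteq> K"
  proof
    fix u assume "u \<in> cyclic_quartic_field a b d"
    then have "u \<in> generate_field complex_ring {\<beta>}"
      by (simp add: cyclic_quartic_field_def \<beta>_def)
    then show "u \<in> K"
    proof induction
      case one
      show ?case using K_rat[of 1] by simp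
    next
      case (incl h)
      have "\<beta> = el 0 0 1 0" by (simp add: el_def)
      with incl show ?case by simp
    qed (simp_all add: K_add K_mult K_minus K_inverse)
  qed
next
  let ?G = "generate_field complex_ring {\<beta>}"
  have one: "1 \<in> ?G" using generate_field.one[of complex_ring] by simp
  have add: "u + v \<in> ?G" if "u \<in> ?G" "v \<in> ?G" for u v
    using generate_field.eng_add[OF that] by simp
  have mult: "u * v \<in> ?G" if "u \<in> ?G" "v \<in> ?G" for u v
    using generate_field.eng_mult[OF that] by simp
  have minus: "- u \<in> ?G" if "u \<in> ?G" for u
    using generate_field.a_inv[OF that] by simp
  have zero: "0 \<in> ?G" using add[OF one minus[OF one]] by simp
  have inv: "inverse u \<in> ?G" if "u \<in> ?G" for u
    using generate_field.m_inv[OF that] zero by (cases "u = 0") auto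
  have nat: "of_nat n \<in> ?G" for n
    by (induction n) (auto simp: zero one add)
  have int: "of_int k \<in> ?G" for k
    by (cases k rule: int_cases2) (auto simp: nat minus)
  have rat: "of_rat r \<in> ?G" for r
  proof -
    obtain u v where "quotient_of r = (u, v)" by fastforce
    then have "r = of_int u / of_int v" by (rule quotient_of_div)
    then have "of_rat r = of_int u * inverse (of_int v :: complex)"
      by (simp add: of_rat_divide divide_inverse of_rat_mult of_rat_inverse)
    then show ?thesis by (simp add: mult inv int)
  qed
  have \<beta>: "\<beta> \<in> ?G" by (rule generate_field.incl) simp
  have "s = (of_int d * of_int a - \<beta> * \<beta>) * inverse (of_int (a * b))"
    unfolding \<beta>_\<beta> using a_nonzero b_pos by (simp add: field_simps)
  then have s: "s \<in> ?G"
    by (metis int mult inv minus add \<beta> diff_conv_add_uminus)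
  have \<beta>': "\<beta>' \<in> ?G"
    unfolding \<beta>'_def divide_inverse by (intro mult int inv \<beta> s)
  show "K \<subseteq> cyclic_quartic_field a b d"
    unfolding cyclic_quartic_field_def \<beta>_def[symmetric]
    by (auto simp: K_def el_def intro!: add mult rat s \<beta> \<beta>')
qed

end

section \<open>Galois group and the trace norm\<close>

context cyclic_quartic
begin

text \<open>A generator of the Galois group.\<close>

definition gal :: "complex \<Rightarrow> complex" where
  "gal u = (THE v. \<exists>x y z w. u = el x y z w \<and> v = el x (- y) (- w) z)"

lemma gal_el [simp]: "gal (el x y z w) = el x (- y) (- w) z"
  unfolding gal_def by (rule the_equality) (auto simp: el_eq_iff)

lemma gal_K: "u \<in> K \<Longrightarrow> gal u \<in> K"
  by (elim K_cases) simp

lemma gal_add: "u \<in> K \<Longrightarrow> v \<in> K \<Longrightarrow> gal (u + v) = gal u + gal v"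
  by (elim K_cases) (simp add: el_add)

lemma gal_mult: "u \<in> K \<Longrightarrow> v \<in> K \<Longrightarrow> gal (u * v) = gal u * gal v"
  by (elim K_cases) (simp add: el_mult el_eq_iff algebra_simps)

lemma gal_rat [simp]: "gal (of_rat r) = of_rat r"
  by (simp flip: el_rat)

lemma gal_1 [simp]: "gal 1 = 1"
  using gal_rat[of 1] by simp

definition emb :: "nat \<Rightarrow> complex \<Rightarrow> complex" where
  "emb k = restrict (gal ^^ k) K"

lemma emb_el:
  "emb 0 (el x y z w) = el x y z w"
  "emb 1 (el x y z w) = el x (- y) (- w) z"
  "emb 2 (el x y z w) = el x y (- z) (- w)"
  "emb 3 (el x y z w) = el x (- y) w (- z)"
  by (simp_all add: emb_def eval_nat_numeral)

lemma emb_embedding: "emb k \<in> embeddings K"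
proof -
  have K: "(gal ^^ k) u \<in> K" if "u \<in> K" for u
    using that by (induction k) (auto intro: gal_K)
  have "(gal ^^ k) (u + v) = (gal ^^ k) u + (gal ^^ k) v" if "u \<in> K" "v \<in> K" for u v
    using that by (induction k arbitrary: u v) (simp_all add: funpow_Suc_right gal_K gal_add del: funpow.simps)
  moreover have "(gal ^^ k) (u * v) = (gal ^^ k) u * (gal ^^ k) v" if "u \<in> K" "v \<in> K" for u v
    using that by (induction k arbitrary: u v) (simp_all add: funpow_Suc_right gal_K gal_mult del: funpow.simps)
  moreover have "(gal ^^ k) 1 = 1" by (induction k) auto
  ultimately show ?thesis
    using K_rat[of 1] by (auto simp: embeddings_def ring_hom_def emb_def K_add K_mult)
qed

lemma generators_in_K: "s \<in> K" "\<beta> \<in> K" "\<beta>' \<in> K"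
  using el_in_K[of 0 1 0 0] el_in_K[of 0 0 1 0] el_in_K[of 0 0 0 1] by (simp_all add: el_def)

lemma embedding_el:
  assumes "f \<in> embeddings K"
  shows "f (el x y z w) = of_rat x + of_rat y * f s + of_rat z * f \<beta> + of_rat w * f \<beta>'"
    and "f (of_rat r) = of_rat r"
proof -
  have add: "f (u + v) = f u + f v" and mult: "f (u * v) = f u * f v"
    if "u \<in> K" "v \<in> K" for u v
    using assms that by (auto simp: embeddings_def ring_hom_def)
  have one: "f 1 = 1" using assms by (auto simp: embeddings_def ring_hom_def)
  have zero: "f 0 = 0" using add[of 0 0] K_rat[of 0] by simp
  have minus: "f (- u) = - f u" if "u \<in> K" for u
    using add[OF that K_minus[OF that]] zero by (simp add: eq_neg_iff_add_eq_0 add.commute)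
  have nat: "f (of_nat n) = of_nat n" for n
  proof (induction n)
    case (Suc n)
    then show ?case using add[OF K_rat[of 1] K_rat[of "of_nat n"]] by (simp add: one)
  qed (simp add: zero)
  have int: "f (of_int k) = of_int k" for k
    using minus[OF K_rat[of "of_nat _"]] by (cases k rule: int_cases2) (auto simp: nat)
  have rat: "f (of_rat r) = of_rat r" for r
  proof -
    obtain u v where uv: "quotient_of r = (u, v)" by fastforce
    then have r: "r = of_int u / of_int v" by (rule quotient_of_div)
    have v: "v > 0" using uv by (rule quotient_of_denom_pos)
    have "f (of_rat r) * f (of_int v) = f (of_rat r * of_int v)"
      using mult[OF K_rat K_rat[of "of_int v"]] by simp
    also have "of_rat r * of_int v = (of_int u :: complex)"
      using v unfolding r by (simp add: of_rat_divide)
    finally show ?thesis using v unfolding int r by (simp add: of_rat_divide field_simps)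
  qed
  then show "f (of_rat r) = of_rat r" .
  note mem = generators_in_K
  show "f (el x y z w) = of_rat x + of_rat y * f s + of_rat z * f \<beta> + of_rat w * f \<beta>'"
    unfolding el_def by (simp add: add mult K_add K_mult K_rat mem rat)
qed

text \<open>An embedding sends \<open>s\<close> to \<open>\<plusminus>s\<close>; then \<open>\<beta>\<^sup>2\<close>, hence \<open>\<beta>\<close> up to sign, and finally \<open>\<beta>'\<close> are determined.\<close>

lemma embeddings_K: "embeddings K = {emb 0, emb 1, emb 2, emb 3}"
proof (intro equalityI subsetI)
  fix f assume f: "f \<in> embeddings K"
  note mem = generators_in_K
  have mult: "f (u * v) = f u * f v" if "u \<in> K" "v \<in> K" for u v
    using f that by (auto simp: embeddings_def ring_hom_def)
  note fel = embedding_el[OF f]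
  have "f s * f s = f (of_rat (of_int d))" using mult[OF mem(1,1)] s_s by simp
  then have "f s * f s = s * s" unfolding fel s_s by simp
  then have fs: "f s = s \<or> f s = - s" by (simp add: square_eq_iff)
  have "f \<beta> * f \<beta> = f (el (of_int (a * d)) (- of_int (a * b)) 0 0)"
    using mult[OF mem(2,2)] \<beta>_\<beta> by (simp add: el_def of_rat_minus of_rat_mult)
  then have ff: "f \<beta> * f \<beta> = of_int (a * d) - of_int (a * b) * f s"
    unfolding fel by (simp add: of_rat_minus of_rat_mult)
  have "f \<beta> * f \<beta>' = f (el 0 (of_int (a * c)) 0 0)"
    using mult[OF mem(2,3)] \<beta>_\<beta>' by (simp add: el_def of_rat_mult)
  then have ff': "f \<beta> * f \<beta>' = of_int (a * c) * f s"
    unfolding fel by (simp add: of_rat_mult)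
  have fext: "f \<in> extensional K" using f by (simp add: embeddings_def)
  have eqI: "f = emb k" if "\<And>x y z w. f (el x y z w) = emb k (el x y z w)" for k
  proof (rule extensionalityI[OF fext])
    show "emb k \<in> extensional K" by (simp add: emb_def)
  qed (use that in \<open>auto elim: K_cases\<close>)
  have \<beta>'0: "\<beta>' \<noteq> 0" using \<beta>_\<beta>' a_nonzero c_pos s_nonzero by auto
  from fs show "f \<in> {emb 0, emb 1, emb 2, emb 3}"
  proof
    assume s: "f s = s"
    have "f \<beta> * f \<beta> = \<beta> * \<beta>" using ff unfolding s \<beta>_\<beta> .
    then have "f \<beta> = \<beta> \<or> f \<beta> = - \<beta>" by (simp add: square_eq_iff)
    then show ?thesis
    proof
      assume b: "f \<beta> = \<beta>"
      have "f \<beta>' = \<beta>'" using ff' \<beta>_nonzero unfolding b s \<beta>_\<beta>'[symmetric] by simp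
      then have "f = emb 0" by (intro eqI) (simp only: fel emb_el s b, simp add: el_def)
      then show ?thesis by simp
    next
      assume b: "f \<beta> = - \<beta>"
      have "- \<beta> * f \<beta>' = - \<beta> * - \<beta>'" using ff' unfolding b s \<beta>_\<beta>'[symmetric] by simp
      moreover have "- \<beta> \<noteq> 0" using \<beta>_nonzero by simp
      ultimately have "f \<beta>' = - \<beta>'" by (metis mult_left_cancel)
      then have "f = emb 2" by (intro eqI) (simp only: fel emb_el s b, simp add: el_def of_rat_minus)
      then show ?thesis by simp
    qed
  next
    assume s: "f s = - s"
    have "f \<beta> * f \<beta> = \<beta>' * \<beta>'" using ff unfolding s \<beta>'_\<beta>' by simp
    then have "f \<beta> = \<beta>' \<or> f \<beta> = - \<beta>'" by (simp add: square_eq_iff)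
    then show ?thesis
    proof
      assume b: "f \<beta> = \<beta>'"
      have "\<beta>' * f \<beta>' = \<beta>' * - \<beta>" using ff' \<beta>_\<beta>' unfolding b s by (simp add: mult.commute)
      then have "f \<beta>' = - \<beta>" using \<beta>'0 by (metis mult_left_cancel)
      then have "f = emb 1" by (intro eqI) (simp only: fel emb_el s b, simp add: el_def of_rat_minus)
      then show ?thesis by simp
    next
      assume b: "f \<beta> = - \<beta>'"
      have "\<beta>' * f \<beta>' = \<beta>' * \<beta>" using ff' \<beta>_\<beta>' unfolding b s by (simp add: mult.commute)
      then have "f \<beta>' = \<beta>" using \<beta>'0 by (metis mult_left_cancel)
      then have "f = emb 3" by (intro eqI) (simp only: fel emb_el s b, simp add: el_def of_rat_minus)
      then show ?thesis by simp
    qed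
  qed
qed (use emb_embedding in auto)

lemma emb_distinct: "distinct [emb 0, emb 1, emb 2, emb 3]"
proof -
  have "distinct (map (\<lambda>f. f (el 0 0 1 0)) [emb 0, emb 1, emb 2, emb 3])"
    by (simp add: emb_el el_eq_iff del: One_nat_def)
  then show ?thesis by (simp only: distinct_map)
qed

lemma cmod_\<beta>: "(cmod \<beta>)\<^sup>2 = \<bar>of_int a\<bar> * (of_int d - of_int b * sqrt (of_int d))"
  and cmod_\<beta>': "(cmod \<beta>')\<^sup>2 = \<bar>of_int a\<bar> * (of_int d + of_int b * sqrt (of_int d))"
proof -
  have "of_int b * sqrt (of_int d) \<le> sqrt (of_int d) * sqrt (of_int d :: real)"
    using d_eq b_pos by (intro mult_right_mono real_le_rsqrt) (auto simp flip: of_int_power)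
  then have *: "of_int b * sqrt (of_int d) \<le> (of_int d :: real)" using d_ge_2 by simp
  have "\<beta> * \<beta> = complex_of_real (of_int a * (of_int d - of_int b * sqrt (of_int d)))"
    unfolding \<beta>_\<beta> s_def by (simp add: algebra_simps)
  then have "(cmod \<beta>)\<^sup>2 = \<bar>of_int a * (of_int d - of_int b * sqrt (of_int d))\<bar>"
    by (metis norm_mult norm_of_real power2_eq_square)
  then show "(cmod \<beta>)\<^sup>2 = \<bar>of_int a\<bar> * (of_int d - of_int b * sqrt (of_int d))"
    using * by (simp add: abs_mult)
  have "\<beta>' * \<beta>' = complex_of_real (of_int a * (of_int d + of_int b * sqrt (of_int d)))"
    unfolding \<beta>'_\<beta>' s_def by (simp add: algebra_simps)
  then have "(cmod \<beta>')\<^sup>2 = \<bar>of_int a * (of_int d + of_int b * sqrt (of_int d))\<bar>"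
    by (metis norm_mult norm_of_real power2_eq_square)
  moreover have "0 \<le> of_int d + of_int b * sqrt (of_int d :: real)"
    using b_pos d_ge_2 by simp
  ultimately show "(cmod \<beta>')\<^sup>2 = \<bar>of_int a\<bar> * (of_int d + of_int b * sqrt (of_int d))"
    by (simp add: abs_mult)
qed

text \<open>
  The embeddings come in two pairs that differ by the sign of the part in \<open>\<rat>\<beta> + \<rat>\<beta>'\<close>. The parallelogram law
  separates that part from the part in \<open>\<rat>(s)\<close>, and on \<open>\<rat>\<beta> + \<rat>\<beta>'\<close> the two pairs act like a rotation by a right
  angle.
\<close>

lemma norm_square_el:
  "(\<Sum>f\<in>embeddings K. (cmod (f (el x y z w)))\<^sup>2) =
    of_rat (4 * (x\<^sup>2 + of_int d * y\<^sup>2 + of_int (\<bar>a\<bar> * d) * (z\<^sup>2 + w\<^sup>2)))"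
proof -
  have par: "(cmod (P + Q))\<^sup>2 + (cmod (P - Q))\<^sup>2 = 2 * ((cmod P)\<^sup>2 + (cmod Q)\<^sup>2)" for P Q
    unfolding cmod_power2 by (simp add: power2_eq_square algebra_simps)
  have rot: "(cmod (of_real z * P + of_real w * Q))\<^sup>2 + (cmod (of_real z * Q - of_real w * P))\<^sup>2
      = (z\<^sup>2 + w\<^sup>2) * ((cmod P)\<^sup>2 + (cmod Q)\<^sup>2)" for z w P Q
    unfolding cmod_power2 by (simp add: power2_eq_square algebra_simps)
  have of_rat: "(of_rat r :: complex) = of_real (of_rat r)" for r
    by (cases r) (simp add: of_rat_rat)
  define P P' Q Q' where
    "P = of_rat x + of_rat y * s" and "P' = of_rat x + of_rat (- y) * s" and
    "Q = of_rat z * \<beta> + of_rat w * \<beta>'" and "Q' = of_rat z * \<beta>' - of_rat w * \<beta>"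
  have "(\<Sum>f\<in>embeddings K. (cmod (f (el x y z w)))\<^sup>2) =
      (cmod (P + Q))\<^sup>2 + (cmod (P' + Q'))\<^sup>2 + (cmod (P - Q))\<^sup>2 + (cmod (P' - Q'))\<^sup>2"
    unfolding embeddings_K using emb_distinct
    by (simp add: emb_el del: One_nat_def)
      (simp add: el_def P_def P'_def Q_def Q'_def of_rat_minus algebra_simps)
  also have "\<dots> = 2 * ((cmod P)\<^sup>2 + (cmod P')\<^sup>2 + ((cmod Q)\<^sup>2 + (cmod Q')\<^sup>2))"
    using par[of P Q] par[of P' Q'] by simp
  also have "(cmod Q)\<^sup>2 + (cmod Q')\<^sup>2 = (of_rat z ^ 2 + of_rat w ^ 2) * ((cmod \<beta>)\<^sup>2 + (cmod \<beta>')\<^sup>2)"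
    unfolding Q_def Q'_def of_rat rot by simp
  also have "(cmod P)\<^sup>2 + (cmod P')\<^sup>2 = 2 * (of_rat x ^ 2 + of_int d * of_rat y ^ 2)"
    using d_ge_2 unfolding P_def P'_def of_rat s_def cmod_power2
    by (simp add: of_rat_minus power2_eq_square algebra_simps)
  finally show ?thesis
    unfolding cmod_\<beta> cmod_\<beta>'
    by (simp add: of_rat_add of_rat_mult of_rat_power algebra_simps flip: of_int_abs)
qed

end

section \<open>Integral elements\<close>

text \<open>Every power of the denominator of \<open>r\<close> would have to divide \<open>D\<close>.\<close>

lemma rat_Ints_if_bounded_power_denominators:
  fixes r :: rat and D :: int
  assumes D: "D > 0" and int: "\<And>n. of_int D * r ^ n \<in> \<int>"
  shows "r \<in> \<int>"
proof -
  obtain u v where uv: "quotient_of r = (u, v)" by fastforce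
  have v: "v > 0" "coprime u v" using uv quotient_of_denom_pos quotient_of_coprime by auto
  have r: "r = of_int u / of_int v" using uv by (rule quotient_of_div)
  have dvd: "v ^ n dvd D" for n
  proof -
    obtain m where "of_int D * r ^ n = of_int m" using int[of n] by (auto elim: Ints_cases)
    then have "of_int (D * u ^ n) = (of_int (m * v ^ n) :: rat)"
      using v(1) unfolding r by (simp add: field_simps)
    then have "D * u ^ n = m * v ^ n" unfolding of_int_eq_iff .
    then have "v ^ n dvd D * u ^ n" by simp
    moreover have "coprime (v ^ n) (u ^ n)" using v(2) by (simp add: coprime_commute)
    ultimately show ?thesis by (simp add: coprime_dvd_mult_left_iff)
  qed
  have "\<not> v \<ge> 2"
  proof
    assume "v \<ge> 2"
    then have "2 ^ nat D \<le> v ^ nat D" by (intro power_mono) auto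
    also have "\<dots> \<le> D" using dvd D by (intro zdvd_imp_le) auto
    also have "D = int (nat D)" using D by simp
    also have "\<dots> < 2 ^ nat D" using of_nat_less_two_power by blast
    finally show False by simp
  qed
  then have "v = 1" using v(1) by simp
  then show ?thesis unfolding r by simp
qed

context cyclic_quartic
begin

text \<open>The order \<open>\<int>[s, \<beta>, \<beta>']\<close>.\<close>

definition \<Lambda> :: "complex set" where
  "\<Lambda> = {el (of_int x) (of_int y) (of_int z) (of_int w) | x y z w. True}"

lemma el_in_\<Lambda>_iff: "el x y z w \<in> \<Lambda> \<longleftrightarrow> x \<in> \<int> \<and> y \<in> \<int> \<and> z \<in> \<int> \<and> w \<in> \<int>"
  by (auto simp: \<Lambda>_def el_eq_iff elim!: Ints_cases)

lemma \<Lambda>_cases: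
  assumes "u \<in> \<Lambda>"
  obtains x y z w where "u = el x y z w" "x \<in> \<int>" "y \<in> \<int>" "z \<in> \<int>" "w \<in> \<int>"
  using assms by (auto simp: \<Lambda>_def)

lemma \<Lambda>_add: "u \<in> \<Lambda> \<Longrightarrow> v \<in> \<Lambda> \<Longrightarrow> u + v \<in> \<Lambda>"
  by (elim \<Lambda>_cases) (simp add: el_add el_in_\<Lambda>_iff)

lemma \<Lambda>_mult: "u \<in> \<Lambda> \<Longrightarrow> v \<in> \<Lambda> \<Longrightarrow> u * v \<in> \<Lambda>"
  by (elim \<Lambda>_cases) (auto simp: el_mult el_in_\<Lambda>_iff)

lemma \<Lambda>_of_int: "of_int k \<in> \<Lambda>"
  using el_in_\<Lambda>_iff[of "of_int k" 0 0 0] by (simp add: el_rat)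

lemma \<Lambda>_gal: "u \<in> \<Lambda> \<Longrightarrow> gal u \<in> \<Lambda>"
  by (elim \<Lambda>_cases) (simp add: el_in_\<Lambda>_iff)

lemma \<Lambda>_sum: "(\<And>i. i \<in> A \<Longrightarrow> f i \<in> \<Lambda>) \<Longrightarrow> sum f A \<in> \<Lambda>"
  using \<Lambda>_of_int[of 0] by (induction A rule: infinite_finite_induct) (auto simp: \<Lambda>_add)

lemma common_denominator:
  assumes "u \<in> K"
  shows "\<exists>D>0. of_int D * u \<in> \<Lambda>"
proof -
  obtain x y z w where u: "u = el x y z w" using assms by (rule K_cases)
  have "\<exists>D>0. of_int D * r \<in> \<int>" for r :: rat
  proof -
    obtain m n where "quotient_of r = (m, n)" by fastforce
    then have "n > 0" "of_int n * r = of_int m"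
      using quotient_of_div[of r m n] quotient_of_denom_pos[of r m n] by auto
    then show ?thesis by (metis Ints_of_int)
  qed
  then obtain D where D: "\<And>r::rat. D r > 0" "\<And>r. of_int (D r) * r \<in> \<int>" by metis
  define E where "E = D x * D y * D z * D w"
  have "of_int E * x = of_int (D y * D z * D w) * (of_int (D x) * x)"
    "of_int E * y = of_int (D x * D z * D w) * (of_int (D y) * y)"
    "of_int E * z = of_int (D x * D y * D w) * (of_int (D z) * z)"
    "of_int E * w = of_int (D x * D y * D z) * (of_int (D w) * w)"
    by (simp_all add: E_def)
  then have "of_int E * x \<in> \<int>" "of_int E * y \<in> \<int>" "of_int E * z \<in> \<int>" "of_int E * w \<in> \<int>"
    using D(2) by (metis Ints_mult Ints_of_int)+
  moreover have "of_int E * u = el (of_int E * x) (of_int E * y) (of_int E * z) (of_int E * w)"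
    by (simp add: u el_def of_rat_mult algebra_simps)
  ultimately have "of_int E * u \<in> \<Lambda>" by (simp add: el_in_\<Lambda>_iff)
  moreover have "E > 0" using D(1) by (simp add: E_def)
  ultimately show ?thesis by blast
qed

text \<open>
  Elements whose powers have a common denominator. For elements of \<open>F\<close> this turns out to be the same as being an algebraic
  integer, and sums, products and conjugates are immediate for it. This is how the integers of \<open>F\<close> are seen to form a ring.
\<close>

definition almost_integral :: "complex \<Rightarrow> bool" where
  "almost_integral u \<longleftrightarrow> u \<in> K \<and> (\<exists>D>0. \<forall>n. of_int D * u ^ n \<in> \<Lambda>)"

lemma almost_integralE:
  assumes "almost_integral u"
  obtains D where "D > 0" "\<And>n. of_int D * u ^ n \<in> \<Lambda>"
  using assms unfolding almost_integral_def by blast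

lemma K_power: "u \<in> K \<Longrightarrow> u ^ n \<in> K"
  using K_rat[of 1] by (induction n) (auto intro: K_mult)

text \<open>
  A monic equation of degree \<open>N\<close> expresses every power of \<open>u\<close> through the powers below \<open>N\<close> with coefficients in \<open>\<int>\<close>, so a
  common denominator of these finitely many powers serves all of them.
\<close>

lemma algebraic_int_imp_almost_integral:
  assumes "u \<in> K" "algebraic_int u"
  shows "almost_integral u"
proof -
  obtain p where p: "Polynomial.lead_coeff p = 1" "\<And>i. poly.coeff p i \<in> \<int>" "poly p u = 0"
    using assms(2) by (auto elim!: algebraic_int.cases)
  define N where "N = Polynomial.degree p"
  have "\<exists>D>0. \<forall>i<m. of_int D * u ^ i \<in> \<Lambda>" for m
  proof (induction m)
    case 0
    show ?case by (intro exI[of _ 1]) simp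
  next
    case (Suc m)
    then obtain D where D: "D > 0" "\<And>i. i < m \<Longrightarrow> of_int D * u ^ i \<in> \<Lambda>" by auto
    obtain E where E: "E > 0" "of_int E * u ^ m \<in> \<Lambda>"
      using common_denominator[OF K_power[OF assms(1)]] by blast
    have "of_int (E * D) * u ^ i \<in> \<Lambda>" if "i < Suc m" for i
    proof (cases "i = m")
      case True
      then show ?thesis using \<Lambda>_mult[OF \<Lambda>_of_int[of D] E(2)] by (simp add: mult_ac)
    next
      case False
      then show ?thesis using that \<Lambda>_mult[OF \<Lambda>_of_int[of E] D(2)[of i]] by (simp add: mult_ac)
    qed
    moreover have "E * D > 0" using D E by simp
    ultimately show ?case by blast
  qed
  then obtain D where D: "D > 0" "\<And>i. i < N \<Longrightarrow> of_int D * u ^ i \<in> \<Lambda>" by blast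
  have "of_int D * u ^ n \<in> \<Lambda>" for n
  proof (induction n rule: less_induct)
    case (less n)
    show ?case
    proof (cases "n < N")
      case False
      have "0 = (\<Sum>i<N. poly.coeff p i * u ^ i) + u ^ N"
        using p(1,3) by (simp add: poly_altdef N_def lessThan_Suc_atMost[symmetric])
      then have "u ^ N = - (\<Sum>i<N. poly.coeff p i * u ^ i)" by (simp add: eq_neg_iff_add_eq_0 add.commute)
      then have "of_int D * u ^ n = of_int D * (u ^ (n - N) * - (\<Sum>i<N. poly.coeff p i * u ^ i))"
        using False by (metis le_add_diff_inverse2 not_less power_add)
      also have "\<dots> = of_int (- 1) * (\<Sum>i<N. poly.coeff p i * (of_int D * u ^ (n - N + i)))"
        by (simp add: sum_distrib_left power_add sum_negf algebra_simps)
      also have "\<dots> \<in> \<Lambda>"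
      proof (intro \<Lambda>_mult[OF \<Lambda>_of_int] \<Lambda>_sum)
        fix i assume i: "i \<in> {..<N}"
        have "poly.coeff p i \<in> \<Lambda>" using p(2)[of i] by (auto elim!: Ints_cases intro: \<Lambda>_of_int)
        moreover have "of_int D * u ^ (n - N + i) \<in> \<Lambda>" using i False by (intro less) auto
        ultimately show "poly.coeff p i * (of_int D * u ^ (n - N + i)) \<in> \<Lambda>" by (rule \<Lambda>_mult)
      qed
      finally show ?thesis .
    qed (use D in auto)
  qed
  then show ?thesis using D(1) assms(1) by (auto simp: almost_integral_def)
qed

lemma almost_integral_mult:
  assumes "almost_integral u" "almost_integral v"
  shows "almost_integral (u * v)"
proof -
  obtain D where D: "D > 0" "\<And>n. of_int D * u ^ n \<in> \<Lambda>" using assms(1) by (rule almost_integralE) blast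
  obtain E where E: "E > 0" "\<And>n. of_int E * v ^ n \<in> \<Lambda>" using assms(2) by (rule almost_integralE) blast
  have "of_int (D * E) * (u * v) ^ n \<in> \<Lambda>" for n
    using \<Lambda>_mult[OF D(2)[of n] E(2)[of n]] by (simp add: power_mult_distrib mult_ac)
  then show ?thesis using D(1) E(1) assms
    by (auto simp: almost_integral_def K_mult intro!: exI[of _ "D * E"])
qed

lemma almost_integral_add:
  assumes "almost_integral u" "almost_integral v"
  shows "almost_integral (u + v)"
proof -
  obtain D where D: "D > 0" "\<And>n. of_int D * u ^ n \<in> \<Lambda>" using assms(1) by (rule almost_integralE) blast
  obtain E where E: "E > 0" "\<And>n. of_int E * v ^ n \<in> \<Lambda>" using assms(2) by (rule almost_integralE) blast
  have "of_int (D * E) * (u + v) ^ n \<in> \<Lambda>" for n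
  proof -
    have "of_int (D * E) * (u + v) ^ n =
        (\<Sum>k\<le>n. of_int (int (n choose k)) * ((of_int D * u ^ k) * (of_int E * v ^ (n - k))))"
      by (simp add: binomial_ring sum_distrib_left mult_ac)
    also have "\<dots> \<in> \<Lambda>" by (intro \<Lambda>_sum \<Lambda>_mult \<Lambda>_of_int D E)
    finally show ?thesis .
  qed
  then show ?thesis using D(1) E(1) assms
    by (auto simp: almost_integral_def K_add intro!: exI[of _ "D * E"])
qed

lemma almost_integral_of_int: "almost_integral (of_int k)"
  using K_rat[of "of_int k"] \<Lambda>_of_int[of "k ^ _"] unfolding almost_integral_def
  by (auto intro!: exI[of _ 1])

lemma almost_integral_minus: "almost_integral u \<Longrightarrow> almost_integral (- u)"
  using almost_integral_mult[OF almost_integral_of_int[of "-1"]] by simp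

lemma gal_power: "u \<in> K \<Longrightarrow> gal (u ^ n) = gal u ^ n"
  by (induction n) (simp_all add: gal_mult K_power)

lemma almost_integral_gal:
  assumes "almost_integral u"
  shows "almost_integral (gal u)"
proof -
  obtain D where D: "D > 0" "\<And>n. of_int D * u ^ n \<in> \<Lambda>" using assms by (rule almost_integralE) blast
  have u: "u \<in> K" using assms by (simp add: almost_integral_def)
  have "gal (of_int D * u ^ n) = of_int D * gal u ^ n" for n
    using gal_mult[OF K_rat[of "of_int D"] K_power[OF u, of n]] gal_rat[of "of_int D"]
    by (simp add: gal_power u)
  then have "of_int D * gal u ^ n \<in> \<Lambda>" for n using \<Lambda>_gal[OF D(2)[of n]] by simp
  then show ?thesis using D(1) u by (auto simp: almost_integral_def gal_K)
qed

lemma almost_integral_rat: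
  assumes "almost_integral (el r 0 0 0)"
  shows "r \<in> \<int>"
proof -
  obtain D where D: "D > 0" "\<And>n. of_int D * el r 0 0 0 ^ n \<in> \<Lambda>" using assms by (rule almost_integralE) blast
  have "of_int D * r ^ n \<in> \<int>" for n
    using D(2)[of n] el_in_\<Lambda>_iff[of "of_int D * r ^ n" 0 0 0]
    by (simp add: el_rat of_rat_mult of_rat_power)
  then show ?thesis using rat_Ints_if_bounded_power_denominators D(1) by blast
qed

text \<open>
  Trace and norm: \<open>2x\<close> and \<open>x\<^sup>2 - d y\<^sup>2\<close> are integers, hence so is \<open>d (2y)\<^sup>2\<close>, and \<open>d\<close> is squarefree.
  The congruence describes the integers \<open>(m + n s) / 2\<close> of \<open>\<rat>(s)\<close> whether \<open>d\<close> is even or odd.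
\<close>

lemma almost_integral_quadratic:
  assumes "almost_integral (el x y 0 0)"
  obtains m n :: int where "x = of_int m / 2" "y = of_int n / 2" "4 dvd m\<^sup>2 - d * n\<^sup>2"
proof -
  have "almost_integral (el x y 0 0 + gal (el x y 0 0))"
    by (intro almost_integral_add almost_integral_gal assms)
  then have "almost_integral (el (2 * x) 0 0 0)" by (simp add: el_add)
  then have "2 * x \<in> \<int>" by (rule almost_integral_rat)
  then obtain m where m: "2 * x = of_int m" by (auto elim: Ints_cases)
  have "almost_integral (el x y 0 0 * gal (el x y 0 0))"
    by (intro almost_integral_mult almost_integral_gal assms)
  then have "almost_integral (el (x\<^sup>2 - of_int d * y\<^sup>2) 0 0 0)" by (simp add: el_mult power2_eq_square)
  then have "x\<^sup>2 - of_int d * y\<^sup>2 \<in> \<int>" by (rule almost_integral_rat)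
  then obtain N where N: "x\<^sup>2 - of_int d * y\<^sup>2 = of_int N" by (auto elim: Ints_cases)
  have "of_int d * (2 * y)\<^sup>2 = (2 * x)\<^sup>2 - 4 * (x\<^sup>2 - of_int d * y\<^sup>2)"
    by (simp add: power2_eq_square algebra_simps)
  also have "\<dots> = of_int (m\<^sup>2 - 4 * N)" unfolding m N by simp
  finally have dy: "of_int d * (2 * y)\<^sup>2 = of_int (m\<^sup>2 - 4 * N)" .
  then have "of_int d * (2 * y)\<^sup>2 \<in> \<int>" by (simp only: Ints_of_int)
  then have "2 * y \<in> \<int>" by (rule squarefree_mult_rat_square_Ints[OF squarefree_d])
  then obtain n where n: "2 * y = of_int n" by (auto elim: Ints_cases)
  have "of_int (d * n\<^sup>2) = (of_int (m\<^sup>2 - 4 * N) :: rat)" using dy unfolding n by simp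
  then have "d * n\<^sup>2 = m\<^sup>2 - 4 * N" unfolding of_int_eq_iff .
  then have "4 dvd m\<^sup>2 - d * n\<^sup>2" by simp
  with m n show ?thesis by (intro that[of m n]) auto
qed

definition qel :: "int \<Rightarrow> int \<Rightarrow> int \<Rightarrow> int \<Rightarrow> complex" where
  "qel x y z w = el (of_int x / 4) (of_int y / 4) (of_int z / 4) (of_int w / 4)"

text \<open>The relative norm over \<open>\<rat>(s)\<close> of the element with quarter coordinates \<open>(x, y, z, w)\<close> is \<open>(norm_x + norm_y s) / 16\<close>.\<close>

definition norm_x :: "int \<Rightarrow> int \<Rightarrow> int \<Rightarrow> int \<Rightarrow> int" where
  "norm_x x y z w = x\<^sup>2 + d * y\<^sup>2 - a * d * (z\<^sup>2 + w\<^sup>2)"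
definition norm_y :: "int \<Rightarrow> int \<Rightarrow> int \<Rightarrow> int \<Rightarrow> int" where
  "norm_y x y z w = 2 * x * y - a * (b * (w\<^sup>2 - z\<^sup>2) + 2 * c * z * w)"

text \<open>This says that relative trace and relative norm over \<open>\<rat>(s)\<close> are algebraic integers; the trace is \<open>(x + y s) / 2\<close>.\<close>

definition integral_coords :: "int \<Rightarrow> int \<Rightarrow> int \<Rightarrow> int \<Rightarrow> bool" where
  "integral_coords x y z w \<longleftrightarrow> 4 dvd x\<^sup>2 - d * y\<^sup>2 \<and> 8 dvd norm_x x y z w \<and> 8 dvd norm_y x y z w
     \<and> 4 dvd (norm_x x y z w div 8)\<^sup>2 - d * (norm_y x y z w div 8)\<^sup>2"

text \<open>
  For \<open>u\<close> with conjugate \<open>u'\<close> over \<open>\<rat>(s)\<close>, the trace and the norm of \<open>u\<close> give the congruences, once the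
  coordinates are known to lie in \<open>1/4 \<int>\<close>. For the trace part this is clear. For \<open>v = u - u' = 2 z \<beta> + 2 w \<beta>'\<close>,
  the coordinates of \<open>v\<^sup>2\<close> and of \<open>v gal(v)\<close> are integers up to a factor \<open>2\<close>, and, again by \<open>d = b\<^sup>2 + c\<^sup>2\<close>,
  they combine to the integers \<open>a d (4z)\<^sup>2\<close> and \<open>a d (4w)\<^sup>2\<close>.
\<close>

lemma almost_integral_imp_integral_coords:
  assumes ai: "almost_integral u"
  obtains x y z w where "u = qel x y z w" "integral_coords x y z w"
proof -
  obtain x y z w where u: "u = el x y z w" using ai by (auto simp: almost_integral_def elim: K_cases)
  define u' where "u' = gal (gal u)"
  have u'_el: "u' = el x y (- z) (- w)" by (simp add: u'_def u)
  have ai': "almost_integral u'" unfolding u'_def by (intro almost_integral_gal ai)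
  have "almost_integral (u + u')" by (intro almost_integral_add ai ai')
  then have "almost_integral (el (2 * x) (2 * y) 0 0)" by (simp add: u u'_el el_add)
  then obtain X0 Y0 where xy0: "2 * x = of_int X0 / 2" "2 * y = of_int Y0 / 2" "4 dvd X0\<^sup>2 - d * Y0\<^sup>2"
    by (rule almost_integral_quadratic)
  have xy: "x = of_int X0 / 4" "y = of_int Y0 / 4" using xy0 by simp_all
  define m where "m = x\<^sup>2 + of_int d * y\<^sup>2 - of_int (a * d) * (z\<^sup>2 + w\<^sup>2)"
  define n where "n = 2 * x * y - of_int a * (of_int b * (w\<^sup>2 - z\<^sup>2) + 2 * of_int c * z * w)"
  have "almost_integral (u * u')" by (intro almost_integral_mult ai ai')
  moreover have "u * u' = el m n 0 0"
    unfolding u u'_el el_mult m_def n_def by (simp add: el_eq_iff power2_eq_square algebra_simps)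
  ultimately have "almost_integral (el m n 0 0)" by simp
  then obtain M N where mn: "m = of_int M / 2" "n = of_int N / 2" "4 dvd M\<^sup>2 - d * N\<^sup>2"
    by (rule almost_integral_quadratic)
  define v where "v = u + - u'"
  have v_el: "v = el 0 0 (2 * z) (2 * w)" by (simp add: v_def u u'_el el_minus el_add)
  have aiv: "almost_integral v" unfolding v_def by (intro almost_integral_add almost_integral_minus ai ai')
  have "v * v = el (4 * of_int (a * d) * (z\<^sup>2 + w\<^sup>2)) (4 * of_int a * (of_int b * (w\<^sup>2 - z\<^sup>2) + 2 * of_int c * z * w)) 0 0"
    unfolding v_el el_mult by (simp add: el_eq_iff power2_eq_square algebra_simps)
  from almost_integral_mult[OF aiv aiv, unfolded this]
  obtain M1 N1 where mn1: "4 * of_int (a * d) * (z\<^sup>2 + w\<^sup>2) = of_int M1 / 2"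
      "4 * of_int a * (of_int b * (w\<^sup>2 - z\<^sup>2) + 2 * of_int c * z * w) = of_int N1 / 2"
    by (rule almost_integral_quadratic)
  \<comment> \<open>\<open>v gal(v) = g s\<close>, and \<open>g\<close> itself is an integer because \<open>(g s)\<^sup>2 = d g\<^sup>2\<close>.\<close>
  define g where "g = 4 * of_int a * (2 * of_int b * z * w + of_int c * (z\<^sup>2 - w\<^sup>2))"
  have vsv: "v * gal v = el 0 g 0 0"
    unfolding v_el gal_el el_mult g_def by (simp add: el_eq_iff power2_eq_square algebra_simps)
  have "almost_integral (el 0 g 0 0)"
    unfolding vsv[symmetric] by (intro almost_integral_mult almost_integral_gal aiv)
  then have "almost_integral (el 0 g 0 0 * el 0 g 0 0)" by (intro almost_integral_mult)
  then have "of_int d * g\<^sup>2 \<in> \<int>"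
    by (intro almost_integral_rat) (simp add: el_mult power2_eq_square)
  then have "g \<in> \<int>" by (rule squarefree_mult_rat_square_Ints[OF squarefree_d])
  then obtain G where G: "g = of_int G" by (auto elim: Ints_cases)
  have sq: "squarefree (a * d)"
    by (rule squarefree_mult_coprime[OF coprime_a_d squarefree_a squarefree_d])
  have diff: "2 * of_int (a * d) * (4 * (z\<^sup>2 - w\<^sup>2)) = of_int (2 * c * G - b * N1)"
  proof -
    have "of_int (2 * c * G - b * N1) = 2 * of_int c * g - 2 * of_int b * (of_int N1 / 2)"
      by (simp add: G)
    also have "\<dots> = 8 * of_int a * (of_int b * of_int b + of_int c * of_int c) * (z\<^sup>2 - w\<^sup>2)"
      unfolding g_def mn1(2)[symmetric] by (simp add: algebra_simps)
    finally show ?thesis by (simp add: of_int_d_eq)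
  qed
  have sum: "2 * of_int (a * d) * (4 * (z\<^sup>2 + w\<^sup>2)) = of_int M1"
  proof -
    have "2 * of_int (a * d) * (4 * (z\<^sup>2 + w\<^sup>2)) = 2 * (4 * of_int (a * d) * (z\<^sup>2 + w\<^sup>2))"
      by (simp only: mult_ac)
    then show ?thesis unfolding mn1(1) by simp
  qed
  have "of_int (a * d) * (4 * z)\<^sup>2 = of_int (M1 + (2 * c * G - b * N1))"
    unfolding of_int_add[of M1] sum[symmetric] diff[symmetric] by (simp add: power2_eq_square algebra_simps)
  then have "of_int (a * d) * (4 * z)\<^sup>2 \<in> \<int>" by (simp only: Ints_of_int)
  then have "4 * z \<in> \<int>" by (rule squarefree_mult_rat_square_Ints[OF sq])
  then obtain Z where Z: "4 * z = of_int Z" by (auto elim: Ints_cases)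
  have "of_int (a * d) * (4 * w)\<^sup>2 = of_int (M1 - (2 * c * G - b * N1))"
    unfolding of_int_diff[of M1] sum[symmetric] diff[symmetric] by (simp add: power2_eq_square algebra_simps)
  then have "of_int (a * d) * (4 * w)\<^sup>2 \<in> \<int>" by (simp only: Ints_of_int)
  then have "4 * w \<in> \<int>" by (rule squarefree_mult_rat_square_Ints[OF sq])
  then obtain W where W: "4 * w = of_int W" by (auto elim: Ints_cases)
  have zw: "z = of_int Z / 4" "w = of_int W / 4" using Z W by simp_all
  have "of_int (norm_x X0 Y0 Z W) = (16 * m :: rat)"
    unfolding m_def xy zw norm_x_def by (simp add: field_simps power2_eq_square)
  also have "\<dots> = of_int (8 * M)" unfolding mn by simp
  finally have R: "norm_x X0 Y0 Z W = 8 * M" unfolding of_int_eq_iff .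
  have "of_int (norm_y X0 Y0 Z W) = (16 * n :: rat)"
    unfolding n_def xy zw norm_y_def by (simp add: field_simps power2_eq_square)
  also have "\<dots> = of_int (8 * N)" unfolding mn by simp
  finally have S: "norm_y X0 Y0 Z W = 8 * N" unfolding of_int_eq_iff .
  show ?thesis
  proof (rule that)
    show "u = qel X0 Y0 Z W" unfolding u qel_def xy zw ..
    show "integral_coords X0 Y0 Z W" unfolding integral_coords_def R S using mn(3) xy0(3) by simp
  qed
qed

text \<open>
  The element \<open>u\<close> is a root of \<open>t\<^sup>2 - A t + B\<close> with \<open>A, B\<close> integral in \<open>\<rat>(s)\<close>. Multiplied by its conjugate,
  this polynomial is monic with integer coefficients.
\<close>

lemma integral_coords_imp_algebraic_int:
  assumes ic: "integral_coords x y z w"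
  shows "algebraic_int (qel x y z w)"
proof -
  obtain T where T: "x\<^sup>2 - d * y\<^sup>2 = 4 * T" using ic unfolding integral_coords_def by blast
  define R S where "R = norm_x x y z w div 8" and "S = norm_y x y z w div 8"
  have RS: "norm_x x y z w = 8 * R" "norm_y x y z w = 8 * S"
    using ic by (simp_all add: integral_coords_def R_def S_def)
  obtain N where N: "R\<^sup>2 - d * S\<^sup>2 = 4 * N" using ic unfolding integral_coords_def R_def S_def by blast
  have "even (x * R - d * y * S)"
  proof -
    have "even (x\<^sup>2 - d * y\<^sup>2)" "even (R\<^sup>2 - d * S\<^sup>2)" unfolding T N by simp_all
    then show ?thesis by auto
  qed
  then obtain E where E: "x * R - d * y * S = 2 * E" by blast
  define u where "u = qel x y z w"
  define A A' where "A = el (of_int x / 2) (of_int y / 2) 0 0" and "A' = el (of_int x / 2) (- of_int y / 2) 0 0"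
  define B B' where "B = el (of_int R / 2) (of_int S / 2) 0 0" and "B' = el (of_int R / 2) (- of_int S / 2) 0 0"
  have R': "of_int R = (of_int (norm_x x y z w) / 8 :: rat)" and S': "of_int S = (of_int (norm_y x y z w) / 8 :: rat)"
    unfolding RS by simp_all
  have root: "u * u - A * u + B = 0"
    unfolding u_def A_def B_def qel_def el_mult el_diff el_add el_eq_0_iff R' S' norm_x_def norm_y_def
    by (simp add: field_simps power2_eq_square)
  have int: "el (of_int k) 0 0 0 = of_int k" for k :: int by (simp add: el_rat)
  have s1: "A + A' = of_int x" unfolding A_def A'_def el_add int[symmetric] by (simp add: el_eq_iff)
  have s2: "B + B' = of_int R" unfolding B_def B'_def el_add int[symmetric] by (simp add: el_eq_iff)
  have T': "of_int T = ((of_int x)\<^sup>2 - of_int d * (of_int y)\<^sup>2) / (4 :: rat)"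
    using arg_cong[OF T, of "of_int :: int \<Rightarrow> rat"] by simp
  have N': "of_int N = ((of_int R)\<^sup>2 - of_int d * (of_int S)\<^sup>2) / (4 :: rat)"
    using arg_cong[OF N, of "of_int :: int \<Rightarrow> rat"] by simp
  have E': "of_int E = (of_int x * of_int R - of_int d * of_int y * of_int S) / (2 :: rat)"
    using arg_cong[OF E, of "of_int :: int \<Rightarrow> rat"] by simp
  have p1: "A * A' = of_int T" unfolding A_def A'_def el_mult int[symmetric] T'
    by (simp add: el_eq_iff field_simps power2_eq_square)
  have p2: "B * B' = of_int N" unfolding B_def B'_def el_mult int[symmetric] N'
    by (simp add: el_eq_iff field_simps power2_eq_square)
  have p3: "A * B' + A' * B = of_int E"
    unfolding A_def A'_def B_def B'_def el_mult el_add int[symmetric] E'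
    by (simp add: el_eq_iff field_simps power2_eq_square)
  let ?p = "[:N, - E, R + T, - x, 1:]"
  have "poly (map_poly of_int ?p) u = (u * u - A * u + B) * (u * u - A' * u + B')"
    by (simp add: map_poly_pCons s1[symmetric] s2[symmetric] p1[symmetric] p2[symmetric] p3[symmetric] algebra_simps)
  also have "\<dots> = 0" unfolding root by simp
  finally have "poly (map_poly of_int ?p) u = 0" .
  moreover have "Polynomial.lead_coeff ?p = 1" by simp
  ultimately show ?thesis unfolding algebraic_int_altdef_ipoly u_def by blast
qed

lemma qel_in_K [simp]: "qel x y z w \<in> K" by (simp add: qel_def)

lemma algebraic_int_iff_almost_integral: "u \<in> K \<Longrightarrow> algebraic_int u \<longleftrightarrow> almost_integral u"
  by (metis algebraic_int_imp_almost_integral almost_integral_imp_integral_coords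
    integral_coords_imp_algebraic_int)

lemma qel_eq_iff [simp]: "qel x y z w = qel x' y' z' w' \<longleftrightarrow> x = x' \<and> y = y' \<and> z = z' \<and> w = w'"
  by (simp add: qel_def el_eq_iff)

lemma algebraic_int_qel_iff: "algebraic_int (qel x y z w) \<longleftrightarrow> integral_coords x y z w"
  by (metis algebraic_int_imp_almost_integral almost_integral_imp_integral_coords
    integral_coords_imp_algebraic_int qel_eq_iff qel_in_K)

end

section \<open>Congruence classification of the integral coordinates\<close>

lemma odd_square_int:
  fixes z :: int
  assumes "odd z"
  obtains k where "z\<^sup>2 = 8 * k + 1"
proof -
  obtain m where z: "z = 2 * m + 1" using assms by (rule oddE)
  have "even (m * (m + 1))" by simp
  then obtain k where k: "m * (m + 1) = 2 * k" by (rule evenE)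
  have "z\<^sup>2 = 4 * (m * (m + 1)) + 1" unfolding z by (simp add: power2_eq_square algebra_simps)
  then show ?thesis using k that by simp
qed

context cyclic_quartic
begin

lemma even_d_facts:
  assumes "even d"
  shows "odd b" "odd c" "\<exists>k. d = 8 * k + 2"
proof -
  have "even b \<longleftrightarrow> even c" using assms unfolding d_eq by simp
  moreover have "\<not> (even b \<and> even c)"
  proof
    assume "even b \<and> even c"
    then have "2\<^sup>2 dvd d" unfolding d_eq by (auto intro!: dvd_add dvd_power_same simp del: power2_eq_square)
    then show False using squarefreeD[OF squarefree_d, of 2] by simp
  qed
  ultimately show bc: "odd b" "odd c" by auto
  obtain k l where "b\<^sup>2 = 8 * k + 1" "c\<^sup>2 = 8 * l + 1" using bc odd_square_int by metis
  then have "d = 8 * (k + l) + 2" unfolding d_eq by simp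
  then show "\<exists>k. d = 8 * k + 2" by blast
qed

lemma odd_d_facts:
  assumes "odd d"
  obtains e where "d = 4 * e + 1"
proof -
  have "even b \<longleftrightarrow> odd c" using assms unfolding d_eq by simp
  then consider "even b" "odd c" | "odd b" "even c" by auto
  then show ?thesis
  proof cases
    case 1
    obtain B where "b = 2 * B" using 1 by (auto elim: evenE)
    moreover obtain l where "c\<^sup>2 = 8 * l + 1" using 1 odd_square_int by blast
    ultimately have "d = 4 * (B\<^sup>2 + 2 * l) + 1" unfolding d_eq by (simp add: power_mult_distrib)
    then show ?thesis by (rule that)
  next
    case 2
    obtain C where "c = 2 * C" using 2 by (auto elim: evenE)
    moreover obtain l where "b\<^sup>2 = 8 * l + 1" using 2 odd_square_int by blast
    ultimately have "d = 4 * (C\<^sup>2 + 2 * l) + 1" unfolding d_eq by (simp add: power_mult_distrib)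
    then show ?thesis by (rule that)
  qed
qed

lemma integral_coordsD:
  assumes "integral_coords x y z w"
  obtains T r s' N where "x\<^sup>2 - d * y\<^sup>2 = 4 * T"
    "x\<^sup>2 + d * y\<^sup>2 - a * d * (z\<^sup>2 + w\<^sup>2) = 8 * r"
    "2 * x * y - a * (b * (w\<^sup>2 - z\<^sup>2) + 2 * c * z * w) = 8 * s'"
    "r\<^sup>2 - d * s'\<^sup>2 = 4 * N"
proof -
  obtain T where T: "x\<^sup>2 - d * y\<^sup>2 = 4 * T" using assms unfolding integral_coords_def by blast
  obtain r where r: "norm_x x y z w = 8 * r" using assms unfolding integral_coords_def by blast
  obtain s' where s': "norm_y x y z w = 8 * s'" using assms unfolding integral_coords_def by blast
  have "4 dvd r\<^sup>2 - d * s'\<^sup>2" using assms unfolding integral_coords_def r s' by simp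
  then obtain N where "r\<^sup>2 - d * s'\<^sup>2 = 4 * N" by blast
  with T r s' show ?thesis using that unfolding norm_x_def norm_y_def by blast
qed

lemma integral_coordsI:
  assumes "x\<^sup>2 - d * y\<^sup>2 = 4 * T"
    "x\<^sup>2 + d * y\<^sup>2 - a * d * (z\<^sup>2 + w\<^sup>2) = 8 * r"
    "2 * x * y - a * (b * (w\<^sup>2 - z\<^sup>2) + 2 * c * z * w) = 8 * s'"
    "4 dvd r\<^sup>2 - d * s'\<^sup>2"
  shows "integral_coords x y z w"
  using assms unfolding integral_coords_def norm_x_def norm_y_def by simp

text \<open>For \<open>d \<equiv> 2\<close> modulo \<open>4\<close> the integers of \<open>\<rat>(s)\<close> are \<open>\<int> + \<int>s\<close>.\<close>

lemma even_norm_form_even_d: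
  assumes "even d" "p\<^sup>2 - d * q\<^sup>2 = 4 * N"
  shows "even p" "even q"
proof -
  have "even (p\<^sup>2 - d * q\<^sup>2)" unfolding assms(2) by simp
  then show "even p" using assms(1) by simp
  then obtain P where P: "p = 2 * P" by (rule evenE)
  obtain k where k: "d = 8 * k + 2" using even_d_facts(3)[OF assms(1)] by blast
  have "2 * q\<^sup>2 = 2 * (2 * (P\<^sup>2 - 2 * k * q\<^sup>2 - N))"
    using assms(2) unfolding P k by (simp add: power2_eq_square algebra_simps)
  then have "q\<^sup>2 = 2 * (P\<^sup>2 - 2 * k * q\<^sup>2 - N)" by simp
  then have "even (q\<^sup>2)" by (metis dvd_triv_left)
  then show "even q" by simp
qed

lemma even_pair_even_d:
  assumes "even d" "a * (b * (w\<^sup>2 - z\<^sup>2) + 2 * c * z * w) = 4 * m"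
  shows "even z" "even w"
proof -
  note bc = even_d_facts(1,2)[OF assms(1)]
  have "even (a * (b * (w\<^sup>2 - z\<^sup>2) + 2 * c * z * w))" unfolding assms(2) by simp
  then have zw: "even z \<longleftrightarrow> even w" using odd_a bc by auto
  moreover have "\<not> (odd z \<and> odd w)"
  proof
    assume odd: "odd z \<and> odd w"
    obtain k where k: "z\<^sup>2 = 8 * k + 1" using odd odd_square_int by blast
    obtain l where l: "w\<^sup>2 = 8 * l + 1" using odd odd_square_int by blast
    have "2 * (a * c * z * w) = 2 * (2 * (m - 2 * a * b * (l - k)))"
      using assms(2) unfolding k l by (simp add: algebra_simps)
    then have "a * c * z * w = 2 * (m - 2 * a * b * (l - k))" by simp
    then have "even (a * c * z * w)" by (metis dvd_triv_left)
    then show False using odd odd_a bc by simp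
  qed
  ultimately show "even z" "even w" by auto
qed

text \<open>The coordinates are halved twice; after the first step the conditions have the same form modulo \<open>4\<close>.\<close>

lemma integral_coords_even_d_iff:
  assumes d: "even d"
  shows "integral_coords x y z w \<longleftrightarrow> 4 dvd x \<and> 4 dvd y \<and> 4 dvd z \<and> 4 dvd w"
proof
  assume "integral_coords x y z w"
  then obtain T r s' N where *: "x\<^sup>2 - d * y\<^sup>2 = 4 * T"
    "x\<^sup>2 + d * y\<^sup>2 - a * d * (z\<^sup>2 + w\<^sup>2) = 8 * r"
    "2 * x * y - a * (b * (w\<^sup>2 - z\<^sup>2) + 2 * c * z * w) = 8 * s'"
    "r\<^sup>2 - d * s'\<^sup>2 = 4 * N" by (rule integral_coordsD)
  obtain x1 y1 where xy: "x = 2 * x1" "y = 2 * y1"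
    using even_norm_form_even_d[OF d *(1)] by (meson evenE)
  have "a * (b * (w\<^sup>2 - z\<^sup>2) + 2 * c * z * w) = 4 * (2 * x1 * y1 - 2 * s')"
    using *(3) unfolding xy by simp
  then have "even z" "even w" using even_pair_even_d[OF d] by blast+
  then obtain z1 w1 where zw: "z = 2 * z1" "w = 2 * w1" by (meson evenE)
  obtain r1 s1 where rs: "r = 2 * r1" "s' = 2 * s1"
    using even_norm_form_even_d[OF d *(4)] by (meson evenE)
  have R: "x1\<^sup>2 + d * y1\<^sup>2 - a * d * (z1\<^sup>2 + w1\<^sup>2) = 4 * r1"
    using *(2) unfolding xy zw rs by (simp add: power_mult_distrib algebra_simps)
  have S: "2 * x1 * y1 - a * (b * (w1\<^sup>2 - z1\<^sup>2) + 2 * c * z1 * w1) = 4 * s1"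
    using *(3) unfolding xy zw rs by (simp add: power_mult_distrib algebra_simps)
  have "even (x1\<^sup>2 + d * y1\<^sup>2 - a * d * (z1\<^sup>2 + w1\<^sup>2))" unfolding R by simp
  then have "even x1" using d by simp
  then obtain x2 where x2: "x1 = 2 * x2" by (rule evenE)
  have "a * (b * (w1\<^sup>2 - z1\<^sup>2) + 2 * c * z1 * w1) = 4 * (x2 * y1 - s1)"
    using S unfolding x2 by simp
  then have "even z1" "even w1" using even_pair_even_d[OF d] by blast+
  then obtain z2 w2 where zw2: "z1 = 2 * z2" "w1 = 2 * w2" by (meson evenE)
  have "0\<^sup>2 - d * y1\<^sup>2 = 4 * (x2\<^sup>2 - a * d * (z2\<^sup>2 + w2\<^sup>2) - r1)"
    using R unfolding x2 zw2 by (simp add: power_mult_distrib algebra_simps)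
  then have "even y1" using even_norm_form_even_d(2)[OF d] by blast
  then obtain y2 where "y1 = 2 * y2" by (rule evenE)
  then show "4 dvd x \<and> 4 dvd y \<and> 4 dvd z \<and> 4 dvd w"
    unfolding xy zw x2 zw2 by simp
next
  assume "4 dvd x \<and> 4 dvd y \<and> 4 dvd z \<and> 4 dvd w"
  then obtain x1 y1 z1 w1 where xyzw: "x = 4 * x1" "y = 4 * y1" "z = 4 * z1" "w = 4 * w1" by (meson dvdE)
  show "integral_coords x y z w"
  proof (rule integral_coordsI)
    show "x\<^sup>2 - d * y\<^sup>2 = 4 * (4 * (x1\<^sup>2 - d * y1\<^sup>2))"
      unfolding xyzw by (simp add: power_mult_distrib)
    show "x\<^sup>2 + d * y\<^sup>2 - a * d * (z\<^sup>2 + w\<^sup>2) = 8 * (2 * (x1\<^sup>2 + d * y1\<^sup>2 - a * d * (z1\<^sup>2 + w1\<^sup>2)))"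
      unfolding xyzw by (simp add: power_mult_distrib algebra_simps)
    show "2 * x * y - a * (b * (w\<^sup>2 - z\<^sup>2) + 2 * c * z * w) =
        8 * (2 * (2 * x1 * y1 - a * (b * (w1\<^sup>2 - z1\<^sup>2) + 2 * c * z1 * w1)))"
      unfolding xyzw by (simp add: power_mult_distrib algebra_simps)
    show "4 dvd (2 * u)\<^sup>2 - d * (2 * v)\<^sup>2" for u v :: int
      by (simp add: power_mult_distrib)
  qed
qed

text \<open>For odd \<open>d\<close> this is the case of odd discriminant \<open>a\<^sup>2 d\<^sup>3\<close>, in which the prime \<open>2\<close> does not ramify in the field.\<close>

definition unramified_at_2 :: bool where "unramified_at_2 \<longleftrightarrow> even b \<and> 4 dvd a + b - 1"

text \<open>
  The parities of \<open>x\<close> and \<open>y\<close> agree. If they are odd, the norm modulo \<open>8\<close> makes \<open>z, w\<close> odd as well and forces \<open>a \<equiv> 1 + 2e\<close>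
  modulo \<open>4\<close> for \<open>d = 4e + 1\<close>; with \<open>e \<equiv> b/2\<close> modulo \<open>2\<close> this is the condition \<open>a + b \<equiv> 1\<close>. If they are even, so
  are \<open>z\<close> and \<open>w\<close>, and halves of different parity force the same condition through the last congruence for the norm.
\<close>

lemma integral_coords_odd_d_imp:
  assumes d: "odd d" and ic: "integral_coords x y z w"
  shows "odd x \<and> odd y \<and> odd z \<and> odd w \<and> unramified_at_2 \<and> 4 dvd x * y - a * c * z * w \<or>
    even x \<and> even y \<and> even z \<and> even w \<and> even (x div 2 + y div 2 + z div 2 + w div 2) \<and>
      (\<not> unramified_at_2 \<longrightarrow> even (x div 2 + y div 2) \<and> even (z div 2 + w div 2))"
proof -
  obtain e where e: "d = 4 * e + 1" using d by (rule odd_d_facts)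
  obtain T r s' N where *: "x\<^sup>2 - d * y\<^sup>2 = 4 * T"
    "x\<^sup>2 + d * y\<^sup>2 - a * d * (z\<^sup>2 + w\<^sup>2) = 8 * r"
    "2 * x * y - a * (b * (w\<^sup>2 - z\<^sup>2) + 2 * c * z * w) = 8 * s'"
    "r\<^sup>2 - d * s'\<^sup>2 = 4 * N" using ic by (rule integral_coordsD)
  have "even (x\<^sup>2 - d * y\<^sup>2)" unfolding *(1) by simp
  then consider (odd) "odd x" "odd y" | (even) "even x" "even y" using d by auto
  then show ?thesis
  proof cases
    case odd
    obtain i where i: "x\<^sup>2 = 8 * i + 1" using odd odd_square_int by blast
    obtain j where j: "y\<^sup>2 = 8 * j + 1" using odd odd_square_int by blast
    have R: "a * d * (z\<^sup>2 + w\<^sup>2) = 2 + 4 * (e + 2 * (i + j + 4 * e * j - r))"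
      using *(2) unfolding i j e by (simp add: algebra_simps)
    then have "even (a * d * (z\<^sup>2 + w\<^sup>2))" by simp
    then have "even z \<longleftrightarrow> even w" using odd_a d by simp
    moreover have "\<not> (even z \<and> even w)"
    proof
      assume "even z \<and> even w"
      then obtain z1 w1 where "z = 2 * z1" "w = 2 * w1" by (meson evenE)
      then have "4 * (a * d * (z1\<^sup>2 + w1\<^sup>2)) = 2 + 4 * (e + 2 * (i + j + 4 * e * j - r))"
        using R by (simp add: power_mult_distrib algebra_simps)
      moreover have "4 * p \<noteq> 2 + 4 * q" for p q :: int by presburger
      ultimately show False by blast
    qed
    ultimately have zw: "odd z" "odd w" by auto
    obtain m where m: "z\<^sup>2 = 8 * m + 1" using zw odd_square_int by blast
    obtain n where n: "w\<^sup>2 = 8 * n + 1" using zw odd_square_int by blast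
    have a_e: "a = 1 + 2 * e + 4 * (i + j + 4 * e * j - r - a * d * (m + n) - a * e)"
      using R unfolding m n e by (simp add: algebra_simps)
    have S: "x * y - a * c * z * w = 4 * (s' + a * b * (n - m))"
      using *(3) unfolding m n by (simp add: algebra_simps)
    then have "even (x * y - a * c * z * w)" by simp
    then have c: "odd c" using odd by auto
    have b: "even b" using d c unfolding d_eq by simp
    obtain B where B: "b = 2 * B" using b by (rule evenE)
    obtain l where l: "c\<^sup>2 = 8 * l + 1" using c odd_square_int by blast
    have eB: "e = B\<^sup>2 + 2 * l" using d_eq l unfolding B e by (simp add: power_mult_distrib)
    have "even (B * (B + 1))" by simp
    then obtain f where f: "B * (B + 1) = 2 * f" by (rule evenE)
    have "a + b - 1 = 2 * e + 2 * B + 4 * (i + j + 4 * e * j - r - a * d * (m + n) - a * e)"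
      unfolding B by (subst a_e) simp
    also have "2 * e + 2 * B = 2 * (B * (B + 1)) + 4 * l"
      unfolding eB by (simp add: power2_eq_square algebra_simps)
    finally have "4 dvd a + b - 1" unfolding f by simp
    then have unramified_at_2 using b by (simp add: unramified_at_2_def)
    then show ?thesis using odd zw S by simp
  next
    case even
    then obtain x1 y1 where xy: "x = 2 * x1" "y = 2 * y1" by (meson evenE)
    have R: "a * d * (z\<^sup>2 + w\<^sup>2) = 4 * (x1\<^sup>2 + d * y1\<^sup>2 - 2 * r)"
      using *(2) unfolding xy by (simp add: power_mult_distrib)
    then have "even (a * d * (z\<^sup>2 + w\<^sup>2))" by simp
    then have "even z \<longleftrightarrow> even w" using odd_a d by simp
    moreover have "\<not> (odd z \<and> odd w)"
    proof
      assume odd: "odd z \<and> odd w"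
      obtain m where m: "z\<^sup>2 = 8 * m + 1" using odd odd_square_int by blast
      obtain n where n: "w\<^sup>2 = 8 * n + 1" using odd odd_square_int by blast
      have "a * d = 2 * (x1\<^sup>2 + d * y1\<^sup>2 - 2 * r - 2 * a * d * (m + n))"
        using R unfolding m n by (simp add: algebra_simps)
      then have "even (a * d)" by (metis dvd_triv_left)
      then show False using odd_a d by simp
    qed
    ultimately have zw_even: "even z" "even w" by auto
    then obtain z1 w1 where zw: "z = 2 * z1" "w = 2 * w1" by (meson evenE)
    have R1: "x1\<^sup>2 + d * y1\<^sup>2 - a * d * (z1\<^sup>2 + w1\<^sup>2) = 2 * r"
      using *(2) unfolding xy zw by (simp add: power_mult_distrib algebra_simps)
    have S1: "2 * x1 * y1 - a * (b * (w1\<^sup>2 - z1\<^sup>2) + 2 * c * z1 * w1) = 2 * s'"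
      using *(3) unfolding xy zw by (simp add: power_mult_distrib algebra_simps)
    have "even (x1\<^sup>2 + d * y1\<^sup>2 - a * d * (z1\<^sup>2 + w1\<^sup>2))" unfolding R1 by simp
    then have sum: "even (x1 + y1 + z1 + w1)" using odd_a d by auto
    have unramified_at_2 if ne: "odd (x1 + y1)"
    proof -
      have zw1: "odd (z1 + w1)" using ne sum by auto
      have "even (2 * x1 * y1 - a * (b * (w1\<^sup>2 - z1\<^sup>2) + 2 * c * z1 * w1))" unfolding S1 by simp
      then have b: "even b" using zw1 odd_a by auto
      then obtain B where B: "b = 2 * B" by (rule evenE)
      have "odd (x1 - y1)" "odd (w1\<^sup>2 - z1\<^sup>2)" "even (z1 * w1)" using ne zw1 by auto
      moreover from this obtain k where k: "(x1 - y1)\<^sup>2 = 8 * k + 1" using odd_square_int by blast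
      ultimately obtain h g where h: "w1\<^sup>2 - z1\<^sup>2 = 2 * h + 1" and g: "z1 * w1 = 2 * g" by (meson oddE evenE)
      have "odd ((z1 + w1))" using zw1 .
      then obtain f where f: "(z1 + w1)\<^sup>2 = 8 * f + 1" using odd_square_int by blast
      have "even (r\<^sup>2 - d * s'\<^sup>2)" unfolding *(4) by simp
      then have "even (r - s')" using d by auto
      then obtain v where v: "r - s' = 2 * v" by (rule evenE)
      have "4 * v = (x1\<^sup>2 + d * y1\<^sup>2 - a * d * (z1\<^sup>2 + w1\<^sup>2)) -
          (2 * x1 * y1 - a * (b * (w1\<^sup>2 - z1\<^sup>2) + 2 * c * z1 * w1))"
        using v unfolding R1 S1 by simp
      also have "\<dots> = (x1 - y1)\<^sup>2 + (d - 1) * y1\<^sup>2 -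
          a * ((z1 + w1)\<^sup>2 - 2 * (z1 * w1) + (d - 1) * (z1\<^sup>2 + w1\<^sup>2) - b * (w1\<^sup>2 - z1\<^sup>2) - 2 * c * (z1 * w1))"
        by (simp add: power2_eq_square algebra_simps)
      also have "\<dots> = (1 - a + 2 * a * B) + 4 * (2 * k + e * y1\<^sup>2 - a * (2 * f - g + e * (z1\<^sup>2 + w1\<^sup>2) - B * h - c * g))"
        unfolding k f g h e B by (simp add: algebra_simps)
      finally have 1: "4 dvd 1 - a + 2 * a * B" by presburger
      obtain a1 where a1: "a = 2 * a1 + 1" using odd_a by (rule oddE)
      have "a + b - 1 = 4 * (a1 * B + B) - (1 - a + 2 * a * B)"
        unfolding B a1 by (simp add: algebra_simps)
      also have "4 dvd \<dots>" using 1 by (intro dvd_diff) auto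
      finally show ?thesis using b by (simp add: unramified_at_2_def)
    qed
    then show ?thesis using sum zw_even even unfolding xy zw by auto
  qed
qed

text \<open>For \<open>d \<equiv> 1\<close> modulo \<open>4\<close> integrality of \<open>(r + s' \<surd>d) / 2\<close> only asks for equal parities.\<close>

lemma even_diff_of_odd_d:
  assumes d: "odd d" and "even (r - s')"
  shows "4 dvd r\<^sup>2 - d * s'\<^sup>2"
proof -
  obtain e where e: "d = 4 * e + 1" using d by (rule odd_d_facts)
  obtain h where h: "r - s' = 2 * h" using assms(2) by (rule evenE)
  then have r: "r = s' + 2 * h" by simp
  have "r\<^sup>2 - d * s'\<^sup>2 = 4 * (h\<^sup>2 + h * s' - e * s'\<^sup>2)"
    unfolding r e by (simp add: power2_eq_square algebra_simps)
  then show ?thesis by simp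
qed

lemma unramified_facts:
  assumes d: "odd d" and unramified_at_2
  obtains B f l e where "b = 2 * B" "a = 1 - 2 * B + 4 * f" "c\<^sup>2 = 8 * l + 1" "d = 4 * e + 1" "e = B\<^sup>2 + 2 * l"
proof -
  have b: "even b" and ab: "4 dvd a + b - 1" using assms(2) by (simp_all add: unramified_at_2_def)
  have c: "odd c" using d b unfolding d_eq by simp
  obtain B where B: "b = 2 * B" using b by (rule evenE)
  obtain f where f: "a + b - 1 = 4 * f" using ab by blast
  obtain l where l: "c\<^sup>2 = 8 * l + 1" using c odd_square_int by blast
  obtain e where e: "d = 4 * e + 1" using d by (rule odd_d_facts)
  have "e = B\<^sup>2 + 2 * l" using d_eq l unfolding B e by (simp add: power_mult_distrib)
  moreover have "a = 1 - 2 * B + 4 * f" using f B by simp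
  ultimately show ?thesis using that B l e by blast
qed

text \<open>
  With \<open>norm_x = 8r\<close> and \<open>norm_y = 8s'\<close> the point is that \<open>r - s'\<close> is even. Since \<open>norm_x - norm_y\<close> is
  \<open>(x - y)\<^sup>2 - a (z - c w)\<^sup>2\<close> up to terms divisible by \<open>4\<close>, put \<open>x - y = 2p\<close> and \<open>z - c w = 2q\<close>: the difference is
  \<open>4 (p\<^sup>2 - a q\<^sup>2 - B\<^sup>2)\<close> modulo \<open>16\<close> with \<open>b = 2B\<close>, and the assumed congruence for \<open>x y\<close> says \<open>p \<equiv> q + B\<close> modulo \<open>2\<close>.
\<close>

lemma integral_coords_odd:
  assumes d: "odd d" and g: unramified_at_2 and odd: "odd x" "odd y" "odd z" "odd w"
    and cong: "4 dvd x * y - a * c * z * w"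
  shows "integral_coords x y z w"
proof -
  obtain B f l e where g: "b = 2 * B" "a = 1 - 2 * B + 4 * f" "c\<^sup>2 = 8 * l + 1" "d = 4 * e + 1" "e = B\<^sup>2 + 2 * l"
    using d g by (rule unramified_facts)
  have "odd (c\<^sup>2)" unfolding g(3) by simp
  then have c: "odd c" by simp
  obtain i where i: "x\<^sup>2 = 8 * i + 1" using odd odd_square_int by blast
  obtain j where j: "y\<^sup>2 = 8 * j + 1" using odd odd_square_int by blast
  obtain m where m: "z\<^sup>2 = 8 * m + 1" using odd odd_square_int by blast
  obtain n where n: "w\<^sup>2 = 8 * n + 1" using odd odd_square_int by blast
  obtain k where k: "x * y - a * c * z * w = 4 * k" using cong by blast
  have "even (x - y)" "even (z - c * w)" using odd c by simp_all
  then obtain p q where pq: "x - y = 2 * p" "z - c * w = 2 * q" by (meson evenE)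
  have "even (B * (B + 1))" "even (q * (q + 1))" by simp_all
  then obtain B2 q2 where B2: "B * (B + 1) = 2 * B2" and q2: "q * (q + 1) = 2 * q2" by (meson evenE)
  define r where "r = i + j + 4 * e * j - a * d * (m + n) + B2 + l - f - a * e"
  define s' where "s' = k - a * b * (n - m)"
  have S: "2 * x * y - a * (b * (w\<^sup>2 - z\<^sup>2) + 2 * c * z * w) = 8 * s'"
  proof -
    have "2 * x * y - a * (b * (w\<^sup>2 - z\<^sup>2) + 2 * c * z * w) = 2 * (x * y - a * c * z * w) - a * b * (w\<^sup>2 - z\<^sup>2)"
      by (simp add: algebra_simps)
    then show ?thesis unfolding k m n s'_def by (simp add: algebra_simps)
  qed
  have R: "x\<^sup>2 + d * y\<^sup>2 - a * d * (z\<^sup>2 + w\<^sup>2) = 8 * r"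
  proof -
    have "x\<^sup>2 + d * y\<^sup>2 - a * d * (z\<^sup>2 + w\<^sup>2) =
        2 * (1 + 2 * e - a) + 8 * (i + j + 4 * e * j - a * d * (m + n) - a * e)"
      unfolding i j m n g(4) by (simp add: algebra_simps)
    also have "1 + 2 * e - a = 2 * (B * (B + 1)) + 4 * (l - f)"
      unfolding g(5) by (subst g(2)) (simp add: power2_eq_square algebra_simps)
    finally show ?thesis unfolding r_def B2 by simp
  qed
  have "even (p - q - B)"
  proof -
    obtain y1 w1 c1 where o: "y = 2 * y1 + 1" "w = 2 * w1 + 1" "c = 2 * c1 + 1"
      using odd c by (meson oddE)
    have "4 * k = y\<^sup>2 + 2 * p * y - a * (c\<^sup>2 * w\<^sup>2 + 2 * q * (c * w))"
    proof -
      have "x = y + 2 * p" "z = c * w + 2 * q" using pq by simp_all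
      then show ?thesis unfolding k[symmetric] by (simp add: power2_eq_square algebra_simps)
    qed
    also have "\<dots> = 1 + 2 * p - a * (1 + 2 * q) + 4 * (2 * j + p * y1 - a * (2 * l + 2 * n + 16 * l * n + q * (2 * c1 * w1 + c1 + w1)))"
      unfolding j g(3) n by (simp add: o algebra_simps)
    also have "1 + 2 * p - a * (1 + 2 * q) = 2 * (p - q - B) + 4 * (B + B * q - f - 2 * f * q)"
      by (subst g(2)) (simp add: algebra_simps)
    finally have "4 * k = 2 * (p - q - B) + 4 * (B + B * q - f - 2 * f * q) +
      4 * (2 * j + p * y1 - a * (2 * l + 2 * n + 16 * l * n + q * (2 * c1 * w1 + c1 + w1)))" .
    moreover have "4 * k = 2 * p' + 4 * m1 + 4 * m2 \<Longrightarrow> even p'" for p' m1 m2 :: int by presburger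
    ultimately show ?thesis by blast
  qed
  then obtain h where "p - q - B = 2 * h" by (rule evenE)
  then have p: "p = B + q + 2 * h" by simp
  have "even (1 - a)" using odd_a by simp
  then obtain a1 where a1: "1 - a = 2 * a1" by (rule evenE)
  have "8 * (r - s') = (x\<^sup>2 + d * y\<^sup>2 - a * d * (z\<^sup>2 + w\<^sup>2)) - (2 * x * y - a * (b * (w\<^sup>2 - z\<^sup>2) + 2 * c * z * w))"
    unfolding R S by simp
  also have "\<dots> = (x - y)\<^sup>2 + (d - 1) * y\<^sup>2 - a * ((z - c * w)\<^sup>2 + (1 - c\<^sup>2) * w\<^sup>2 + (d - 1) * (z\<^sup>2 + w\<^sup>2) - b * (w\<^sup>2 - z\<^sup>2))"
    by (simp add: power2_eq_square algebra_simps)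
  also have "\<dots> = 4 * (p\<^sup>2 - a * q\<^sup>2 - B\<^sup>2 + (e + 2 * a * l - 2 * a * e + B\<^sup>2)) +
      16 * (2 * e * j + 4 * a * l * n - 2 * a * e * (m + n) + a * B * (n - m))"
    unfolding pq g(3) j m n g(1,4) by (simp add: power_mult_distrib algebra_simps)
  \<comment> \<open>This part vanishes modulo 4 because \<open>a\<close> is odd.\<close>
  also have "e + 2 * a * l - 2 * a * e + B\<^sup>2 = 2 * (1 - a) * (B\<^sup>2 + l)"
    unfolding g(5) by (simp add: algebra_simps)
  also have "p\<^sup>2 - a * q\<^sup>2 - B\<^sup>2 = 2 * B * (q * (q + 1)) + 4 * (h\<^sup>2 + h * B + h * q - f * q\<^sup>2)"
    unfolding p by (subst g(2)) (simp add: power2_eq_square algebra_simps)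
  finally have "8 * (r - s') = 16 * (B * q2 + (h\<^sup>2 + h * B + h * q - f * q\<^sup>2) + a1 * (B\<^sup>2 + l) +
       (2 * e * j + 4 * a * l * n - 2 * a * e * (m + n) + a * B * (n - m)))"
    unfolding q2 a1 by (simp add: algebra_simps)
  then have "r - s' = 2 * (B * q2 + (h\<^sup>2 + h * B + h * q - f * q\<^sup>2) + a1 * (B\<^sup>2 + l) +
       (2 * e * j + 4 * a * l * n - 2 * a * e * (m + n) + a * B * (n - m)))" by simp
  then have "even (r - s')" by (metis dvd_triv_left)
  then have "4 dvd r\<^sup>2 - d * s'\<^sup>2" by (rule even_diff_of_odd_d[OF d])
  moreover have "x\<^sup>2 - d * y\<^sup>2 = 4 * (2 * i - 8 * e * j - e - 2 * j)"
    unfolding i j g(4) by (simp add: algebra_simps)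
  ultimately show ?thesis using R S by (intro integral_coordsI)
qed

lemma integral_coords_even:
  assumes d: "odd d" and g: unramified_at_2 and sum: "even (x + y + z + w)"
  shows "integral_coords (2 * x) (2 * y) (2 * z) (2 * w)"
proof -
  obtain B f l e where g: "b = 2 * B" "a = 1 - 2 * B + 4 * f" "c\<^sup>2 = 8 * l + 1" "d = 4 * e + 1" "e = B\<^sup>2 + 2 * l"
    using d g by (rule unramified_facts)
  have "odd (c\<^sup>2)" unfolding g(3) by simp
  then have c: "odd c" by simp
  have "even (x\<^sup>2 + d * y\<^sup>2 - a * d * (z\<^sup>2 + w\<^sup>2))" using sum odd_a d by auto
  then obtain r where r: "x\<^sup>2 + d * y\<^sup>2 - a * d * (z\<^sup>2 + w\<^sup>2) = 2 * r" by (rule evenE)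
  define s' where "s' = x * y - a * (B * (w\<^sup>2 - z\<^sup>2) + c * z * w)"
  have "2 * (r - s') = (x - y)\<^sup>2 + (d - 1) * y\<^sup>2 -
      a * ((z - c * w)\<^sup>2 + (1 - c\<^sup>2) * w\<^sup>2 + (d - 1) * (z\<^sup>2 + w\<^sup>2) - 2 * B * (w\<^sup>2 - z\<^sup>2))"
    using r unfolding s'_def by (simp add: power2_eq_square algebra_simps)
  also have "\<dots> = (x - y)\<^sup>2 - a * ((z - c * w)\<^sup>2 - 2 * B * (w\<^sup>2 - z\<^sup>2)) + 4 * (e * y\<^sup>2 - a * (e * (z\<^sup>2 + w\<^sup>2) - 2 * l * w\<^sup>2))"
    unfolding g(3,4) by (simp add: algebra_simps)
  finally have rs: "2 * (r - s') = (x - y)\<^sup>2 - a * ((z - c * w)\<^sup>2 - 2 * B * (w\<^sup>2 - z\<^sup>2)) + 4 * (e * y\<^sup>2 - a * (e * (z\<^sup>2 + w\<^sup>2) - 2 * l * w\<^sup>2))" .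
  have "4 dvd (x - y)\<^sup>2 - a * ((z - c * w)\<^sup>2 - 2 * B * (w\<^sup>2 - z\<^sup>2))"
  proof (cases "even (x - y)")
    case True
    then have "even (z - c * w)" "even (w\<^sup>2 - z\<^sup>2)" using sum c by auto
    then obtain p q h where "x - y = 2 * p" "z - c * w = 2 * q" "w\<^sup>2 - z\<^sup>2 = 2 * h" using True by (meson evenE)
    then have "(x - y)\<^sup>2 - a * ((z - c * w)\<^sup>2 - 2 * B * (w\<^sup>2 - z\<^sup>2)) = 4 * (p\<^sup>2 - a * (q\<^sup>2 - B * h))"
      by (simp add: power_mult_distrib algebra_simps)
    then show ?thesis by simp
  next
    case False
    then have "odd (z - c * w)" "odd (w\<^sup>2 - z\<^sup>2)" using sum c by auto
    moreover obtain p where p: "(x - y)\<^sup>2 = 8 * p + 1" using False odd_square_int by blast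
    ultimately obtain q h where qh: "(z - c * w)\<^sup>2 = 8 * q + 1" "w\<^sup>2 - z\<^sup>2 = 2 * h + 1"
      by (meson odd_square_int oddE)
    have "(x - y)\<^sup>2 - a * ((z - c * w)\<^sup>2 - 2 * B * (w\<^sup>2 - z\<^sup>2)) = 1 - a + 2 * a * B + 4 * (2 * p - a * (2 * q - B * h))"
      unfolding p qh by (simp add: algebra_simps)
    also have "1 - a + 2 * a * B = 4 * (B - f - B\<^sup>2 + 2 * f * B)"
      by (subst (1 2) g(2)) (simp add: power2_eq_square algebra_simps)
    finally show ?thesis by simp
  qed
  then have "4 dvd 2 * (r - s')" unfolding rs by simp
  then have "even (r - s')" by presburger
  then have *: "4 dvd r\<^sup>2 - d * s'\<^sup>2" by (rule even_diff_of_odd_d[OF d])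
  show ?thesis
  proof (rule integral_coordsI[OF _ _ _ *])
    show "(2 * x)\<^sup>2 - d * (2 * y)\<^sup>2 = 4 * (x\<^sup>2 - d * y\<^sup>2)" by (simp add: power_mult_distrib)
    show "(2 * x)\<^sup>2 + d * (2 * y)\<^sup>2 - a * d * ((2 * z)\<^sup>2 + (2 * w)\<^sup>2) = 8 * r"
      using r by (simp add: power_mult_distrib algebra_simps)
    show "2 * (2 * x) * (2 * y) - a * (b * ((2 * w)\<^sup>2 - (2 * z)\<^sup>2) + 2 * c * (2 * z) * (2 * w)) = 8 * s'"
      unfolding s'_def g(1) by (simp add: power_mult_distrib algebra_simps)
  qed
qed

lemma integral_coords_quadratic:
  assumes d: "odd d" and sum: "even (x + y)"
  shows "integral_coords (2 * x) (2 * y) 0 0"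
proof -
  have "even (x\<^sup>2 + d * y\<^sup>2)" using sum d by auto
  then obtain r where r: "x\<^sup>2 + d * y\<^sup>2 = 2 * r" by (rule evenE)
  obtain e where e: "d = 4 * e + 1" using d by (rule odd_d_facts)
  have "even (x - y)" using sum by simp
  then obtain h where h: "x - y = 2 * h" by (rule evenE)
  have "2 * (r - x * y) = (x - y)\<^sup>2 + (d - 1) * y\<^sup>2"
    using r by (simp add: power2_eq_square algebra_simps)
  then have "2 * (r - x * y) = 2 * (2 * (h\<^sup>2 + e * y\<^sup>2))" unfolding h e by (simp add: power_mult_distrib)
  then have "r - x * y = 2 * (h\<^sup>2 + e * y\<^sup>2)" by simp
  then have "even (r - x * y)" by (metis dvd_triv_left)
  then have *: "4 dvd r\<^sup>2 - d * (x * y)\<^sup>2" by (rule even_diff_of_odd_d[OF d])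
  show ?thesis
    by (rule integral_coordsI[OF _ _ _ *, where T = "x\<^sup>2 - d * y\<^sup>2"])
      (use r in \<open>simp_all add: power_mult_distrib\<close>)
qed

lemma integral_coords_4: "integral_coords (4 * x) (4 * y) (4 * z) (4 * w)"
proof (rule integral_coordsI)
  show "(4 * x)\<^sup>2 - d * (4 * y)\<^sup>2 = 4 * (4 * (x\<^sup>2 - d * y\<^sup>2))"
    by (simp add: power_mult_distrib)
  show "(4 * x)\<^sup>2 + d * (4 * y)\<^sup>2 - a * d * ((4 * z)\<^sup>2 + (4 * w)\<^sup>2) = 8 * (2 * (x\<^sup>2 + d * y\<^sup>2 - a * d * (z\<^sup>2 + w\<^sup>2)))"
    by (simp add: power_mult_distrib algebra_simps)
  show "2 * (4 * x) * (4 * y) - a * (b * ((4 * w)\<^sup>2 - (4 * z)\<^sup>2) + 2 * c * (4 * z) * (4 * w)) =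
      8 * (2 * (2 * x * y - a * (b * (w\<^sup>2 - z\<^sup>2) + 2 * c * z * w)))"
    by (simp add: power_mult_distrib algebra_simps)
  show "4 dvd (2 * u)\<^sup>2 - d * (2 * v)\<^sup>2" for u v :: int
    by (simp add: power_mult_distrib)
qed

end

section \<open>Well-rounded lattices with a diagonal form\<close>

lemma square_ge_1: "x \<noteq> 0 \<Longrightarrow> x\<^sup>2 \<ge> (1 :: int)"
  using zero_less_power2[of x] by linarith

lemma square_ge_4: "x \<noteq> 0 \<Longrightarrow> even x \<Longrightarrow> x\<^sup>2 \<ge> (4 :: int)"
  using square_ge_1 by (auto elim!: evenE)

text \<open>If \<open>P\<close> is odd, a second coordinate is nonzero by parity; if \<open>P\<close> is even, then \<open>P\<^sup>2 \<ge> 4\<close>.\<close>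

lemma diagonal_form_lower_bound_D4:
  fixes P Q R S p q r s :: int
  assumes par: "even (P + Q + R + S)" and P: "P \<noteq> 0"
    and pos: "p > 0" "q > 0" "r > 0" "s > 0"
    and N: "N = p * P\<^sup>2 + q * Q\<^sup>2 + r * R\<^sup>2 + s * S\<^sup>2"
  shows "4 * p \<le> N \<or> p + q \<le> N \<or> p + r \<le> N \<or> p + s \<le> N"
proof -
  have bound: "m \<le> m * M\<^sup>2" if "M \<noteq> 0" "m > 0" for m M :: int
    using mult_left_mono[OF square_ge_1[OF that(1)], of m] that(2) by simp
  have nonneg: "p * P\<^sup>2 \<ge> 0" "q * Q\<^sup>2 \<ge> 0" "r * R\<^sup>2 \<ge> 0" "s * S\<^sup>2 \<ge> 0" using pos by simp_all
  consider "even P" | "Q \<noteq> 0" | "R \<noteq> 0" | "S \<noteq> 0" using par P by auto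
  then show ?thesis
  proof cases
    case 1
    have "p * 4 \<le> p * P\<^sup>2" using square_ge_4[OF P 1] pos by (intro mult_left_mono) auto
    then have "4 * p \<le> N" using nonneg unfolding N by linarith
    then show ?thesis by blast
  next
    case 2
    have "p + q \<le> N" using bound[OF 2 pos(2)] bound[OF P pos(1)] nonneg unfolding N by linarith
    then show ?thesis by blast
  next
    case 3
    have "p + r \<le> N" using bound[OF 3 pos(3)] bound[OF P pos(1)] nonneg unfolding N by linarith
    then show ?thesis by blast
  next
    case 4
    have "p + s \<le> N" using bound[OF 4 pos(4)] bound[OF P pos(1)] nonneg unfolding N by linarith
    then show ?thesis by blast
  qed
qed

text \<open>The scaling factor \<open>\<kappa>\<close> keeps the values of the quadratic form integral.\<close>

locale orthogonal_frame =
  fixes e1 e2 e3 e4 :: "'a::euclidean_space" and \<kappa> :: real and d t :: int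
  assumes orthogonal: "e1 \<bullet> e2 = 0" "e1 \<bullet> e3 = 0" "e1 \<bullet> e4 = 0" "e2 \<bullet> e3 = 0" "e2 \<bullet> e4 = 0" "e3 \<bullet> e4 = 0"
    and norms: "e1 \<bullet> e1 = \<kappa>" "e2 \<bullet> e2 = \<kappa> * of_int d" "e3 \<bullet> e3 = \<kappa> * of_int t" "e4 \<bullet> e4 = \<kappa> * of_int t"
    and pos: "\<kappa> > 0" "d > 0" "t > 0"
begin

definition vec :: "int \<Rightarrow> int \<Rightarrow> int \<Rightarrow> int \<Rightarrow> 'a" where
  "vec x y z w = of_int x *\<^sub>R e1 + of_int y *\<^sub>R e2 + of_int z *\<^sub>R e3 + of_int w *\<^sub>R e4"

definition form :: "int \<Rightarrow> int \<Rightarrow> int \<Rightarrow> int \<Rightarrow> int" where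
  "form x y z w = x\<^sup>2 + d * y\<^sup>2 + t * (z\<^sup>2 + w\<^sup>2)"

abbreviation lattice :: "(int \<Rightarrow> int \<Rightarrow> int \<Rightarrow> int \<Rightarrow> bool) \<Rightarrow> 'a set" where
  "lattice L \<equiv> {vec x y z w | x y z w. L x y z w}"

abbreviation frame_span :: "'a set" where "frame_span \<equiv> span {e1, e2, e3, e4}"

lemma orthogonal': "e2 \<bullet> e1 = 0" "e3 \<bullet> e1 = 0" "e4 \<bullet> e1 = 0" "e3 \<bullet> e2 = 0" "e4 \<bullet> e2 = 0" "e4 \<bullet> e3 = 0"
  using orthogonal by (simp_all add: inner_commute)

lemma norm_vec: "(norm (vec x y z w))\<^sup>2 = \<kappa> * of_int (form x y z w)"
  unfolding power2_norm_eq_inner vec_def form_def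
  by (simp add: inner_add_left inner_add_right norms orthogonal orthogonal' power2_eq_square algebra_simps)

lemma form_nonneg: "form x y z w \<ge> 0"
  using pos by (simp add: form_def)

lemma form_eq_0_iff: "form x y z w = 0 \<longleftrightarrow> x = 0 \<and> y = 0 \<and> z = 0 \<and> w = 0"
proof
  assume *: "form x y z w = 0"
  have nn: "d * y\<^sup>2 \<ge> 0" "t * (z\<^sup>2 + w\<^sup>2) \<ge> 0" "x\<^sup>2 \<ge> 0" using pos by simp_all
  then have "x\<^sup>2 = 0" "d * y\<^sup>2 = 0" "t * (z\<^sup>2 + w\<^sup>2) = 0"
    using * unfolding form_def by linarith+
  then show "x = 0 \<and> y = 0 \<and> z = 0 \<and> w = 0"
    using pos by (simp add: sum_power2_eq_zero_iff)
qed (simp add: form_def)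

lemma vec_eq_0_iff: "vec x y z w = 0 \<longleftrightarrow> x = 0 \<and> y = 0 \<and> z = 0 \<and> w = 0"
proof -
  have "vec x y z w = 0 \<longleftrightarrow> (norm (vec x y z w))\<^sup>2 = 0" by simp
  also have "\<dots> \<longleftrightarrow> form x y z w = 0" unfolding norm_vec using pos by simp
  finally show ?thesis by (simp add: form_eq_0_iff)
qed

lemma norm_vec_le_iff: "norm (vec x y z w) \<le> norm (vec x' y' z' w') \<longleftrightarrow> form x y z w \<le> form x' y' z' w'"
proof -
  have "norm (vec x y z w) \<le> norm (vec x' y' z' w') \<longleftrightarrow> (norm (vec x y z w))\<^sup>2 \<le> (norm (vec x' y' z' w'))\<^sup>2"
    by simp
  then show ?thesis unfolding norm_vec using pos by simp
qed

lemma vec_in_minimal_vectors_iff: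
  "vec x y z w \<in> minimal_vectors (lattice L) \<longleftrightarrow>
    vec x y z w \<in> lattice L \<and> form x y z w \<noteq> 0 \<and>
    (\<forall>x' y' z' w'. L x' y' z' w' \<longrightarrow> form x' y' z' w' \<noteq> 0 \<longrightarrow> form x y z w \<le> form x' y' z' w')"
proof -
  have *: "form x y z w \<noteq> 0 \<longleftrightarrow> vec x y z w \<noteq> 0" for x y z w
    by (simp add: vec_eq_0_iff form_eq_0_iff)
  show ?thesis unfolding minimal_vectors_def * norm_vec_le_iff[symmetric] by blast
qed

lemma inner_vec:
  "vec x y z w \<bullet> e1 = of_int x * \<kappa>" "vec x y z w \<bullet> e2 = of_int y * (\<kappa> * of_int d)"
  "vec x y z w \<bullet> e3 = of_int z * (\<kappa> * of_int t)" "vec x y z w \<bullet> e4 = of_int w * (\<kappa> * of_int t)"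
  unfolding vec_def
  by (simp_all add: inner_add_left norms orthogonal orthogonal')

lemma frame_nonzero: "e1 \<noteq> 0" "e2 \<noteq> 0" "e3 \<noteq> 0" "e4 \<noteq> 0"
  using norms pos by auto

lemma dim_frame_span: "dim frame_span = 4"
proof -
  have ne: "e1 \<noteq> e2" "e1 \<noteq> e3" "e1 \<noteq> e4" "e2 \<noteq> e3" "e2 \<noteq> e4" "e3 \<noteq> e4"
    using orthogonal frame_nonzero by (metis inner_eq_zero_iff)+
  have "independent {e1, e2, e3, e4}"
    using orthogonal frame_nonzero
    by (intro pairwise_orthogonal_independent)
      (auto simp: pairwise_def orthogonal_def orthogonal orthogonal')
  then have "dim frame_span = card {e1, e2, e3, e4}" by (rule dim_span_eq_card_independent)
  then show ?thesis using ne by simp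
qed

lemma vec_in_frame_span: "vec x y z w \<in> frame_span"
  unfolding vec_def by (intro span_add span_scale span_base) auto

text \<open>Minimal vectors that span cannot all be orthogonal to one of the axes.\<close>

lemma well_rounded_imp:
  assumes "well_rounded frame_span (lattice L)"
  obtains N where
    "\<And>x y z w. L x y z w \<Longrightarrow> form x y z w \<noteq> 0 \<Longrightarrow> N \<le> form x y z w"
    "\<exists>x y z w. L x y z w \<and> form x y z w = N \<and> x \<noteq> 0"
    "\<exists>x y z w. L x y z w \<and> form x y z w = N \<and> y \<noteq> 0"
    "\<exists>x y z w. L x y z w \<and> form x y z w = N \<and> z \<noteq> 0"
    "\<exists>x y z w. L x y z w \<and> form x y z w = N \<and> w \<noteq> 0"
proof -
  obtain B where B: "B \<subseteq> minimal_vectors (lattice L)" "finite B" "independent B" "card B = dim frame_span"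
    using assms unfolding well_rounded_def by auto
  have "B \<subseteq> frame_span" using B(1) vec_in_frame_span unfolding minimal_vectors_def by auto
  then have span: "frame_span \<subseteq> span B" using B(3,4) card_ge_dim_independent by (metis order_refl)
  have nonorth: "\<exists>v\<in>B. v \<bullet> e \<noteq> 0" if e: "e \<in> {e1, e2, e3, e4}" for e
  proof (rule ccontr)
    assume "\<not> ?thesis"
    then have orth: "\<And>v. v \<in> B \<Longrightarrow> orthogonal e v" by (auto simp: orthogonal_def inner_commute)
    have "e \<in> frame_span" using e by (rule span_base)
    with span have "e \<in> span B" by (rule subsetD)
    from orthogonal_to_span[OF this orth] have "orthogonal e e" .
    then show False using e frame_nonzero by (auto simp: orthogonal_def)
  qed
  have mem: "\<exists>x y z w. v = vec x y z w \<and> L x y z w \<and> form x y z w \<noteq> 0 \<and>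
      (\<forall>x' y' z' w'. L x' y' z' w' \<longrightarrow> form x' y' z' w' \<noteq> 0 \<longrightarrow> form x y z w \<le> form x' y' z' w')"
    if "v \<in> B" for v
  proof -
    have v: "v \<in> minimal_vectors (lattice L)" using that B(1) by auto
    then obtain x y z w where xyzw: "v = vec x y z w" "L x y z w"
      unfolding minimal_vectors_def by auto
    show ?thesis
      using v xyzw(2) unfolding xyzw(1) vec_in_minimal_vectors_iff
      by (intro exI[of _ x] exI[of _ y] exI[of _ z] exI[of _ w]) simp
  qed
  have ex: "\<exists>x y z w. vec x y z w \<bullet> e \<noteq> 0 \<and> L x y z w \<and> form x y z w \<noteq> 0 \<and>
      (\<forall>x' y' z' w'. L x' y' z' w' \<longrightarrow> form x' y' z' w' \<noteq> 0 \<longrightarrow> form x y z w \<le> form x' y' z' w')"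
    if "e \<in> {e1, e2, e3, e4}" for e
    using nonorth[OF that] mem by metis
  obtain x1 y1 z1 w1 where 1: "L x1 y1 z1 w1" "form x1 y1 z1 w1 \<noteq> 0"
      "\<And>x' y' z' w'. L x' y' z' w' \<Longrightarrow> form x' y' z' w' \<noteq> 0 \<Longrightarrow> form x1 y1 z1 w1 \<le> form x' y' z' w'"
    using ex[of e1] by auto
  have all: "\<exists>x y z w. L x y z w \<and> form x y z w = form x1 y1 z1 w1 \<and> vec x y z w \<bullet> e \<noteq> 0"
    if "e \<in> {e1, e2, e3, e4}" for e
    using ex[OF that] 1 by (meson order_antisym)
  show ?thesis
    using all[of e1] all[of e2] all[of e3] all[of e4] 1(3) pos
    by (intro that[of "form x1 y1 z1 w1"]) (auto simp: inner_vec)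
qed

text \<open>The four vectors differ by the signs in the rows of a Hadamard matrix, so suitable sums of them are multiples of the axes.\<close>

lemma well_roundedI:
  assumes nz: "x \<noteq> 0" "y \<noteq> 0" "z \<noteq> 0" "w \<noteq> 0"
    and L: "L x y z w" "L x y (- z) (- w)" "L x (- y) z (- w)" "L x (- y) (- z) w"
    and min: "\<And>x' y' z' w'. L x' y' z' w' \<Longrightarrow> form x' y' z' w' \<noteq> 0 \<Longrightarrow> form x y z w \<le> form x' y' z' w'"
  shows "well_rounded frame_span (lattice L)"
proof -
  define B where "B = {vec x y z w, vec x y (- z) (- w), vec x (- y) z (- w), vec x (- y) (- z) w}"
  have "form x y z w \<noteq> 0" using nz form_eq_0_iff by blast
  then have B: "B \<subseteq> minimal_vectors (lattice L)"
    using L min unfolding B_def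
    by (auto simp: vec_in_minimal_vectors_iff form_def[of x y "- z"] form_def[of x "- y"] form_def[of x y z w, symmetric])
  have fin: "finite B" by (simp add: B_def)
  have Bs: "B \<subseteq> frame_span" unfolding B_def using vec_in_frame_span by auto
  have scale: "e \<in> span B" if "of_int k *\<^sub>R e \<in> span B" "k \<noteq> 0" for e and k :: int
    using span_scale[OF that(1), of "inverse (of_int k)"] that(2) by simp
  have mem: "v \<in> span B" if "v \<in> B" for v using that by (rule span_base)
  have four: "(r * 4) *\<^sub>R e = r *\<^sub>R e + (r *\<^sub>R e + (r *\<^sub>R e + r *\<^sub>R e))" for r and e :: 'a
    by (simp flip: scaleR_add_left)
  let ?v1 = "vec x y z w" and ?v2 = "vec x y (- z) (- w)" and ?v3 = "vec x (- y) z (- w)" and ?v4 = "vec x (- y) (- z) w"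
  have "of_int (4 * x) *\<^sub>R e1 = ?v1 + ?v2 + (?v3 + ?v4)" "of_int (4 * y) *\<^sub>R e2 = ?v1 + ?v2 - (?v3 + ?v4)"
    "of_int (4 * z) *\<^sub>R e3 = ?v1 + ?v3 - (?v2 + ?v4)" "of_int (4 * w) *\<^sub>R e4 = ?v1 + ?v4 - (?v2 + ?v3)"
    by (simp_all add: vec_def four algebra_simps)
  moreover have "?v1 \<in> span B" "?v2 \<in> span B" "?v3 \<in> span B" "?v4 \<in> span B"
    by (rule mem, simp add: B_def)+
  ultimately have "of_int (4 * x) *\<^sub>R e1 \<in> span B" "of_int (4 * y) *\<^sub>R e2 \<in> span B"
    "of_int (4 * z) *\<^sub>R e3 \<in> span B" "of_int (4 * w) *\<^sub>R e4 \<in> span B"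
    by (simp_all only: span_add span_diff)
  then have "e1 \<in> span B" "e2 \<in> span B" "e3 \<in> span B" "e4 \<in> span B"
    using nz by (auto intro: scale[of "4 * x"] scale[of "4 * y"] scale[of "4 * z"] scale[of "4 * w"])
  then have span: "frame_span \<subseteq> span B" by (intro span_minimal) auto
  have "card B \<le> 4" unfolding B_def
    by (intro order_trans[OF card_insert_le_m1] order_trans[OF card_insert_le_m1, of 3]
        order_trans[OF card_insert_le_m1, of 2]) auto
  then have ind: "independent B"
    using Bs span fin dim_frame_span by (metis card_le_dim_spanning)
  then have "card B = dim frame_span" using Bs span by (metis basis_card_eq_dim)
  then show ?thesis unfolding well_rounded_def using B fin ind by blast
qed

text \<open>
  The right-hand side says that the odd vectors of value \<open>u + v + 2t\<close> are at most as long as the shortest vectors of the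
  even part, a copy of \<open>D\<^sub>4\<close>. Then they are minimal, and they occur with all the signs needed to span. Conversely, if all minimal
  vectors were even and shorter, then the lower bounds that come from nonzero first, second and third coordinates would be
  incompatible.
\<close>

lemma well_rounded_D4_iff:
  fixes g h \<epsilon> :: int
  defines "u \<equiv> g\<^sup>2" and "v \<equiv> d * h\<^sup>2"
  assumes gh: "odd g" "odd h" "g > 0" "h > 0" and \<epsilon>: "odd \<epsilon>"
    and L: "\<And>x y z w. L x y z w \<longleftrightarrow> g dvd x \<and> h dvd y \<and>
      (odd x \<and> odd y \<and> odd z \<and> odd w \<and> 4 dvd x * y - \<epsilon> * z * w \<or>
       even x \<and> even y \<and> even z \<and> even w \<and> even (x div 2 + y div 2 + z div 2 + w div 2))"
  shows "well_rounded frame_span (lattice L) \<longleftrightarrow>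
    u + v + 2 * t \<le> 4 * (u + v) \<and> u + v + 2 * t \<le> 4 * (u + t) \<and> u + v + 2 * t \<le> 4 * (v + t) \<and>
    u + v + 2 * t \<le> 8 * t \<and> u + v + 2 * t \<le> 16 * u \<and> u + v + 2 * t \<le> 16 * v"
    (is "?WR \<longleftrightarrow> ?C")
proof -
  have uv: "u > 0" "v > 0" using gh pos by (simp_all add: u_def v_def)
  have odd_vec: "u + v + 2 * t \<le> form x y z w" if "L x y z w" "odd x" for x y z w
  proof -
    have 1: "g dvd x" "h dvd y" "odd y" "odd z" "odd w" using that L by auto
    then have nz: "x \<noteq> 0" "y \<noteq> 0" "z \<noteq> 0" "w \<noteq> 0" using that by auto
    have "g\<^sup>2 \<le> x\<^sup>2" "h\<^sup>2 \<le> y\<^sup>2" using 1 nz by (auto intro!: zdvd_imp_le)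
    moreover have "1 \<le> z\<^sup>2" "1 \<le> w\<^sup>2" using square_ge_1 nz by auto
    ultimately have "u \<le> x\<^sup>2" "v \<le> d * y\<^sup>2" "t * 2 \<le> t * (z\<^sup>2 + w\<^sup>2)"
      unfolding u_def v_def using pos by (auto intro!: mult_left_mono)
    then show ?thesis unfolding form_def by linarith
  qed
  have even_vec: "(x \<noteq> 0 \<longrightarrow> N \<ge> 4 * (u + v) \<or> N \<ge> 4 * (u + t) \<or> N \<ge> 16 * u) \<and>
      (y \<noteq> 0 \<longrightarrow> N \<ge> 4 * (u + v) \<or> N \<ge> 4 * (v + t) \<or> N \<ge> 16 * v) \<and>
      (z \<noteq> 0 \<longrightarrow> N \<ge> 4 * (u + t) \<or> N \<ge> 4 * (v + t) \<or> N \<ge> 8 * t \<or> N \<ge> 16 * t) \<and>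
      (w \<noteq> 0 \<longrightarrow> N \<ge> 4 * (u + t) \<or> N \<ge> 4 * (v + t) \<or> N \<ge> 8 * t \<or> N \<ge> 16 * t)"
    if l: "L x y z w" "even x" and N: "N = form x y z w" for x y z w N
  proof -
    obtain X0 Y0 Z W where h2: "x = 2 * X0" "y = 2 * Y0" "z = 2 * Z" "w = 2 * W"
      using l L by (auto elim!: evenE)
    have "g dvd X0" "h dvd Y0"
      using l L gh unfolding h2 by (auto simp: coprime_dvd_mult_right_iff)
    then obtain X1 Y1 where XY: "X0 = g * X1" "Y0 = h * Y1" by (auto elim!: dvdE)
    have par: "even (X1 + Y1 + Z + W)" using l L gh unfolding h2 XY by simp
    define V where "V = u * X1\<^sup>2 + v * Y1\<^sup>2 + t * Z\<^sup>2 + t * W\<^sup>2"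
    have N': "N = 4 * V"
      unfolding N V_def form_def h2 XY u_def v_def by (simp add: power2_eq_square algebra_simps)
    have "4 * u \<le> V \<or> u + v \<le> V \<or> u + t \<le> V" if "X1 \<noteq> 0"
      using diagonal_form_lower_bound_D4[of X1 Y1 Z W u v t t V] that par uv pos by (auto simp: V_def)
    moreover have "4 * v \<le> V \<or> u + v \<le> V \<or> v + t \<le> V" if "Y1 \<noteq> 0"
      using diagonal_form_lower_bound_D4[of Y1 X1 Z W v u t t V] that par uv pos by (auto simp: V_def add_ac)
    moreover have "4 * t \<le> V \<or> u + t \<le> V \<or> v + t \<le> V \<or> t + t \<le> V" if "Z \<noteq> 0"
      using diagonal_form_lower_bound_D4[of Z X1 Y1 W t u v t V] that par uv pos by (auto simp: V_def add_ac)
    moreover have "4 * t \<le> V \<or> u + t \<le> V \<or> v + t \<le> V \<or> t + t \<le> V" if "W \<noteq> 0"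
      using diagonal_form_lower_bound_D4[of W X1 Y1 Z t u v t V] that par uv pos by (auto simp: V_def add_ac)
    ultimately show ?thesis unfolding N' h2 XY by auto
  qed
  show ?thesis
  proof
    assume ?WR
    then obtain N where N: "\<And>x y z w. L x y z w \<Longrightarrow> form x y z w \<noteq> 0 \<Longrightarrow> N \<le> form x y z w"
        "\<exists>x y z w. L x y z w \<and> form x y z w = N \<and> x \<noteq> 0"
        "\<exists>x y z w. L x y z w \<and> form x y z w = N \<and> y \<noteq> 0"
        "\<exists>x y z w. L x y z w \<and> form x y z w = N \<and> z \<noteq> 0"
      by (rule well_rounded_imp) blast
    have "N \<ge> u + v + 2 * t"
    proof (rule ccontr)
      assume less: "\<not> ?thesis"
      then have "\<And>x y z w. L x y z w \<Longrightarrow> form x y z w = N \<Longrightarrow> even x" using odd_vec by blast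
      with N(2-4) even_vec have
        "N \<ge> 4 * (u + v) \<or> N \<ge> 4 * (u + t) \<or> N \<ge> 16 * u"
        "N \<ge> 4 * (u + v) \<or> N \<ge> 4 * (v + t) \<or> N \<ge> 16 * v"
        "N \<ge> 4 * (u + t) \<or> N \<ge> 4 * (v + t) \<or> N \<ge> 8 * t \<or> N \<ge> 16 * t"
        by metis+
      then show False using less uv pos(3) by (smt (verit))
    qed
    \<comment> \<open>The types of short vectors of the even part.\<close>
    moreover have "N \<le> 4 * (u + v)" "N \<le> 4 * (u + t)" "N \<le> 4 * (v + t)" "N \<le> 8 * t" "N \<le> 16 * u" "N \<le> 16 * v"
    proof -
      have *: "L (2*g) (2*h) 0 0" "L (2*g) 0 2 0" "L 0 (2*h) 2 0" "L 0 0 2 2" "L (4*g) 0 0 0" "L 0 (4*h) 0 0"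
        using gh by (auto simp: L)
      note N(1)[OF *(1)] N(1)[OF *(2)] N(1)[OF *(3)] N(1)[OF *(4)] N(1)[OF *(5)] N(1)[OF *(6)]
      note this[unfolded form_eq_0_iff]
      moreover have "form (2*g) (2*h) 0 0 = 4 * (u + v)" "form (2*g) 0 2 0 = 4 * (u + t)" "form 0 (2*h) 2 0 = 4 * (v + t)"
        "form 0 0 2 2 = 8 * t" "form (4*g) 0 0 0 = 16 * u" "form 0 (4*h) 0 0 = 16 * v"
        by (simp_all add: form_def u_def v_def power_mult_distrib)
      ultimately show "N \<le> 4 * (u + v)" "N \<le> 4 * (u + t)" "N \<le> 4 * (v + t)" "N \<le> 8 * t" "N \<le> 16 * u" "N \<le> 16 * v"
        using gh by simp_all
    qed
    ultimately show ?C by linarith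
  next
    assume C: ?C
    \<comment> \<open>The sign of the last coordinate that satisfies the congruence for odd vectors.\<close>
    obtain \<kappa>' :: int where \<kappa>': "\<kappa>' = 1 \<or> \<kappa>' = - 1" "4 dvd g * h - \<epsilon> * \<kappa>'"
    proof (cases "4 dvd g * h - \<epsilon>")
      case True
      then show ?thesis by (intro that[of 1]) auto
    next
      case False
      have "odd (g * h)" using gh by simp
      moreover have "odd k \<Longrightarrow> \<not> 4 dvd k - \<epsilon> \<Longrightarrow> 4 dvd k + \<epsilon>" for k
        using \<epsilon> by presburger
      ultimately have "4 dvd g * h + \<epsilon>" using False by blast
      then show ?thesis by (intro that[of "- 1"]) auto
    qed
    have min: "form g h 1 \<kappa>' \<le> form x y z w" if l: "L x y z w" and nz: "form x y z w \<noteq> 0" for x y z w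
    proof -
      have "form g h 1 \<kappa>' = u + v + 2 * t" using \<kappa>'(1) by (auto simp: form_def u_def v_def)
      moreover have "u + v + 2 * t \<le> form x y z w"
      proof (cases "odd x")
        case True
        then show ?thesis using odd_vec l by blast
      next
        case False
        then have "even x" by simp
        from even_vec[OF l this refl] nz C pos(3) show ?thesis unfolding form_eq_0_iff by (smt (verit))
      qed
      ultimately show ?thesis by simp
    qed
    have odd': "odd \<kappa>'" using \<kappa>'(1) by auto
    have neg: "4 dvd \<epsilon> * \<kappa>' - g * h" using \<kappa>'(2) by (subst dvd_diff_commute)
    show ?WR
    proof (rule well_roundedI[OF _ _ _ _ _ _ _ _ min])
      show "g \<noteq> 0" "h \<noteq> 0" "(1 :: int) \<noteq> 0" "\<kappa>' \<noteq> 0" using gh \<kappa>'(1) by auto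
      show "L g h 1 \<kappa>'" "L g h (- 1) (- \<kappa>')" using gh odd' \<kappa>'(2) by (simp_all add: L)
      show "L g (- h) 1 (- \<kappa>')" "L g (- h) (- 1) \<kappa>'" using gh odd' neg by (simp_all add: L)
    qed
  qed
qed

text \<open>
  The lattice contains its projection to the plane of the first two axes, so each minimal vector lies in one of the two
  coordinate planes, and both planes contain minimal vectors. In the first plane the minimum is \<open>4(u + v)\<close>, unless \<open>u = v\<close>; in the second it is \<open>4t\<close> times \<open>2\<close> or \<open>4\<close>.
\<close>

lemma well_rounded_split_lattice_imp:
  fixes g h :: int
  defines "u \<equiv> g\<^sup>2" and "v \<equiv> d * h\<^sup>2"
  assumes gh: "odd g" "odd h" "g > 0" "h > 0"
    and L: "\<And>x y z w. L x y z w \<Longrightarrow> g dvd x \<and> h dvd y \<and> even x \<and> even y \<and> even z \<and> even w \<and>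
       even (x div 2 + y div 2) \<and> even (z div 2 + w div 2)"
    and L': "\<And>x y z w. L x y z w \<Longrightarrow> L x y 0 0" "L (2 * g) (2 * h) 0 0" "L (4 * g) 0 0 0" "L 0 (4 * h) 0 0" "L 0 0 4 0"
    and wr: "well_rounded frame_span (lattice L)"
  shows "u = v \<or> v \<le> 3 * u \<and> u \<le> 3 * v \<and> (u + v = 2 * t \<or> u + v = 4 * t)"
proof -
  have uv: "u > 0" "v > 0" using gh pos by (simp_all add: u_def v_def)
  obtain N where N: "\<And>x y z w. L x y z w \<Longrightarrow> form x y z w \<noteq> 0 \<Longrightarrow> N \<le> form x y z w"
        "\<exists>x y z w. L x y z w \<and> form x y z w = N \<and> x \<noteq> 0"
        "\<exists>x y z w. L x y z w \<and> form x y z w = N \<and> y \<noteq> 0"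
        "\<exists>x y z w. L x y z w \<and> form x y z w = N \<and> z \<noteq> 0"
    by (rule well_rounded_imp[OF wr]) blast
  have le: "N \<le> 4 * (u + v)" "N \<le> 16 * u" "N \<le> 16 * v" "N \<le> 16 * t"
    using N(1)[OF L'(2)] N(1)[OF L'(3)] N(1)[OF L'(4)] N(1)[OF L'(5)] gh
    unfolding form_eq_0_iff by (simp_all add: form_def u_def v_def power_mult_distrib)
  have split: "z = 0 \<and> w = 0 \<or> x = 0 \<and> y = 0" if "L x y z w" "form x y z w = N" for x y z w
  proof (rule ccontr)
    assume ne: "\<not> ?thesis"
    then have "form x y 0 0 \<noteq> 0" by (simp add: form_eq_0_iff)
    then have "N \<le> form x y 0 0" using N(1) L'(1) that(1) by blast
    moreover have "form x y z w = form x y 0 0 + form 0 0 z w" by (simp add: form_def)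
    moreover have "form 0 0 z w > 0" using ne form_nonneg[of 0 0 z w] form_eq_0_iff[of 0 0 z w] by linarith
    ultimately show False using that(2) by simp
  qed
  have xy: "(x \<noteq> 0 \<longrightarrow> y = 0 \<longrightarrow> N \<ge> 16 * u) \<and> (y \<noteq> 0 \<longrightarrow> x = 0 \<longrightarrow> N \<ge> 16 * v) \<and>
      (x \<noteq> 0 \<longrightarrow> y \<noteq> 0 \<longrightarrow> N \<ge> 4 * (u + v))"
    if l: "L x y z w" "form x y z w = N" for x y z w
  proof -
    obtain X0 Y0 where h2: "x = 2 * X0" "y = 2 * Y0" using l L by (meson evenE)
    have "g dvd X0" "h dvd Y0"
      using L[OF l(1)] gh unfolding h2 by (auto simp: coprime_dvd_mult_right_iff)
    then obtain X1 Y1 where XY: "X0 = g * X1" "Y0 = h * Y1" by (auto elim!: dvdE)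
    have par: "even (X1 + Y1)" using L[OF l(1)] gh unfolding h2 XY by simp
    have "form x y 0 0 \<le> form x y z w" using pos by (simp add: form_def)
    moreover have "form x y 0 0 = 4 * (u * X1\<^sup>2 + v * Y1\<^sup>2)"
      unfolding form_def h2 XY u_def v_def by (simp add: power2_eq_square algebra_simps)
    ultimately have N': "N \<ge> 4 * (u * X1\<^sup>2 + v * Y1\<^sup>2)" using l by simp
    have X1: "u * 1 \<le> u * X1\<^sup>2" if "X1 \<noteq> 0" using square_ge_1[OF that] uv by (intro mult_left_mono) auto
    have Y1: "v * 1 \<le> v * Y1\<^sup>2" if "Y1 \<noteq> 0" using square_ge_1[OF that] uv by (intro mult_left_mono) auto
    have "N \<ge> 16 * u" if "X1 \<noteq> 0" "Y1 = 0"
    proof -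
      have "u * 4 \<le> u * X1\<^sup>2" using square_ge_4[of X1] par that uv by (intro mult_left_mono) auto
      then show ?thesis using N' that by simp
    qed
    moreover have "N \<ge> 16 * v" if "Y1 \<noteq> 0" "X1 = 0"
    proof -
      have "v * 4 \<le> v * Y1\<^sup>2" using square_ge_4[of Y1] par that uv by (intro mult_left_mono) auto
      then show ?thesis using N' that by simp
    qed
    moreover have "N \<ge> 4 * (u + v)" if "X1 \<noteq> 0" "Y1 \<noteq> 0" using X1 Y1 N' that by simp
    ultimately show ?thesis using gh unfolding h2 XY by auto
  qed
  have c: "N \<ge> 4 * (u + v) \<or> N \<ge> 16 * u \<and> N \<ge> 16 * v" using N(2,3) xy by metis
  obtain x y z w where zw: "L x y z w" "form x y z w = N" "z \<noteq> 0" using N(4) by blast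
  then have "x = 0" "y = 0" using split by blast+
  obtain Z W where h2: "z = 2 * Z" "w = 2 * W" using zw L by (meson evenE)
  define k where "k = Z\<^sup>2 + W\<^sup>2"
  have k: "even k" "k > 0" using L[OF zw(1)] zw(3) unfolding h2 k_def by (auto simp: sum_power2_gt_zero_iff)
  have Nk: "N = 4 * (t * k)" using zw(2) \<open>x = 0\<close> \<open>y = 0\<close> unfolding h2 k_def form_def
    by (simp add: power2_eq_square algebra_simps)
  then have "t * k \<le> t * 4" using le(4) by (simp add: mult.commute)
  then have "k \<le> 4" using pos by simp
  then have "k = 2 \<or> k = 4" using k by presburger
  then have "N = 8 * t \<or> N = 16 * t" using Nk by auto
  then show ?thesis using c le by (smt (verit))
qed

lemma well_rounded_rectangular_lattice_imp:
  fixes g h :: int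
  assumes gh: "g > 0" "h > 0"
    and L: "\<And>x y z w. L x y z w \<Longrightarrow> 4 * g dvd x \<and> 4 * h dvd y"
    and L': "L (4 * g) 0 0 0" "L 0 (4 * h) 0 0"
    and wr: "well_rounded frame_span (lattice L)"
  shows "g\<^sup>2 = d * h\<^sup>2"
proof -
  obtain N where N: "\<And>x y z w. L x y z w \<Longrightarrow> form x y z w \<noteq> 0 \<Longrightarrow> N \<le> form x y z w"
        "\<exists>x y z w. L x y z w \<and> form x y z w = N \<and> x \<noteq> 0"
        "\<exists>x y z w. L x y z w \<and> form x y z w = N \<and> y \<noteq> 0"
    by (rule well_rounded_imp[OF wr]) blast
  have le: "N \<le> 16 * g\<^sup>2" "N \<le> 16 * (d * h\<^sup>2)"
    using N(1)[OF L'(1)] N(1)[OF L'(2)] gh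
    unfolding form_eq_0_iff by (simp_all add: form_def power_mult_distrib)
  have nn: "d * y\<^sup>2 \<ge> 0" "t * (z\<^sup>2 + w\<^sup>2) \<ge> 0" "x\<^sup>2 \<ge> 0" for x y z w :: int using pos by simp_all
  obtain x y z w where 1: "L x y z w" "form x y z w = N" "x \<noteq> 0" using N(2) by blast
  have "(4 * g)\<^sup>2 \<le> x\<^sup>2" using L[OF 1(1)] 1(3) by (intro zdvd_imp_le dvd_power_same) auto
  also have "\<dots> \<le> N" unfolding 1(2)[symmetric] form_def using nn(1)[of y] nn(2)[of z w] by linarith
  finally have g: "16 * g\<^sup>2 \<le> N" by (simp add: power_mult_distrib)
  obtain x y z w where 2: "L x y z w" "form x y z w = N" "y \<noteq> 0" using N(3) by blast
  have "(4 * h)\<^sup>2 \<le> y\<^sup>2" using L[OF 2(1)] 2(3) by (intro zdvd_imp_le dvd_power_same) auto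
  then have "d * (4 * h)\<^sup>2 \<le> d * y\<^sup>2" using pos by simp
  also have "\<dots> \<le> N" unfolding 2(2)[symmetric] form_def using nn(3)[of x] nn(2)[of z w] by linarith
  finally have "16 * (d * h\<^sup>2) \<le> N" by (simp add: power_mult_distrib)
  with g le show ?thesis by linarith
qed

end

section \<open>Ideals of ramified and of inert norm\<close>

lemma order_Quot_eq_card_representatives:
  assumes I: "ideal I R" and S: "S \<subseteq> carrier R"
    and rep: "\<And>x. x \<in> carrier R \<Longrightarrow> \<exists>!r\<in>S. x \<ominus>\<^bsub>R\<^esub> r \<in> I"
  shows "order (R Quot I) = card S"
proof -
  interpret ideal I R by (rule I)
  have eq: "I +>\<^bsub>R\<^esub> x = I +>\<^bsub>R\<^esub> r \<longleftrightarrow> x \<ominus>\<^bsub>R\<^esub> r \<in> I" if "x \<in> carrier R" "r \<in> carrier R" for x r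
    using quotient_eq_iff_same_a_r_cos[OF I that] by auto
  have "bij_betw (\<lambda>r. I +>\<^bsub>R\<^esub> r) S (a_rcosets\<^bsub>R\<^esub> I)"
  proof (rule bij_betw_imageI)
    show "inj_on (\<lambda>r. I +>\<^bsub>R\<^esub> r) S"
    proof
      fix x y assume xy: "x \<in> S" "y \<in> S" "I +>\<^bsub>R\<^esub> x = I +>\<^bsub>R\<^esub> y"
      have "x \<in> carrier R" using xy S by auto
      then have "\<exists>!r\<in>S. x \<ominus>\<^bsub>R\<^esub> r \<in> I" by (rule rep)
      moreover have "x \<ominus>\<^bsub>R\<^esub> y \<in> I" "x \<ominus>\<^bsub>R\<^esub> x \<in> I" using xy S eq by blast+
      ultimately show "x = y" using xy by blast
    qed
    show "(\<lambda>r. I +>\<^bsub>R\<^esub> r) ` S = a_rcosets\<^bsub>R\<^esub> I"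
    proof
      show "(\<lambda>r. I +>\<^bsub>R\<^esub> r) ` S \<subseteq> a_rcosets\<^bsub>R\<^esub> I"
        using S unfolding A_RCOSETS_def' by auto
      show "a_rcosets\<^bsub>R\<^esub> I \<subseteq> (\<lambda>r. I +>\<^bsub>R\<^esub> r) ` S"
      proof
        fix C assume "C \<in> a_rcosets\<^bsub>R\<^esub> I"
        then obtain x where x: "x \<in> carrier R" "C = I +>\<^bsub>R\<^esub> x" unfolding A_RCOSETS_def' by auto
        obtain r where r: "r \<in> S" "x \<ominus>\<^bsub>R\<^esub> r \<in> I" using rep[OF x(1)] by blast
        then have "C = I +>\<^bsub>R\<^esub> r" using eq[of x r] x S by auto
        then show "C \<in> (\<lambda>r. I +>\<^bsub>R\<^esub> r) ` S" using r(1) by blast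
      qed
    qed
  qed
  then show ?thesis by (simp add: order_def FactRing_def bij_betw_same_card)
qed

text \<open>The canonical surjection from \<open>R/P\<close> to \<open>R/I\<close> is injective by counting; it is described on cosets by choosing representatives.\<close>

lemma ideal_eq_if_subset_same_order:
  assumes I: "ideal I R" and P: "ideal P R" and sub: "P \<subseteq> I"
    and ord: "order (R Quot P) = order (R Quot I)" "order (R Quot I) > 0"
  shows "P = I"
proof
  interpret I: ideal I R by (rule I)
  interpret P: ideal P R by (rule P)
  define g where "g C = I +>\<^bsub>R\<^esub> (SOME x. x \<in> C)" for C
  have g: "g (P +>\<^bsub>R\<^esub> x) = I +>\<^bsub>R\<^esub> x" if x: "x \<in> carrier R" for x
  proof -
    have "x \<in> P +>\<^bsub>R\<^esub> x" using x P.a_rcos_self by simp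
    then have y: "(SOME y. y \<in> P +>\<^bsub>R\<^esub> x) \<in> P +>\<^bsub>R\<^esub> x" by (rule someI)
    define y where "y = (SOME y. y \<in> P +>\<^bsub>R\<^esub> x)"
    have "y \<in> P +>\<^bsub>R\<^esub> x" using y by (simp add: y_def)
    then have "y \<in> I +>\<^bsub>R\<^esub> x" using sub by (auto simp: a_r_coset_def')
    then have "I +>\<^bsub>R\<^esub> x = I +>\<^bsub>R\<^esub> y" using x by (rule I.a_repr_independence')
    then show ?thesis by (simp add: g_def y_def)
  qed
  have "g ` (a_rcosets\<^bsub>R\<^esub> P) = a_rcosets\<^bsub>R\<^esub> I"
    unfolding A_RCOSETS_def' using g by (auto simp: image_iff)
  moreover have "card (a_rcosets\<^bsub>R\<^esub> P) = card (a_rcosets\<^bsub>R\<^esub> I)" "card (a_rcosets\<^bsub>R\<^esub> I) > 0"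
    using ord by (simp_all add: order_def FactRing_def)
  ultimately have inj: "inj_on g (a_rcosets\<^bsub>R\<^esub> P)"
    by (metis card_ge_0_finite eq_card_imp_inj_on)
  show "I \<subseteq> P"
  proof
    fix x assume x: "x \<in> I"
    then have xR: "x \<in> carrier R" by (rule I.a_Hcarr)
    have "g (P +>\<^bsub>R\<^esub> x) = g (P +>\<^bsub>R\<^esub> \<zero>\<^bsub>R\<^esub>)"
      using g[OF xR] g[of "\<zero>\<^bsub>R\<^esub>"] I.a_rcos_zero[OF I x] I.a_rcos_zero[OF I additive_subgroup.zero_closed[OF I.is_additive_subgroup]] by simp
    then have "P +>\<^bsub>R\<^esub> x = P +>\<^bsub>R\<^esub> \<zero>\<^bsub>R\<^esub>"
      using inj xR by (auto simp: inj_on_def A_RCOSETS_def')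
    then have "P +>\<^bsub>R\<^esub> x = P"
      using I.a_rcos_zero[OF P additive_subgroup.zero_closed[OF P.is_additive_subgroup]] by simp
    then show "x \<in> P" using xR P.a_rcos_self by blast
  qed
qed (rule sub)

context cyclic_quartic
begin

abbreviation \<O> :: "complex ring" where "\<O> \<equiv> ring_of_integers K"

lemma \<O>_simps [simp]:
  "u \<in> carrier \<O> \<longleftrightarrow> u \<in> K \<and> algebraic_int u" "mult \<O> = (*)" "one \<O> = 1"
  "zero \<O> = 0" "add \<O> = (+)"
  by (simp_all add: ring_of_integers_def)

lemma algebraic_int_K_add: "\<lbrakk>u \<in> K; v \<in> K; algebraic_int u; algebraic_int v\<rbrakk> \<Longrightarrow> algebraic_int (u + v)"
  by (simp add: algebraic_int_iff_almost_integral K_add almost_integral_add)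

lemma algebraic_int_K_mult: "\<lbrakk>u \<in> K; v \<in> K; algebraic_int u; algebraic_int v\<rbrakk> \<Longrightarrow> algebraic_int (u * v)"
  by (simp add: algebraic_int_iff_almost_integral K_mult almost_integral_mult)

lemma cring_\<O>: "cring \<O>"
proof (intro cringI abelian_groupI comm_monoidI)
  show "\<exists>v\<in>carrier \<O>. v \<oplus>\<^bsub>\<O>\<^esub> u = \<zero>\<^bsub>\<O>\<^esub>" if "u \<in> carrier \<O>" for u
    using that by (intro bexI[of _ "- u"]) (auto simp: K_minus)
qed (use K_rat[of 1] K_rat[of 0] in \<open>auto simp: K_add K_mult algebraic_int_K_add algebraic_int_K_mult algebra_simps int_imp_algebraic_int\<close>)

lemma a_inv_\<O>: "u \<in> carrier \<O> \<Longrightarrow> \<ominus>\<^bsub>\<O>\<^esub> u = - u"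
proof -
  interpret cring \<O> by (rule cring_\<O>)
  assume u: "u \<in> carrier \<O>"
  show ?thesis using minus_equality[of "- u" u] u by (simp add: K_minus)
qed

lemma a_minus_\<O>: "u \<in> carrier \<O> \<Longrightarrow> v \<in> carrier \<O> \<Longrightarrow> u \<ominus>\<^bsub>\<O>\<^esub> v = u - v"
  by (simp add: a_minus_def a_inv_\<O>)

lemma idealD_\<O>:
  assumes "ideal I \<O>"
  shows "\<And>u. u \<in> I \<Longrightarrow> u \<in> carrier \<O>" "\<And>u v. u \<in> I \<Longrightarrow> v \<in> I \<Longrightarrow> u + v \<in> I"
    "\<And>u v. u \<in> I \<Longrightarrow> v \<in> carrier \<O> \<Longrightarrow> v * u \<in> I" "0 \<in> I" "\<And>u v. u \<in> I \<Longrightarrow> v \<in> I \<Longrightarrow> u - v \<in> I"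
proof -
  interpret ideal I \<O> by (rule assms)
  show 1: "\<And>u. u \<in> I \<Longrightarrow> u \<in> carrier \<O>" by (rule a_Hcarr)
  show 2: "\<And>u v. u \<in> I \<Longrightarrow> v \<in> I \<Longrightarrow> u + v \<in> I" using additive_subgroup.a_closed[OF is_additive_subgroup] by simp
  show 3: "\<And>u v. u \<in> I \<Longrightarrow> v \<in> carrier \<O> \<Longrightarrow> v * u \<in> I" using I_l_closed by simp
  show "0 \<in> I" using additive_subgroup.zero_closed[OF is_additive_subgroup] by simp
  show "u - v \<in> I" if "u \<in> I" "v \<in> I" for u v
    using 2[OF that(1) 3[OF that(2), of "- 1"]] K_rat[of "- 1"]
    by (simp add: of_rat_minus)
qed

lemma idealI_\<O>:
  assumes "I \<subseteq> carrier \<O>" "0 \<in> I" "\<And>u v. u \<in> I \<Longrightarrow> v \<in> I \<Longrightarrow> u + v \<in> I"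
    "\<And>u v. u \<in> I \<Longrightarrow> v \<in> carrier \<O> \<Longrightarrow> v * u \<in> I"
  shows "ideal I \<O>"
proof (rule idealI)
  show "ring \<O>" using cring_\<O> by (simp add: cring_def)
  have m1: "- 1 \<in> carrier \<O>" using K_rat[of "- 1"] by (simp add: of_rat_minus)
  have "- u \<in> I" if "u \<in> I" for u using assms(4)[OF that m1] by simp
  then have "\<ominus>\<^bsub>\<O>\<^esub> u \<in> I" if "u \<in> I" for u using that assms(1) a_inv_\<O>[of u] by auto
  then show "subgroup I (add_monoid \<O>)"
    using assms by unfold_locales (auto simp: a_inv_def)
  show "v \<otimes>\<^bsub>\<O>\<^esub> u \<in> I" "u \<otimes>\<^bsub>\<O>\<^esub> v \<in> I" if "u \<in> I" "v \<in> carrier \<O>" for u v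
    using assms(4)[OF that] by (simp_all add: mult.commute)
qed

lemma add_pow_\<O>: "u \<in> carrier \<O> \<Longrightarrow> [(k::int)] \<cdot>\<^bsub>\<O>\<^esub> u = of_int k * u"
proof -
  interpret cring \<O> by (rule cring_\<O>)
  assume u: "u \<in> carrier \<O>"
  have nat: "[(n::nat)] \<cdot>\<^bsub>\<O>\<^esub> u = of_nat n * u" for n
    by (induction n) (use u in \<open>auto simp: algebra_simps\<close>)
  have nat': "of_nat n * u \<in> carrier \<O>" for n
    using add.nat_pow_closed[OF u, of n] nat by simp
  show ?thesis
  proof (cases k rule: int_cases2)
    case (nonneg n)
    then show ?thesis using nat[of n] by (simp add: add_pow_int_ge)
  next
    case (nonpos n)
    have "[(- int n)] \<cdot>\<^bsub>\<O>\<^esub> u = \<ominus>\<^bsub>\<O>\<^esub> ([n] \<cdot>\<^bsub>\<O>\<^esub> u)"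
      using add.int_pow_neg[OF u, of "int n"] by (simp add: add_pow_int_ge)
    then show ?thesis unfolding nonpos using a_inv_\<O>[OF nat'[of n]] by (simp add: nat)
  qed
qed

lemma of_int_in_\<O>: "of_int k \<in> carrier \<O>"
  using K_rat[of "of_int k"] by (simp add: int_imp_algebraic_int)

lemma quotient_facts:
  assumes I: "ideal I \<O>" and n: "order (\<O> Quot I) = n" "n > 0"
  shows "cring (\<O> Quot I)" "finite (carrier (\<O> Quot I))"
    "\<And>u. u \<in> carrier \<O> \<Longrightarrow> I +>\<^bsub>\<O>\<^esub> u = \<zero>\<^bsub>\<O> Quot I\<^esub> \<longleftrightarrow> u \<in> I"
    "\<And>u v. u \<in> carrier \<O> \<Longrightarrow> v \<in> carrier \<O> \<Longrightarrow>
      (I +>\<^bsub>\<O>\<^esub> u) \<otimes>\<^bsub>\<O> Quot I\<^esub> (I +>\<^bsub>\<O>\<^esub> v) = I +>\<^bsub>\<O>\<^esub> (u * v)"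
    "\<And>u. u \<in> carrier \<O> \<Longrightarrow> I +>\<^bsub>\<O>\<^esub> u \<in> carrier (\<O> Quot I)"
    "\<And>k :: int. I +>\<^bsub>\<O>\<^esub> (of_int k) = [k] \<cdot>\<^bsub>\<O> Quot I\<^esub> \<one>\<^bsub>\<O> Quot I\<^esub>"
    "of_nat n \<in> I"
proof -
  interpret ideal I \<O> by (rule I)
  interpret h: ring_hom_ring \<O> "\<O> Quot I" "(+>\<^bsub>\<O>\<^esub>) I" by (rule rcos_ring_hom_ring)
  show cr: "cring (\<O> Quot I)" using cring_\<O> by (rule quotient_is_cring)
  show fin: "finite (carrier (\<O> Quot I))" using n by (simp add: order_def card_ge_0_finite)
  show zero: "I +>\<^bsub>\<O>\<^esub> u = \<zero>\<^bsub>\<O> Quot I\<^esub> \<longleftrightarrow> u \<in> I" if "u \<in> carrier \<O>" for u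
    using that a_rcos_zero[OF I] a_rcos_self[OF _ , of u]
    by (auto simp: FactRing_def)
  show "(I +>\<^bsub>\<O>\<^esub> u) \<otimes>\<^bsub>\<O> Quot I\<^esub> (I +>\<^bsub>\<O>\<^esub> v) = I +>\<^bsub>\<O>\<^esub> (u * v)" if "u \<in> carrier \<O>" "v \<in> carrier \<O>" for u v
    using h.hom_mult[OF that] by simp
  show "I +>\<^bsub>\<O>\<^esub> u \<in> carrier (\<O> Quot I)" if "u \<in> carrier \<O>" for u
    using that by (rule h.hom_closed)
  have gh: "group_hom (add_monoid \<O>) (add_monoid (\<O> Quot I)) ((+>\<^bsub>\<O>\<^esub>) I)"
    by (rule h.a_group_hom)
  have one: "1 \<in> carrier \<O>" using of_int_in_\<O>[of 1] by simp
  show int: "I +>\<^bsub>\<O>\<^esub> (of_int k) = [k] \<cdot>\<^bsub>\<O> Quot I\<^esub> \<one>\<^bsub>\<O> Quot I\<^esub>" for k :: int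
    using group_hom.hom_int_pow[OF gh, of 1 k] one add_pow_\<O>[OF one, of k] h.hom_one
    by (simp add: add_pow_def)
  interpret Q: cring "\<O> Quot I" by (rule cr)
  have "[int n] \<cdot>\<^bsub>\<O> Quot I\<^esub> \<one>\<^bsub>\<O> Quot I\<^esub> = \<zero>\<^bsub>\<O> Quot I\<^esub>"
    using group.pow_order_eq_1[OF h.S.a_group, of "\<one>\<^bsub>\<O> Quot I\<^esub>"] n(1)
    by (simp add: order_def add_pow_int_ge) (simp add: add_pow_def)
  then have "I +>\<^bsub>\<O>\<^esub> (of_int (int n)) = \<zero>\<^bsub>\<O> Quot I\<^esub>" unfolding int .
  then show "of_nat n \<in> I" using zero[OF of_int_in_\<O>[of "int n"]] by simp
qed

lemma contains_if_contains_square: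
  assumes I: "ideal I \<O>" and n: "order (\<O> Quot I) = n" "n > 0"
    and reduced: "\<And>t. t \<in> carrier (\<O> Quot I) \<Longrightarrow> t \<otimes>\<^bsub>\<O> Quot I\<^esub> t = \<zero>\<^bsub>\<O> Quot I\<^esub> \<Longrightarrow> t = \<zero>\<^bsub>\<O> Quot I\<^esub>"
    and u: "u \<in> carrier \<O>" "u * u \<in> I"
  shows "u \<in> I"
proof -
  note Q = quotient_facts[OF I n]
  have "(I +>\<^bsub>\<O>\<^esub> u) \<otimes>\<^bsub>\<O> Quot I\<^esub> (I +>\<^bsub>\<O>\<^esub> u) = \<zero>\<^bsub>\<O> Quot I\<^esub>"
    using Q(3)[OF idealD_\<O>(1)[OF I u(2)]] Q(4)[OF u(1) u(1)] u(2) by simp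
  then show ?thesis using reduced[OF Q(5)[OF u(1)]] Q(3)[OF u(1)] by simp
qed

text \<open>
  A common factor of the quarter coordinates of all integers. It lets the cases of even and odd \<open>d\<close> share one description
  of the ideals: for odd \<open>d\<close> the denominator \<open>4\<close> is invertible modulo the norm, for even \<open>d\<close> it never occurs.
\<close>

definition coord_divisor :: int where "coord_divisor = (if even d then 4 else 1)"

lemma integral_coords_coord_divisor_dvd:
  assumes "integral_coords x y z w"
  shows "coord_divisor dvd x" "coord_divisor dvd y" "coord_divisor dvd z" "coord_divisor dvd w"
  using assms integral_coords_even_d_iff unfolding coord_divisor_def by auto

text \<open>The ideal of ramified norm \<open>p\<close> is the case \<open>g = p, h = 1\<close>, the ideal of inert norm \<open>q\<^sup>2\<close> is \<open>g = h = q\<close>.\<close>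

definition ideal_lattice :: "int \<Rightarrow> int \<Rightarrow> int \<Rightarrow> int \<Rightarrow> int \<Rightarrow> int \<Rightarrow> bool" where
  "ideal_lattice g h x y z w \<longleftrightarrow> integral_coords x y z w \<and> coord_divisor * g dvd x \<and> coord_divisor * h dvd y"

definition ideal_set :: "int \<Rightarrow> int \<Rightarrow> complex set" where
  "ideal_set g h = {qel x y z w | x y z w. ideal_lattice g h x y z w}"

lemma qel_in_ideal_set_iff: "qel x y z w \<in> ideal_set g h \<longleftrightarrow> ideal_lattice g h x y z w"
  by (auto simp: ideal_set_def)

lemma \<O>_cases:
  assumes "u \<in> carrier \<O>"
  obtains x y z w where "u = qel x y z w" "integral_coords x y z w"
proof -
  have "almost_integral u" using assms by (auto intro: algebraic_int_imp_almost_integral)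
  then show ?thesis by (rule almost_integral_imp_integral_coords) (rule that)
qed

lemma qel_in_\<O>_iff: "qel x y z w \<in> carrier \<O> \<longleftrightarrow> integral_coords x y z w"
  by (simp add: algebraic_int_qel_iff)

lemma qel_add: "qel x y z w + qel x' y' z' w' = qel (x + x') (y + y') (z + z') (w + w')"
  by (simp add: qel_def el_add el_eq_iff add_divide_distrib)

lemma qel_mult:
  assumes "qel x y z w * qel x' y' z' w' = qel x'' y'' z'' w''"
  shows "4 * x'' = x * x' + d * (y * y') + a * d * (z * z' + w * w')"
    and "4 * y'' = x * y' + y * x' + a * (b * (w * w' - z * z') + c * (z * w' + w * z'))"
proof -
  have "of_int (4 * x'') = (of_int (x * x' + d * (y * y') + a * d * (z * z' + w * w')) :: rat)"
    "of_int (4 * y'') = (of_int (x * y' + y * x' + a * (b * (w * w' - z * z') + c * (z * w' + w * z'))) :: rat)"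
    using assms unfolding qel_def el_mult el_eq_iff by (simp_all add: field_simps)
  then show "4 * x'' = x * x' + d * (y * y') + a * d * (z * z' + w * w')"
    "4 * y'' = x * y' + y * x' + a * (b * (w * w' - z * z') + c * (z * w' + w * z'))"
    unfolding of_int_eq_iff by auto
qed

lemma dvd_of_coord_divisor_square_dvd:
  assumes "coord_divisor = 1 \<Longrightarrow> odd g" "coord_divisor * (coord_divisor * g) dvd 4 * (x :: int)"
  shows "coord_divisor * g dvd x"
proof (cases "even d")
  case True
  then show ?thesis using assms(2) dvd_mult_cancel_left[of 4 "4 * g" x] by (simp add: coord_divisor_def)
next
  case False
  then have "odd g" "g dvd 4 * x" using assms by (simp_all add: coord_divisor_def)
  moreover from this have "coprime g (2 ^ 2)" by (subst coprime_power_right_iff) auto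
  ultimately show ?thesis using False by (simp add: coord_divisor_def coprime_dvd_mult_right_iff)
qed

lemma ideal_set_ideal:
  assumes g: "coord_divisor = 1 \<Longrightarrow> odd g" and h: "coord_divisor = 1 \<Longrightarrow> odd h"
    and dvd: "g dvd d * h" "g dvd a * d" "h dvd g" "h dvd a"
  shows "ideal (ideal_set g h) \<O>"
proof (rule idealI_\<O>)
  show "ideal_set g h \<subseteq> carrier \<O>"
    unfolding ideal_set_def ideal_lattice_def using qel_in_\<O>_iff by blast
  have "qel 0 0 0 0 \<in> ideal_set g h"
    unfolding qel_in_ideal_set_iff ideal_lattice_def using integral_coords_4[of 0 0 0 0] by simp
  then show "0 \<in> ideal_set g h" by (simp add: qel_def el_def)
next
  fix u v assume "u \<in> ideal_set g h" "v \<in> ideal_set g h"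
  then obtain x y z w x' y' z' w' where u: "u = qel x y z w" "ideal_lattice g h x y z w"
    and v: "v = qel x' y' z' w'" "ideal_lattice g h x' y' z' w'" unfolding ideal_set_def by auto
  have "qel x y z w + qel x' y' z' w' \<in> carrier \<O>"
    using u v by (auto simp: ideal_lattice_def algebraic_int_qel_iff K_add algebraic_int_K_add)
  then show "u + v \<in> ideal_set g h"
    using u v unfolding qel_add qel_in_\<O>_iff
    by (simp add: qel_add qel_in_ideal_set_iff ideal_lattice_def)
next
  fix u v assume uv: "u \<in> ideal_set g h" "v \<in> carrier \<O>"
  obtain x' y' z' w' where u: "u = qel x' y' z' w'" "ideal_lattice g h x' y' z' w'"
    using uv(1) unfolding ideal_set_def by auto
  obtain x y z w where v: "v = qel x y z w" "integral_coords x y z w" using uv(2) by (rule \<O>_cases)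
  have "v * u \<in> carrier \<O>"
    using u v by (auto simp: ideal_lattice_def algebraic_int_qel_iff K_mult algebraic_int_K_mult)
  then obtain x'' y'' z'' w'' where vu: "v * u = qel x'' y'' z'' w''" "integral_coords x'' y'' z'' w''"
    by (rule \<O>_cases)
  note eq = qel_mult[OF vu(1)[unfolded u(1) v(1)]]
  have iu: "integral_coords x' y' z' w'" "coord_divisor * g dvd x'" "coord_divisor * h dvd y'"
    using u(2) by (simp_all add: ideal_lattice_def)
  obtain x1 y1 z1 w1 where 1: "x = coord_divisor * x1" "y = coord_divisor * y1" "z = coord_divisor * z1" "w = coord_divisor * w1"
    using integral_coords_coord_divisor_dvd[OF v(2)] by (meson dvdE)
  obtain x2 y2 z2 w2 where 2: "x' = coord_divisor * g * x2" "y' = coord_divisor * h * y2" "z' = coord_divisor * z2" "w' = coord_divisor * w2"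
    using integral_coords_coord_divisor_dvd(3,4)[OF iu(1)] iu(2,3) by (meson dvdE)
  have "4 * x'' = coord_divisor * (coord_divisor * (g * (x1 * x2) + (d * h) * (y1 * y2) + (a * d) * (z1 * z2 + w1 * w2)))"
    unfolding eq 1 2 by (simp add: algebra_simps)
  moreover have "g dvd g * (x1 * x2) + (d * h) * (y1 * y2) + (a * d) * (z1 * z2 + w1 * w2)"
    using dvd by (intro dvd_add dvd_mult2[of g g] dvd_mult2[of g "d * h"] dvd_mult2[of g "a * d"]) auto
  ultimately have "coord_divisor * (coord_divisor * g) dvd 4 * x''" by (simp only: mult_dvd_mono dvd_refl)
  with g have "coord_divisor * g dvd x''" by (rule dvd_of_coord_divisor_square_dvd)
  have "4 * y'' = coord_divisor * (coord_divisor * (h * (x1 * y2) + g * (x2 * y1) + a * (b * (w1 * w2 - z1 * z2) + c * (z1 * w2 + w1 * z2))))"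
    unfolding eq 1 2 by (simp add: algebra_simps)
  moreover have "h dvd h * (x1 * y2) + g * (x2 * y1) + a * (b * (w1 * w2 - z1 * z2) + c * (z1 * w2 + w1 * z2))"
    using dvd by (intro dvd_add dvd_mult2[of h h] dvd_mult2[of h g] dvd_mult2[of h a]) auto
  ultimately have "coord_divisor * (coord_divisor * h) dvd 4 * y''" by (simp only: mult_dvd_mono dvd_refl)
  with h have "coord_divisor * h dvd y''" by (rule dvd_of_coord_divisor_square_dvd)
  with \<open>coord_divisor * g dvd x''\<close> show "v * u \<in> ideal_set g h"
    using vu by (simp add: qel_in_ideal_set_iff ideal_lattice_def)
qed

lemma ex1_residue:
  assumes g: "coord_divisor = 1 \<Longrightarrow> odd g" "g > 0" and x: "coord_divisor dvd x"
  shows "\<exists>!i. i \<in> {0..<g} \<and> coord_divisor * g dvd x - 4 * i"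
proof -
  have ex: "\<exists>i. coord_divisor * g dvd x - 4 * i"
  proof (cases "even d")
    case True
    then obtain k where "x = 4 * k" using x by (auto simp: coord_divisor_def)
    then show ?thesis by (intro exI[of _ k]) simp
  next
    case False
    then have "odd g" using g by (simp add: coord_divisor_def)
    then have "coprime (2 ^ 2) g" by (subst coprime_power_left_iff) auto
    then obtain k where "[4 * k = 1] (mod g)" using cong_solve_coprime_int[of 4 g] by auto
    then have "g dvd (1 - 4 * k) * x" by (simp add: cong_iff_dvd_diff dvd_diff_commute)
    then show ?thesis using False by (intro exI[of _ "k * x"]) (simp add: coord_divisor_def algebra_simps)
  qed
  have iff: "coord_divisor * g dvd x - 4 * i \<longleftrightarrow> g dvd i - j" if "coord_divisor * g dvd x - 4 * j" for i j
  proof -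
    have "coord_divisor * g dvd x - 4 * i \<longleftrightarrow> coord_divisor * g dvd (x - 4 * j) - 4 * (i - j)" by (simp add: algebra_simps)
    also have "\<dots> \<longleftrightarrow> coord_divisor * g dvd 4 * (i - j)" using that dvd_diff_right_iff by blast
    also have "\<dots> \<longleftrightarrow> g dvd i - j"
    proof (cases "even d")
      case False
      then have "odd g" using g by (simp add: coord_divisor_def)
      then have "coprime g (2 ^ 2)" by (subst coprime_power_right_iff) auto
      then have "coprime g 4" by simp
      then have "g dvd 4 * (i - j) \<longleftrightarrow> g dvd i - j" by (rule coprime_dvd_mult_right_iff)
      then show ?thesis using False by (simp add: coord_divisor_def)
    qed (simp add: coord_divisor_def del: right_diff_distrib_numeral)
    finally show ?thesis .
  qed
  obtain j where j: "coord_divisor * g dvd x - 4 * j" using ex by blast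
  show ?thesis
  proof (rule ex1I[of _ "j mod g"])
    show "j mod g \<in> {0..<g} \<and> coord_divisor * g dvd x - 4 * (j mod g)"
      using g(2) iff[OF j] by (simp add: mod_eq_dvd_iff[symmetric])
    fix i assume "i \<in> {0..<g} \<and> coord_divisor * g dvd x - 4 * i"
    then have "i \<in> {0..<g}" "g dvd i - j" using iff[OF j] by auto
    then show "i = j mod g" by (metis atLeastLessThan_iff mod_eq_dvd_iff mod_pos_pos_trivial)
  qed
qed

text \<open>The elements \<open>i + j s\<close> with \<open>0 \<le> i < g\<close> and \<open>0 \<le> j < h\<close> represent the residue classes.\<close>

lemma order_ideal_set:
  assumes I: "ideal (ideal_set g h) \<O>"
    and g: "coord_divisor = 1 \<Longrightarrow> odd g" "g > 0" and h: "coord_divisor = 1 \<Longrightarrow> odd h" "h > 0"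
  shows "order (\<O> Quot ideal_set g h) = nat (g * h)"
proof -
  define rep where "rep = (\<lambda>(i, j). qel (4 * i) (4 * j) 0 0)"
  have repO: "rep ij \<in> carrier \<O>" for ij
  proof -
    have "rep ij = qel (4 * fst ij) (4 * snd ij) (4 * 0) (4 * 0)" by (simp add: rep_def split_beta)
    then show ?thesis using integral_coords_4 by (simp only: qel_in_\<O>_iff)
  qed
  have "order (\<O> Quot ideal_set g h) = card (rep ` ({0..<g} \<times> {0..<h}))"
  proof (rule order_Quot_eq_card_representatives[OF I])
    show "rep ` ({0..<g} \<times> {0..<h}) \<subseteq> carrier \<O>" using repO by auto
    fix u assume u: "u \<in> carrier \<O>"
    then obtain x y z w where xyzw: "u = qel x y z w" "integral_coords x y z w" by (rule \<O>_cases)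
    have diff: "u \<ominus>\<^bsub>\<O>\<^esub> rep (i, j) \<in> ideal_set g h \<longleftrightarrow> coord_divisor * g dvd x - 4 * i \<and> coord_divisor * h dvd y - 4 * j" for i j
    proof -
      have eq: "u \<ominus>\<^bsub>\<O>\<^esub> rep (i, j) = qel (x - 4 * i) (y - 4 * j) z w"
        unfolding a_minus_\<O>[OF u repO] unfolding rep_def xyzw
        by (simp add: qel_def el_diff el_eq_iff diff_divide_distrib)
      interpret cring \<O> by (rule cring_\<O>)
      have "u \<ominus>\<^bsub>\<O>\<^esub> rep (i, j) \<in> carrier \<O>" using u repO by (rule minus_closed)
      then show ?thesis unfolding eq qel_in_\<O>_iff by (simp add: qel_in_ideal_set_iff ideal_lattice_def)
    qed
    obtain i where i: "i \<in> {0..<g} \<and> coord_divisor * g dvd x - 4 * i"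
      and i': "\<And>i'. i' \<in> {0..<g} \<and> coord_divisor * g dvd x - 4 * i' \<Longrightarrow> i' = i"
      using ex1_residue[OF g integral_coords_coord_divisor_dvd(1)[OF xyzw(2)]] by metis
    obtain j where j: "j \<in> {0..<h} \<and> coord_divisor * h dvd y - 4 * j"
      and j': "\<And>j'. j' \<in> {0..<h} \<and> coord_divisor * h dvd y - 4 * j' \<Longrightarrow> j' = j"
      using ex1_residue[OF h integral_coords_coord_divisor_dvd(2)[OF xyzw(2)]] by metis
    show "\<exists>!r\<in>rep ` ({0..<g} \<times> {0..<h}). u \<ominus>\<^bsub>\<O>\<^esub> r \<in> ideal_set g h"
    proof (rule ex1I[of _ "rep (i, j)"])
      show "rep (i, j) \<in> rep ` ({0..<g} \<times> {0..<h}) \<and> u \<ominus>\<^bsub>\<O>\<^esub> rep (i, j) \<in> ideal_set g h"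
        using i j diff by auto
      fix r assume "r \<in> rep ` ({0..<g} \<times> {0..<h}) \<and> u \<ominus>\<^bsub>\<O>\<^esub> r \<in> ideal_set g h"
      then obtain i1 j1 where r: "r = rep (i1, j1)" "i1 \<in> {0..<g}" "j1 \<in> {0..<h}" "u \<ominus>\<^bsub>\<O>\<^esub> rep (i1, j1) \<in> ideal_set g h"
        by auto
      then have "i1 = i" "j1 = j" using diff i' j' by blast+
      then show "r = rep (i, j)" using r by simp
    qed
  qed
  also have "\<dots> = card ({0..<g} \<times> {0..<h})"
    by (rule card_image) (auto simp: inj_on_def rep_def)
  also have "\<dots> = nat (g * h)" using g h by (simp add: card_cartesian_product nat_mult_distrib)
  finally show ?thesis .
qed

lemma generators_in_\<O>: "s \<in> carrier \<O>" "\<beta> \<in> carrier \<O>" "\<beta>' \<in> carrier \<O>"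
proof -
  have "s = qel 0 4 0 0" "\<beta> = qel 0 0 4 0" "\<beta>' = qel 0 0 0 4" by (simp_all add: qel_def el_def)
  then show "s \<in> carrier \<O>" "\<beta> \<in> carrier \<O>" "\<beta>' \<in> carrier \<O>"
    using integral_coords_4[of 0 1 0 0] integral_coords_4[of 0 0 1 0] integral_coords_4[of 0 0 0 1]
    by (simp_all only: qel_in_\<O>_iff) simp_all
qed

text \<open>If \<open>d\<close> is odd, then \<open>4u\<close> is a combination of the generators and \<open>g u\<close> is in \<open>I\<close>, with \<open>g\<close> odd.\<close>

lemma ideal_set_subset:
  assumes I: "ideal I \<O>" and gen: "of_int g \<in> I" "of_int h * s \<in> I" "\<beta> \<in> I" "\<beta>' \<in> I"
    and g: "coord_divisor = 1 \<Longrightarrow> odd g"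
  shows "ideal_set g h \<subseteq> I"
proof
  note ID = idealD_\<O>[OF I]
  fix u assume "u \<in> ideal_set g h"
  then obtain x y z w where u: "u = qel x y z w" "ideal_lattice g h x y z w" unfolding ideal_set_def by auto
  have ic: "integral_coords x y z w" "coord_divisor * g dvd x" "coord_divisor * h dvd y"
    using u(2) by (simp_all add: ideal_lattice_def)
  then have uO: "u \<in> carrier \<O>" using u(1) qel_in_\<O>_iff by simp
  obtain x1 y1 z1 w1 where 1: "x = coord_divisor * g * x1" "y = coord_divisor * h * y1" "z = coord_divisor * z1" "w = coord_divisor * w1"
    using integral_coords_coord_divisor_dvd(3,4)[OF ic(1)] ic(2,3) by (meson dvdE)
  have "of_int x1 * of_int g + of_int y1 * (of_int h * s) + of_int z1 * \<beta> + of_int w1 * \<beta>' \<in> I"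
    by (intro ID(2) ID(3) gen of_int_in_\<O>)
  also have "of_int x1 * of_int g + of_int y1 * (of_int h * s) + of_int z1 * \<beta> + of_int w1 * \<beta>' =
      of_int (4 div coord_divisor) * u"
    unfolding u(1) 1 qel_def el_def coord_divisor_def
    by (auto simp: of_rat_divide of_rat_mult algebra_simps)
  finally have mu: "of_int (4 div coord_divisor) * u \<in> I" .
  show "u \<in> I"
  proof (cases "even d")
    case True
    then show ?thesis using mu by (simp add: coord_divisor_def)
  next
    case False
    then have "odd g" using g by (simp add: coord_divisor_def)
    then have "coprime (2 ^ 2) g" by (subst coprime_power_left_iff) auto
    then have "coprime 4 g" by simp
    then obtain k l where kl: "k * 4 + l * g = 1" using bezout_int[of 4 g] by (auto simp: coprime_iff_gcd_eq_1)
    have 4: "4 * u \<in> I" using mu False by (simp add: coord_divisor_def)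
    have gu: "u * of_int g \<in> I" by (intro ID(3) gen uO)
    have "of_int k * (4 * u) + of_int l * (u * of_int g) \<in> I" by (intro ID(2) ID(3) 4 gu of_int_in_\<O>)
    also have "of_int k * (4 * u) + of_int l * (u * of_int g) = of_int (k * 4 + l * g) * u"
      by (simp add: algebra_simps)
    finally show ?thesis unfolding kl by simp
  qed
qed

lemma ideal_eq_ideal_set:
  assumes I: "ideal I \<O>" and gen: "of_int g \<in> I" "of_int h * s \<in> I" "\<beta> \<in> I" "\<beta>' \<in> I"
    and g: "coord_divisor = 1 \<Longrightarrow> odd g" "g > 0" and h: "coord_divisor = 1 \<Longrightarrow> odd h" "h > 0"
    and J: "ideal (ideal_set g h) \<O>"
    and ord: "order (\<O> Quot I) = nat (g * h)"
  shows "I = ideal_set g h"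
proof -
  have "ideal_set g h = I"
    by (rule ideal_eq_if_subset_same_order[OF I J ideal_set_subset[OF I gen g(1)]])
      (use order_ideal_set[OF J g h] ord g h in simp_all)
  then show ?thesis by simp
qed

lemma ideal_set_nonzero:
  assumes "g > 0"
  shows "ideal_set g h \<noteq> {0}"
proof -
  have "qel (4 * g) 0 0 0 \<in> ideal_set g h"
    unfolding qel_in_ideal_set_iff ideal_lattice_def using integral_coords_4[of g 0 0 0]
    by (auto simp: coord_divisor_def)
  moreover have "qel (4 * g) 0 0 0 \<noteq> 0" using assms by (simp add: qel_def el_eq_0_iff)
  ultimately show ?thesis by auto
qed

text \<open>
  The quotient ring has squarefree order \<open>p\<close>, so an ideal of norm \<open>p\<close> contains every integer whose square it contains:
  first \<open>s\<close>, because \<open>s\<^sup>2 = d\<close> is a multiple of \<open>p\<close>, and then \<open>\<beta>\<close> and \<open>\<beta>'\<close>.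
\<close>

lemma nonzero_ideal_of_ramified_norm_iff:
  fixes p :: nat
  assumes p: "p \<ge> 1" "int p dvd d"
  shows "nonzero_ideal_of_norm K p I \<longleftrightarrow> I = ideal_set (int p) 1"
proof -
  have odd: "coord_divisor = 1 \<Longrightarrow> odd (int p)"
    using p(2) by (auto simp: coord_divisor_def split: if_splits)
  have J: "ideal (ideal_set (int p) 1) \<O>"
    using p odd by (intro ideal_set_ideal) auto
  have ordJ: "order (\<O> Quot ideal_set (int p) 1) = p"
    using order_ideal_set[OF J odd] p by simp
  show ?thesis
  proof
    assume "nonzero_ideal_of_norm K p I"
    then have I: "ideal I \<O>" and ord: "order (\<O> Quot I) = p" by (simp_all add: nonzero_ideal_of_norm_def)
    note ID = idealD_\<O>[OF I]
    have p0: "p > 0" using p by simp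
    note Q = quotient_facts[OF I ord p0]
    interpret T: cring "\<O> Quot I" by (rule Q(1))
    have "squarefree (int p)" using squarefree_mono[OF p(2) squarefree_d] .
    then have sq: "squarefree (order (\<O> Quot I))"
      unfolding ord by (metis (no_types, lifting) squarefree_def int_dvd_int_iff of_nat_power of_nat_1)
    have nil: "u \<in> I" if u: "u \<in> carrier \<O>" "u * u \<in> I" for u
      using contains_if_contains_square[OF I ord p0 _ u] T.nilpotent_eq_zero_if_squarefree_order[OF _ _ Q(2) sq] by blast
    obtain k where k: "d = int p * k" using p(2) by blast
    have dI: "of_int d * u \<in> I" if "u \<in> carrier \<O>" for u
    proof -
      have "of_int k * u \<in> carrier \<O>"
        using that of_int_in_\<O>[of k] by (simp add: K_mult algebraic_int_K_mult)
      from ID(3)[OF Q(7) this] show ?thesis unfolding k by (simp add: mult_ac)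
    qed
    have "s * s \<in> I" using dI[of 1] of_int_in_\<O>[of 1] s_s by simp
    with generators_in_\<O>(1) have sI: "s \<in> I" by (rule nil)
    have "of_int d * of_int a - of_int (a * b) * s \<in> I" "of_int d * of_int a + of_int (a * b) * s \<in> I"
      by (rule ID(5)[OF dI[OF of_int_in_\<O>] ID(3)[OF sI of_int_in_\<O>]]
          ID(2)[OF dI[OF of_int_in_\<O>] ID(3)[OF sI of_int_in_\<O>]])+
    then have "\<beta> * \<beta> \<in> I" "\<beta>' * \<beta>' \<in> I" unfolding \<beta>_\<beta> \<beta>'_\<beta>' by (simp_all add: mult.commute)
    then have "\<beta> \<in> I" "\<beta>' \<in> I" using nil generators_in_\<O>(2,3) by blast+
    then show "I = ideal_set (int p) 1"
      using ideal_eq_ideal_set[OF I, of "int p" 1] Q(7) sI odd p J ord by simp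
  next
    assume "I = ideal_set (int p) 1"
    then show "nonzero_ideal_of_norm K p I"
      using J ordJ ideal_set_nonzero[of "int p" 1] p by (simp add: nonzero_ideal_of_norm_def)
  qed
qed

text \<open>
  The quotient ring has order \<open>q\<^sup>2\<close> and contains a square root of \<open>d\<close>, so it is reduced. The ideal contains \<open>q\<^sup>2\<close>,
  hence \<open>q\<close>, hence \<open>a\<close> and the squares of \<open>\<beta>\<close> and \<open>\<beta>'\<close>.
\<close>

lemma nonzero_ideal_of_inert_norm_iff:
  fixes q :: nat
  assumes q: "q \<ge> 1" "int q dvd a" "\<forall>r::nat. Factorial_Ring.prime r \<and> r dvd q \<longrightarrow> \<not> QuadRes (int r) d"
  shows "nonzero_ideal_of_norm K (q\<^sup>2) I \<longleftrightarrow> I = ideal_set (int q) (int q)"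
proof -
  have odd: "odd (int q)" using q(2) odd_a dvd_trans by blast
  have J: "ideal (ideal_set (int q) (int q)) \<O>"
    using q odd by (intro ideal_set_ideal) auto
  have ordJ: "order (\<O> Quot ideal_set (int q) (int q)) = q\<^sup>2"
    using order_ideal_set[OF J] odd q by (simp add: power2_eq_square nat_mult_distrib)
  show ?thesis
  proof
    assume "nonzero_ideal_of_norm K (q\<^sup>2) I"
    then have I: "ideal I \<O>" and ord: "order (\<O> Quot I) = q\<^sup>2" by (simp_all add: nonzero_ideal_of_norm_def)
    note ID = idealD_\<O>[OF I]
    have q0: "q\<^sup>2 > 0" using q by simp
    note Q = quotient_facts[OF I ord q0]
    interpret T: cring "\<O> Quot I" by (rule Q(1))
    have "squarefree (int q)" using squarefree_mono[OF q(2) squarefree_a] .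
    then have sq: "squarefree q"
      by (metis (no_types, lifting) squarefree_def int_dvd_int_iff of_nat_power of_nat_1)
    have ss: "(I +>\<^bsub>\<O>\<^esub> s) \<otimes>\<^bsub>\<O> Quot I\<^esub> (I +>\<^bsub>\<O>\<^esub> s) = [d] \<cdot>\<^bsub>\<O> Quot I\<^esub> \<one>\<^bsub>\<O> Quot I\<^esub>"
      using Q(4)[OF generators_in_\<O>(1) generators_in_\<O>(1)] Q(6)[of d] s_s by simp
    have nil: "u \<in> I" if u: "u \<in> carrier \<O>" "u * u \<in> I" for u
      using contains_if_contains_square[OF I ord q0 _ u] q(3)
        T.nilpotent_eq_zero_if_no_root[OF _ _ Q(2) ord sq Q(5)[OF generators_in_\<O>(1)] ss] by blast
    have "of_int (int q) * of_int (int q) \<in> I" using Q(7) by (simp add: power2_eq_square)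
    with of_int_in_\<O> have qI: "of_int (int q) \<in> I" by (rule nil)
    obtain k where k: "a = int q * k" using q(2) by blast
    have aI: "of_int a * u \<in> I" if "u \<in> carrier \<O>" for u
    proof -
      have "of_int k * u \<in> carrier \<O>"
        using that of_int_in_\<O>[of k] by (simp add: K_mult algebraic_int_K_mult)
      from ID(3)[OF qI this] show ?thesis unfolding k by (simp add: mult_ac)
    qed
    have bs: "of_int b * s \<in> carrier \<O>"
      using of_int_in_\<O>[of b] generators_in_\<O>(1) by (simp add: K_mult algebraic_int_K_mult)
    have "of_int a * of_int d - of_int a * (of_int b * s) \<in> I" "of_int a * of_int d + of_int a * (of_int b * s) \<in> I"
      by (rule ID(5)[OF aI[OF of_int_in_\<O>] aI[OF bs]] ID(2)[OF aI[OF of_int_in_\<O>] aI[OF bs]])+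
    then have "\<beta> * \<beta> \<in> I" "\<beta>' * \<beta>' \<in> I" unfolding \<beta>_\<beta> \<beta>'_\<beta>' by (simp_all add: mult.assoc)
    then have "\<beta> \<in> I" "\<beta>' \<in> I" using nil generators_in_\<O>(2,3) by blast+
    moreover have "of_int (int q) * s \<in> I"
      using ID(3)[OF qI generators_in_\<O>(1)] by (simp add: mult.commute)
    ultimately show "I = ideal_set (int q) (int q)"
      using ideal_eq_ideal_set[OF I, of "int q" "int q"] qI odd q J ord
      by (simp add: power2_eq_square nat_mult_distrib)
  next
    assume "I = ideal_set (int q) (int q)"
    then show "nonzero_ideal_of_norm K (q\<^sup>2) I"
      using J ordJ ideal_set_nonzero[of "int q" "int q"] q by (simp add: nonzero_ideal_of_norm_def)
  qed
qed

end

section \<open>Well-rounded ideals\<close>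

context cyclic_quartic
begin

lemma embedding_add_scale:
  assumes f: "f \<in> embeddings K" and u: "u \<in> K" "v \<in> K"
  shows "f (u + v) = f u + f v" "f (of_rat r * u) = of_rat r * f u"
proof -
  show "f (u + v) = f u + f v" using assms by (auto simp: embeddings_def ring_hom_def)
  have "f (of_rat r * u) = f (of_rat r) * f u"
    using assms K_rat by (auto simp: embeddings_def ring_hom_def)
  then show "f (of_rat r * u) = of_rat r * f u" using embedding_el(2)[OF f] by simp
qed

lemma canonical_embedding_add:
  assumes \<tau>: "bij_betw \<tau> UNIV (embeddings K)" and u: "u \<in> K" "v \<in> K"
  shows "canonical_embedding \<tau> (u + v) = canonical_embedding \<tau> u + canonical_embedding \<tau> v"
proof -
  have mem: "\<tau> i \<in> embeddings K" for i using \<tau> by (auto simp: bij_betw_def)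
  show ?thesis
    by (simp add: canonical_embedding_def Finite_Cartesian_Product.vec_eq_iff embedding_add_scale(1)[OF mem u])
qed

lemma canonical_embedding_scale:
  assumes \<tau>: "bij_betw \<tau> UNIV (embeddings K)" and u: "u \<in> K"
  shows "canonical_embedding \<tau> (of_rat r * u) = of_rat r *\<^sub>R canonical_embedding \<tau> u"
proof -
  have mem: "\<tau> i \<in> embeddings K" for i using \<tau> by (auto simp: bij_betw_def)
  have of_rat: "(of_rat r :: complex) = of_real (of_rat r)" by (cases r) (simp add: of_rat_rat)
  have "\<tau> i (of_rat r * u) = of_rat r *\<^sub>R \<tau> i u" for i
    unfolding embedding_add_scale(2)[OF mem u u] by (simp add: of_rat scaleR_conv_of_real)
  then show ?thesis
    by (simp add: canonical_embedding_def Finite_Cartesian_Product.vec_eq_iff)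
qed

lemma norm_canonical_embedding:
  assumes \<tau>: "bij_betw \<tau> UNIV (embeddings K)"
  shows "(norm (canonical_embedding \<tau> (qel x y z w)))\<^sup>2 =
    1 / 4 * of_int (x\<^sup>2 + d * y\<^sup>2 + \<bar>a\<bar> * d * (z\<^sup>2 + w\<^sup>2))"
proof -
  have "(norm (canonical_embedding \<tau> (qel x y z w)))\<^sup>2 = (\<Sum>i\<in>UNIV. (cmod (\<tau> i (qel x y z w)))\<^sup>2)"
    by (simp add: norm_vec_def L2_set_def canonical_embedding_def sum_nonneg)
  also have "\<dots> = (\<Sum>f\<in>embeddings K. (cmod (f (qel x y z w)))\<^sup>2)"
    by (rule sum.reindex_bij_betw[OF \<tau>])
  also have "\<dots> = of_rat (4 * ((of_int x / 4)\<^sup>2 + of_int d * (of_int y / 4)\<^sup>2 +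
      of_int (\<bar>a\<bar> * d) * ((of_int z / 4)\<^sup>2 + (of_int w / 4)\<^sup>2)))"
    unfolding qel_def norm_square_el ..
  also have "4 * ((of_int x / 4)\<^sup>2 + of_int d * (of_int y / 4)\<^sup>2 +
      of_int (\<bar>a\<bar> * d) * ((of_int z / 4)\<^sup>2 + (of_int w / 4)\<^sup>2)) =
      (of_int (x\<^sup>2 + d * y\<^sup>2 + \<bar>a\<bar> * d * (z\<^sup>2 + w\<^sup>2)) / 4 :: rat)"
    by (simp add: field_simps power_divide)
  also have "of_rat (of_int (x\<^sup>2 + d * y\<^sup>2 + \<bar>a\<bar> * d * (z\<^sup>2 + w\<^sup>2)) / 4 :: rat) =
      (1 / 4 * of_int (x\<^sup>2 + d * y\<^sup>2 + \<bar>a\<bar> * d * (z\<^sup>2 + w\<^sup>2)) :: real)"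
    by (simp only: of_rat_divide of_rat_of_int_eq) simp
  finally show ?thesis .
qed

abbreviation (input) "axis1 \<tau> \<equiv> canonical_embedding \<tau> (qel 1 0 0 0)"
abbreviation (input) "axis2 \<tau> \<equiv> canonical_embedding \<tau> (qel 0 1 0 0)"
abbreviation (input) "axis3 \<tau> \<equiv> canonical_embedding \<tau> (qel 0 0 1 0)"
abbreviation (input) "axis4 \<tau> \<equiv> canonical_embedding \<tau> (qel 0 0 0 1)"

text \<open>Orthogonality follows from the norm formula by polarisation, since its mixed terms vanish.\<close>

lemma canonical_frame:
  fixes \<tau> :: "'n::finite \<Rightarrow> complex \<Rightarrow> complex"
  defines "E \<equiv> canonical_embedding \<tau>"
  defines "e1 \<equiv> axis1 \<tau>" and "e2 \<equiv> axis2 \<tau>" and "e3 \<equiv> axis3 \<tau>" and "e4 \<equiv> axis4 \<tau>"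
  assumes \<tau>: "bij_betw \<tau> UNIV (embeddings K)"
  shows "orthogonal_frame e1 e2 e3 e4 (1 / 4) d (\<bar>a\<bar> * d)" (is ?frame)
    and "minkowski_space \<tau> K = span {e1, e2, e3, e4}"
    and "E (qel x y z w) = orthogonal_frame.vec e1 e2 e3 e4 x y z w"
proof -
  note lin = canonical_embedding_add[OF \<tau>, folded E_def] canonical_embedding_scale[OF \<tau>, folded E_def]
  note nrm = norm_canonical_embedding[OF \<tau>, folded E_def]
  have sq: "v \<bullet> v = (norm v)\<^sup>2" for v :: "complex ^ 'n" by (simp add: power2_norm_eq_inner)
  have E_el: "E (el x y z w) = of_rat (4 * x) *\<^sub>R e1 + of_rat (4 * y) *\<^sub>R e2 + of_rat (4 * z) *\<^sub>R e3 + of_rat (4 * w) *\<^sub>R e4"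
    for x y z w
  proof -
    have "el x y z w = of_rat (4 * x) * qel 1 0 0 0 + of_rat (4 * y) * qel 0 1 0 0
        + of_rat (4 * z) * qel 0 0 1 0 + of_rat (4 * w) * qel 0 0 0 1"
      by (simp add: el_def qel_def of_rat_mult of_rat_divide)
    then show ?thesis
      by (simp add: lin K_add K_mult K_rat e1_def e2_def e3_def e4_def flip: E_def)
  qed
  show ?frame
  proof
    have ip: "E u \<bullet> E v = ((norm (E (u + v)))\<^sup>2 - (norm (E u))\<^sup>2 - (norm (E v))\<^sup>2) / 2" if "u \<in> K" "v \<in> K" for u v
      unfolding lin(1)[OF that] by (rule dot_norm)
    show "e1 \<bullet> e2 = 0" "e1 \<bullet> e3 = 0" "e1 \<bullet> e4 = 0" "e2 \<bullet> e3 = 0" "e2 \<bullet> e4 = 0" "e3 \<bullet> e4 = 0"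
      unfolding e1_def e2_def e3_def e4_def E_def[symmetric] by (simp_all add: ip qel_add nrm algebra_simps)
    show "e1 \<bullet> e1 = 1 / 4" "e2 \<bullet> e2 = 1 / 4 * of_int d" "e3 \<bullet> e3 = 1 / 4 * of_int (\<bar>a\<bar> * d)" "e4 \<bullet> e4 = 1 / 4 * of_int (\<bar>a\<bar> * d)"
      unfolding e1_def e2_def e3_def e4_def E_def[symmetric] sq nrm by simp_all
    show "(1 / 4 :: real) > 0" "d > 0" "\<bar>a\<bar> * d > 0" using d_ge_2 a_nonzero by simp_all
  qed
  then interpret orthogonal_frame e1 e2 e3 e4 "1 / 4" d "\<bar>a\<bar> * d" .
  show "E (qel x y z w) = vec x y z w"
    unfolding qel_def E_el by (simp add: vec_def)
  show "minkowski_space \<tau> K = span {e1, e2, e3, e4}"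
  proof
    show "minkowski_space \<tau> K \<subseteq> span {e1, e2, e3, e4}"
      unfolding minkowski_space_def E_def[symmetric]
    proof (rule span_minimal)
      show "E ` K \<subseteq> span {e1, e2, e3, e4}"
        by (auto elim!: K_cases simp: E_el intro!: span_add span_scale intro: span_base)
    qed simp
    have "{e1, e2, e3, e4} \<subseteq> E ` K" by (auto simp: e1_def e2_def e3_def e4_def E_def)
    then show "span {e1, e2, e3, e4} \<subseteq> minkowski_space \<tau> K"
      unfolding minkowski_space_def E_def[symmetric] by (rule span_mono)
  qed
qed

lemma well_rounded_ideal_set_iff_lattice:
  assumes \<tau>: "bij_betw \<tau> UNIV (embeddings K)"
  shows "well_rounded_ideal \<tau> K (ideal_set g h) \<longleftrightarrow>
    well_rounded (span {axis1 \<tau>, axis2 \<tau>, axis3 \<tau>, axis4 \<tau>})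
      {orthogonal_frame.vec (axis1 \<tau>) (axis2 \<tau>) (axis3 \<tau>) (axis4 \<tau>) x y z w | x y z w. ideal_lattice g h x y z w}"
proof -
  have "canonical_embedding \<tau> ` ideal_set g h = {canonical_embedding \<tau> (qel x y z w) | x y z w. ideal_lattice g h x y z w}"
    unfolding ideal_set_def by blast
  then show ?thesis
    unfolding well_rounded_ideal_def canonical_frame(2)[OF \<tau>] canonical_frame(3)[OF \<tau>, symmetric] by simp
qed

lemma unramified_imp_odd_c: "odd d \<Longrightarrow> unramified_at_2 \<Longrightarrow> odd c"
  unfolding d_eq unramified_at_2_def by simp

lemma well_rounded_ideal_set_unramified_iff:
  fixes g h :: int
  defines "u \<equiv> g\<^sup>2" and "v \<equiv> d * h\<^sup>2" and "t \<equiv> \<bar>a\<bar> * d"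
  assumes \<tau>: "bij_betw \<tau> UNIV (embeddings K)" and d: "odd d" and unramified_at_2: unramified_at_2
    and gh: "odd g" "odd h" "g > 0" "h > 0"
  shows "well_rounded_ideal \<tau> K (ideal_set g h) \<longleftrightarrow>
    u + v + 2 * t \<le> 4 * (u + v) \<and> u + v + 2 * t \<le> 4 * (u + t) \<and> u + v + 2 * t \<le> 4 * (v + t) \<and>
    u + v + 2 * t \<le> 8 * t \<and> u + v + 2 * t \<le> 16 * u \<and> u + v + 2 * t \<le> 16 * v"
proof -
  interpret frame: orthogonal_frame "axis1 \<tau>" "axis2 \<tau>" "axis3 \<tau>" "axis4 \<tau>" "1 / 4" d "\<bar>a\<bar> * d"
    by (rule canonical_frame(1)[OF \<tau>])
  have L: "ideal_lattice g h x y z w \<longleftrightarrow> g dvd x \<and> h dvd y \<and>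
      (odd x \<and> odd y \<and> odd z \<and> odd w \<and> 4 dvd x * y - (a * c) * z * w \<or>
       even x \<and> even y \<and> even z \<and> even w \<and> even (x div 2 + y div 2 + z div 2 + w div 2))" for x y z w
  proof -
    have "integral_coords x y z w"
      if "even x" "even y" "even z" "even w" "even (x div 2 + y div 2 + z div 2 + w div 2)"
      using integral_coords_even[OF d unramified_at_2 that(5)] that(1-4) by simp
    then have "integral_coords x y z w \<longleftrightarrow> odd x \<and> odd y \<and> odd z \<and> odd w \<and> 4 dvd x * y - a * c * z * w \<or>
       even x \<and> even y \<and> even z \<and> even w \<and> even (x div 2 + y div 2 + z div 2 + w div 2)"
      using integral_coords_odd_d_imp[OF d] integral_coords_odd[OF d unramified_at_2] by blast
    then show ?thesis using d by (auto simp: ideal_lattice_def coord_divisor_def)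
  qed
  have "odd (a * c)" using odd_a unramified_imp_odd_c[OF d unramified_at_2] by simp
  from frame.well_rounded_D4_iff[OF gh this L] show ?thesis
    unfolding well_rounded_ideal_set_iff_lattice[OF \<tau>] u_def v_def t_def .
qed

lemma well_rounded_ideal_set_split:
  fixes g h :: int
  defines "u \<equiv> g\<^sup>2" and "v \<equiv> d * h\<^sup>2" and "t \<equiv> \<bar>a\<bar> * d"
  assumes \<tau>: "bij_betw \<tau> UNIV (embeddings K)" and d: "odd d" and unramified_at_2: "\<not> unramified_at_2"
    and gh: "odd g" "odd h" "g > 0" "h > 0"
    and wr: "well_rounded_ideal \<tau> K (ideal_set g h)"
  shows "u = v \<or> v \<le> 3 * u \<and> u \<le> 3 * v \<and> (u + v = 2 * t \<or> u + v = 4 * t)"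
proof -
  interpret frame: orthogonal_frame "axis1 \<tau>" "axis2 \<tau>" "axis3 \<tau>" "axis4 \<tau>" "1 / 4" d "\<bar>a\<bar> * d"
    by (rule canonical_frame(1)[OF \<tau>])
  have L: "g dvd x \<and> h dvd y \<and> even x \<and> even y \<and> even z \<and> even w \<and>
       even (x div 2 + y div 2) \<and> even (z div 2 + w div 2)" if "ideal_lattice g h x y z w" for x y z w
    using that d unramified_at_2 integral_coords_odd_d_imp[OF d] unfolding ideal_lattice_def coord_divisor_def by auto
  have L1: "ideal_lattice g h x y 0 0" if "ideal_lattice g h x y z w" for x y z w
    using that L[OF that] integral_coords_quadratic[OF d, of "x div 2" "y div 2"]
    by (simp add: ideal_lattice_def)
  have L2: "ideal_lattice g h (2 * g) (2 * h) 0 0"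
    using integral_coords_quadratic[OF d, of g h] gh d by (simp add: ideal_lattice_def coord_divisor_def)
  have L3: "ideal_lattice g h (4 * g) 0 0 0" "ideal_lattice g h 0 (4 * h) 0 0" "ideal_lattice g h 0 0 4 0"
    using integral_coords_4[of g 0 0 0] integral_coords_4[of 0 h 0 0] integral_coords_4[of 0 0 1 0] d
    by (simp_all add: ideal_lattice_def coord_divisor_def)
  show ?thesis
    unfolding u_def v_def t_def
    by (rule frame.well_rounded_split_lattice_imp[where L = "ideal_lattice g h", OF gh L L1 L2 L3])
      (use wr in \<open>simp_all only: well_rounded_ideal_set_iff_lattice[OF \<tau>]\<close>)
qed

lemma well_rounded_ideal_set_even_d:
  fixes g h :: int
  assumes \<tau>: "bij_betw \<tau> UNIV (embeddings K)" and d: "even d" and gh: "g > 0" "h > 0"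
    and wr: "well_rounded_ideal \<tau> K (ideal_set g h)"
  shows "g\<^sup>2 = d * h\<^sup>2"
proof -
  interpret frame: orthogonal_frame "axis1 \<tau>" "axis2 \<tau>" "axis3 \<tau>" "axis4 \<tau>" "1 / 4" d "\<bar>a\<bar> * d"
    by (rule canonical_frame(1)[OF \<tau>])
  have L: "4 * g dvd x \<and> 4 * h dvd y" if "ideal_lattice g h x y z w" for x y z w
    using that d by (simp add: ideal_lattice_def coord_divisor_def)
  have L': "ideal_lattice g h (4 * g) 0 0 0" "ideal_lattice g h 0 (4 * h) 0 0"
    using integral_coords_4[of g 0 0 0] integral_coords_4[of 0 h 0 0] d
    by (simp_all add: ideal_lattice_def coord_divisor_def)
  show ?thesis
    by (rule frame.well_rounded_rectangular_lattice_imp[where L = "ideal_lattice g h", OF gh L L'])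
      (use wr in \<open>simp_all only: well_rounded_ideal_set_iff_lattice[OF \<tau>]\<close>)
qed

lemma odd_d_iff_cong: "odd d \<longleftrightarrow> [d = 1] (mod 4)"
proof
  assume "odd d"
  then obtain e where "d = 4 * e + 1" by (rule odd_d_facts)
  then show "[d = 1] (mod 4)" by (simp add: cong_iff_dvd_diff)
next
  assume "[d = 1] (mod 4)"
  then have "4 dvd d - 1" by (simp add: cong_iff_dvd_diff)
  then show "odd d" by presburger
qed

lemma unramified_iff_cong: "unramified_at_2 \<longleftrightarrow> [b = 0] (mod 2) \<and> [a + b = 1] (mod 4)"
  by (simp add: unramified_at_2_def cong_iff_dvd_diff)

text \<open>
  With \<open>u = p\<^sup>2\<close> and \<open>v = d\<close>, the orthogonal cases would need \<open>p\<^sup>2 = d\<close> or \<open>p\<^sup>2 = 3d\<close>, which is impossible for a divisor \<open>p\<close> of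
  the squarefree number \<open>d \<noteq> 3\<close>. Otherwise the inequalities include \<open>(2|a| - 3) d \<le> 3p\<^sup>2\<close> and \<open>p\<^sup>2 \<le> (15 - 2|a|) d\<close>, which
  leave only \<open>|a| \<le> 6\<close>.
\<close>

lemma well_rounded_ramified_iff:
  fixes p :: nat
  assumes \<tau>: "bij_betw \<tau> UNIV (embeddings K)" and p: "p \<ge> 1" "int p dvd d"
  shows "well_rounded_ideal \<tau> K (ideal_set (int p) 1) \<longleftrightarrow>
    odd d \<and> unramified_at_2 \<and> (\<bar>a\<bar> = 1 \<and> d \<le> 5 * (int p)\<^sup>2 \<and> (int p)\<^sup>2 \<le> 5 * d \<or>
      \<bar>a\<bar> = 3 \<and> d \<le> (int p)\<^sup>2 \<and> (int p)\<^sup>2 \<le> 9 * d \<or>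
      \<bar>a\<bar> = 5 \<and> 7 * d \<le> 3 * (int p)\<^sup>2 \<and> (int p)\<^sup>2 \<le> 5 * d)"
    (is "?WR \<longleftrightarrow> _")
proof -
  obtain k where k: "d = int p * k" using p(2) by blast
  have "0 < int p * k" using k d_ge_2 by simp
  then have k0: "k > 0" by (rule zero_less_mult_pos) (use p in simp)
  have unit: "x = 1" if "x\<^sup>2 dvd d" "x > 0" for x
    using squarefreeD[OF squarefree_d that(1)] that(2) by simp
  have ne1: "(int p)\<^sup>2 \<noteq> d"
  proof
    assume *: "(int p)\<^sup>2 = d"
    have "int p = 1" by (rule unit) (use * p in simp_all)
    then show False using * d_ge_2 by simp
  qed
  have ne3: "(int p)\<^sup>2 \<noteq> 3 * d" if odd: "odd d"
  proof
    assume *: "(int p)\<^sup>2 = 3 * d"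
    then have "int p * int p = int p * (3 * k)" unfolding k by (simp add: power2_eq_square)
    then have pk: "int p = 3 * k" using p by simp
    then have dk: "d = 3 * k\<^sup>2" unfolding k by (simp add: power2_eq_square)
    then have "k = 1" using unit k0 by simp
    with dk have "d = 3" by simp
    moreover obtain e where "d = 4 * e + 1" using odd by (rule odd_d_facts)
    ultimately show False by presburger
  qed
  show ?thesis
  proof (cases "odd d \<and> unramified_at_2")
    case True
    then have d: "odd d" and g: unramified_at_2 by auto
    define P where "P = (int p)\<^sup>2"
    define t where "t = \<bar>a\<bar> * d"
    have "odd (int p)" using d p(2) dvd_trans by blast
    then have "?WR \<longleftrightarrow> P + d + 2 * t \<le> 4 * (P + d) \<and> P + d + 2 * t \<le> 4 * (P + t) \<and> P + d + 2 * t \<le> 4 * (d + t) \<and>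
      P + d + 2 * t \<le> 8 * t \<and> P + d + 2 * t \<le> 16 * P \<and> P + d + 2 * t \<le> 16 * d"
      using well_rounded_ideal_set_unramified_iff[OF \<tau> d g, of "int p" 1] p unfolding P_def t_def by simp
    also have "\<dots> \<longleftrightarrow> (\<bar>a\<bar> = 1 \<and> d \<le> 5 * P \<and> P \<le> 5 * d \<or> \<bar>a\<bar> = 3 \<and> d \<le> P \<and> P \<le> 9 * d \<or>
      \<bar>a\<bar> = 5 \<and> 7 * d \<le> 3 * P \<and> P \<le> 5 * d)"
    proof (cases "\<bar>a\<bar> \<le> 6")
      case True
      then have "\<bar>a\<bar> = 1 \<or> \<bar>a\<bar> = 3 \<or> \<bar>a\<bar> = 5" using odd_a by presburger
      then show ?thesis
      proof (elim disjE)
        assume "\<bar>a\<bar> = 1"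
        then show ?thesis using d_ge_2 by (auto simp: t_def)
      next
        assume "\<bar>a\<bar> = 3"
        then show ?thesis using d_ge_2 by (auto simp: t_def)
      next
        assume "\<bar>a\<bar> = 5"
        then show ?thesis using d_ge_2 by (auto simp: t_def)
      qed
    next
      case False
      then have "7 * d \<le> t" unfolding t_def using d_ge_2 by (intro mult_right_mono) auto
      then show ?thesis using False d_ge_2 by auto
    qed
    finally show ?thesis using True by (simp add: P_def)
  next
    case False
    have "\<not> ?WR"
    proof
      assume wr: ?WR
      show False
      proof (cases "even d")
        case True
        from well_rounded_ideal_set_even_d[OF \<tau> True _ _ wr] ne1 p show False by simp
      next
        case d: False
        have "odd (int p)" using d p(2) dvd_trans by blast
        then have *: "(int p)\<^sup>2 \<le> 3 * d" "(int p)\<^sup>2 + d = 2 * (\<bar>a\<bar> * d) \<or> (int p)\<^sup>2 + d = 4 * (\<bar>a\<bar> * d)"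
          using well_rounded_ideal_set_split[OF \<tau> d _ _ _ _ _ wr] False d p ne1 by auto
        have "\<bar>a\<bar> = 1"
        proof (rule ccontr)
          assume "\<bar>a\<bar> \<noteq> 1"
          then have "\<bar>a\<bar> \<ge> 3" using odd_a by presburger
          then have "3 * d \<le> \<bar>a\<bar> * d" using d_ge_2 by (intro mult_right_mono) auto
          then show False using * d_ge_2 by linarith
        qed
        then show False using * ne1 ne3[OF d] by auto
      qed
    qed
    then show ?thesis using False by blast
  qed
qed

text \<open>
  With \<open>u = q\<^sup>2\<close> and \<open>v = d q\<^sup>2\<close>, the element \<open>q\<close> is so short that \<open>d \<le> 9\<close> in the unramified case and \<open>d \<le> 3\<close> in the
  orthogonal cases.
\<close>

lemma well_rounded_inert_iff:
  fixes q :: nat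
  assumes \<tau>: "bij_betw \<tau> UNIV (embeddings K)" and q: "q \<ge> 1" "int q dvd a"
  shows "well_rounded_ideal \<tau> K (ideal_set (int q) (int q)) \<longleftrightarrow>
    d = 5 \<and> b = 2 \<and> c = 1 \<and> [a + b = 1] (mod 4) \<and> \<bar>a\<bar> \<le> (int q)\<^sup>2 \<and> (int q)\<^sup>2 \<le> 5 * \<bar>a\<bar>"
    (is "?WR \<longleftrightarrow> ?C")
proof -
  have odd_q: "odd (int q)" using q(2) odd_a dvd_trans by blast
  define T where "T = (int q)\<^sup>2"
  have T: "T > 0" using q by (simp add: T_def)
  have Td: "2 * T \<le> d * T" using d_ge_2 T by (intro mult_right_mono) auto
  show ?thesis
  proof (cases "odd d \<and> unramified_at_2")
    case True
    then have d: "odd d" and g: unramified_at_2 by auto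
    define t where "t = \<bar>a\<bar> * d"
    have WR: "?WR \<longleftrightarrow> T + d * T + 2 * t \<le> 4 * (T + d * T) \<and> T + d * T + 2 * t \<le> 4 * (T + t) \<and>
      T + d * T + 2 * t \<le> 4 * (d * T + t) \<and> T + d * T + 2 * t \<le> 8 * t \<and> T + d * T + 2 * t \<le> 16 * T \<and>
      T + d * T + 2 * t \<le> 16 * (d * T)"
      using well_rounded_ideal_set_unramified_iff[OF \<tau> d g odd_q odd_q] q unfolding T_def t_def by simp
    show ?thesis
    proof
      assume wr: ?WR
      then have "d * T \<le> 9 * T" unfolding WR by (smt (verit))
      then have "d \<le> 9" using T by simp
      moreover obtain e where "d = 4 * e + 1" using d by (rule odd_d_facts)
      ultimately have "d = 5 \<or> d = 9" using d_ge_2 by presburger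
      \<comment> \<open>\<open>d \<equiv> 1\<close> modulo 4 leaves 5 and 9, and 9 is not squarefree.\<close>
      moreover have "d \<noteq> 9" using squarefreeD[OF squarefree_d, of 3] by auto
      ultimately have d5: "d = 5" by simp
      have "even b" using g by (simp add: unramified_at_2_def)
      then obtain B where B: "b = 2 * B" by (rule evenE)
      have "B \<ge> 1" using b_pos B by simp
      then have "B\<^sup>2 \<ge> 1\<^sup>2" by (intro power_mono) auto
      have "c\<^sup>2 \<ge> 1" using c_pos by (simp add: int_one_le_iff_zero_less)
      moreover have "4 * B\<^sup>2 + c\<^sup>2 = 5" using d_eq d5 B by (simp add: power_mult_distrib)
      ultimately have "B\<^sup>2 = 1" "c\<^sup>2 = 1" using \<open>B\<^sup>2 \<ge> 1\<^sup>2\<close> by auto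
      then have "b = 2" "c = 1" using B \<open>B \<ge> 1\<close> c_pos by (auto simp: power2_eq_1_iff)
      then show ?C using wr g d5 unfolding WR unramified_iff_cong t_def T_def by auto
    next
      assume ?C
      then show ?WR unfolding WR t_def T_def by auto
    qed
  next
    case False
    have "\<not> ?WR"
    proof
      assume wr: ?WR
      show False
      proof (cases "even d")
        case True
        from well_rounded_ideal_set_even_d[OF \<tau> True _ _ wr] q Td T show False by (simp add: T_def)
      next
        case d: False
        then obtain e where "d = 4 * e + 1" by (rule odd_d_facts)
        then have "d \<ge> 5" using d_ge_2 by presburger
        then have "5 * T \<le> d * T" using T by (intro mult_right_mono) auto
        moreover have "T = d * T \<or> d * T \<le> 3 * T"
          using well_rounded_ideal_set_split[OF \<tau> d _ odd_q odd_q _ _ wr] False d q unfolding T_def by auto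
        ultimately show False using T by linarith
      qed
    qed
    moreover have "\<not> ?C"
    proof
      assume C: ?C
      then have "d = 5" "b = 2" and ab: "[a + b = 1] (mod 4)" by blast+
      then have "odd d" "[b = 0] (mod 2)" by (simp_all add: cong_0_iff)
      with ab have "odd d \<and> unramified_at_2" unfolding unramified_iff_cong by blast
      then show False using False by simp
    qed
    ultimately show ?thesis by blast
  qed
qed

end

theorem theorem1p5:
  fixes a b c d :: int
    and F :: "complex set"
    and \<tau> :: "4 \<Rightarrow> complex \<Rightarrow> complex"
    and p q :: nat
  assumes "squarefree a" and "odd a"
    and "d = b\<^sup>2 + c\<^sup>2" and "squarefree d"
    and "b > 0" and "c > 0" and "gcd a d = 1"
    and F: "F = cyclic_quartic_field a b d"
    and \<tau>: "bij_betw \<tau> UNIV (embeddings F)"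
    and p: "p \<ge> 1" "int p dvd d"
    and q: "q \<ge> 1" "int q dvd a"
      "\<forall>r::nat. Factorial_Ring.prime r \<and> r dvd q \<longrightarrow> \<not> QuadRes (int r) d"
  shows
    "(\<exists>!P. nonzero_ideal_of_norm F p P) \<and>
     (\<exists>!Q. nonzero_ideal_of_norm F (q\<^sup>2) Q) \<and>
     (\<forall>P. nonzero_ideal_of_norm F p P \<longrightarrow>
        (well_rounded_ideal \<tau> F P \<longleftrightarrow>
           [d = 1] (mod 4) \<and> [b = 0] (mod 2) \<and> [a + b = 1] (mod 4) \<and>
           (\<bar>a\<bar> = 1 \<and> 1 / 5 * real_of_int d \<le> (real p)\<^sup>2 \<and> (real p)\<^sup>2 \<le> 5 * real_of_int d \<or>
            \<bar>a\<bar> = 3 \<and> real_of_int d \<le> (real p)\<^sup>2 \<and> (real p)\<^sup>2 \<le> 9 * real_of_int d \<or>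
            \<bar>a\<bar> = 5 \<and> 7 / 3 * real_of_int d \<le> (real p)\<^sup>2 \<and> (real p)\<^sup>2 \<le> 5 * real_of_int d))) \<and>
     (\<forall>Q. nonzero_ideal_of_norm F (q\<^sup>2) Q \<longrightarrow>
        (well_rounded_ideal \<tau> F Q \<longleftrightarrow>
           d = 5 \<and> b = 2 \<and> c = 1 \<and> [a + b = 1] (mod 4) \<and>
           \<bar>a\<bar> \<le> (int q)\<^sup>2 \<and> (int q)\<^sup>2 \<le> 5 * \<bar>a\<bar>))"
proof -
  interpret cyclic_quartic a b c d
    using assms by unfold_locales (simp_all add: coprime_iff_gcd_eq_1)
  have FK: "F = K" unfolding F by (rule field_eq_K)
  have \<tau>K: "bij_betw \<tau> UNIV (embeddings K)" using \<tau> unfolding FK .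
  note idealP = nonzero_ideal_of_ramified_norm_iff[OF p]
  note idealQ = nonzero_ideal_of_inert_norm_iff[OF q]
  have P: "(real p)\<^sup>2 = real_of_int ((int p)\<^sup>2)" by simp
  have real: "1 / 5 * real_of_int d \<le> (real p)\<^sup>2 \<longleftrightarrow> d \<le> 5 * (int p)\<^sup>2" "(real p)\<^sup>2 \<le> 5 * real_of_int d \<longleftrightarrow> (int p)\<^sup>2 \<le> 5 * d"
    "real_of_int d \<le> (real p)\<^sup>2 \<longleftrightarrow> d \<le> (int p)\<^sup>2" "(real p)\<^sup>2 \<le> 9 * real_of_int d \<longleftrightarrow> (int p)\<^sup>2 \<le> 9 * d"
    "7 / 3 * real_of_int d \<le> (real p)\<^sup>2 \<longleftrightarrow> 7 * d \<le> 3 * (int p)\<^sup>2"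
    unfolding P by linarith+
  have WRP: "well_rounded_ideal \<tau> K (ideal_set (int p) 1) \<longleftrightarrow>
      [d = 1] (mod 4) \<and> [b = 0] (mod 2) \<and> [a + b = 1] (mod 4) \<and>
           (\<bar>a\<bar> = 1 \<and> 1 / 5 * real_of_int d \<le> (real p)\<^sup>2 \<and> (real p)\<^sup>2 \<le> 5 * real_of_int d \<or>
            \<bar>a\<bar> = 3 \<and> real_of_int d \<le> (real p)\<^sup>2 \<and> (real p)\<^sup>2 \<le> 9 * real_of_int d \<or>
            \<bar>a\<bar> = 5 \<and> 7 / 3 * real_of_int d \<le> (real p)\<^sup>2 \<and> (real p)\<^sup>2 \<le> 5 * real_of_int d)"
    unfolding well_rounded_ramified_iff[OF \<tau>K p] odd_d_iff_cong unramified_iff_cong real by blast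
  show ?thesis
    unfolding FK idealP idealQ using WRP well_rounded_inert_iff[OF \<tau>K q(1,2)] by simp
qed

end
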